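(* Let $\alpha,\beta>-1$, let $g\in H(\mathbb{D})$, and let $0<p<q<\infty$. Define the measure $\mu_{g,q,\beta}$ on $\mathbb{D}$ by $d\mu_{g,q,\beta}(z)=(1-|z|^2)^\beta|g'(z)|^q\,dA(z)$. Then the following statements hold. (1) If $p<\alpha+2$, then $T_g:D_\alpha^p\to D_\beta^q$ is bounded if and only if $\mu_{g,q,\beta}$ is a $\frac{q(\alpha+2-p)}{p}$-Carleson measure. (2) If $p=\alpha+2$, then $T_g:D_\alpha^p\to D_\beta^q$ is bounded if and only if there exists a constant $C>0$ such that for all intervals $I\subset\partial\mathbb{D}$, $\mu_{g,q,\beta}(S(I))\le C\left(\log\frac{1}{|I|}\right)^{(1/p-1)q}$. (3) If $p>\alpha+2$, then $T_g:D_\alpha^p\to D_\beta^q$ is bounded if and only if $\mu_{g,q,\beta}$ is a finite measure, or equivalently, if and only if $g\in D_\beta^q$.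
   Context: $\mathbb{D}$ is the open unit disk in $\mathbb{C}$, $H(\mathbb{D})$ is the space of analytic functions on $\mathbb{D}$, and $dA(z)=\frac1\pi\,dx\,dy$ is normalized area measure. For $0<p<\infty$ and $\alpha>-1$, the weighted Dirichlet space $D_\alpha^p$ is the set of $f\in H(\mathbb{D})$ with $\|f\|_{D_\alpha^p}=\left(|f(0)|^p+\int_{\mathbb{D}}|f'(z)|^p(1-|z|^2)^\alpha\,dA(z)\right)^{1/p}<\infty$. (For $p<1$ this is only a quasi-norm.) For $g\in H(\mathbb{D})$, the Volterra type operator is $(T_gf)(z)=\int_0^z f(\omega)g'(\omega)\,d\omega$, $f\in H(\mathbb{D})$. An operator $T:D_\alpha^p\to D_\beta^q$ is bounded if it maps $D_\alpha^p$ into $D_\beta^q$ and there is a constant $C$ with $\|Tf\|_{D_\beta^q}\le C\|f\|_{D_\alpha^p}$ for all $f\in D_\alpha^p$. For an interval (arc) $I\subset\partial\mathbb{D}$, $|I|$ is its normalized length (so $|\partial\mathbb{D}|=1$), and the Carleson square is $S(I)=\{re^{i\theta}: e^{i\theta}\in I,\ 1-|I|\le r<1\}$. For $s>0$, a positive Borel measure $\mu$ on $\mathbb{D}$ is an $s$-Carleson measure if there is $C>0$ with $\mu(S(I))\le C|I|^s$ for all intervals $I\subset\partial\mathbb{D}$. In (2) one has $p=\alpha+2>1$, so the exponent $(1/p-1)q$ is negative; when $|I|=1$ the right-hand side is read as $+\infty$. *)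

theory Defs
  imports "HOL-Complex_Analysis.Complex_Analysis"
begin

abbreviation unit_disk :: "complex set" where
  "unit_disk \<equiv> ball 0 1"

definition disk_area :: "complex measure" where
  "disk_area = scale_measure (ennreal (1 / pi)) (restrict_space lborel unit_disk)"

text \<open>Functions on the disk are total functions on the complex plane; every notion below depends
  only on their values inside the disk.\<close>

definition dirichlet_integral :: "real \<Rightarrow> real \<Rightarrow> (complex \<Rightarrow> complex) \<Rightarrow> ennreal" where
  "dirichlet_integral p \<alpha> f =
     (\<integral>\<^sup>+ z. ennreal (norm (deriv f z) powr p * (1 - (norm z)\<^sup>2) powr \<alpha>) \<partial>disk_area)"

definition dirichlet_space :: "real \<Rightarrow> real \<Rightarrow> (complex \<Rightarrow> complex) set" where
  "dirichlet_space p \<alpha> = {f. f holomorphic_on unit_disk \<and> dirichlet_integral p \<alpha> f < \<infinity>}"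

text \<open>Meaningful only for members of the space, since \<^const>\<open>enn2real\<close> sends infinity to 0.\<close>

definition dirichlet_norm :: "real \<Rightarrow> real \<Rightarrow> (complex \<Rightarrow> complex) \<Rightarrow> real" where
  "dirichlet_norm p \<alpha> f =
     (norm (f 0) powr p + enn2real (dirichlet_integral p \<alpha> f)) powr (1 / p)"

definition volterra :: "(complex \<Rightarrow> complex) \<Rightarrow> (complex \<Rightarrow> complex) \<Rightarrow> complex \<Rightarrow> complex" where
  "volterra g f z = contour_integral (linepath 0 z) (\<lambda>w. f w * deriv g w)"

definition bounded_dirichlet_operator ::
    "real \<Rightarrow> real \<Rightarrow> real \<Rightarrow> real \<Rightarrow> ((complex \<Rightarrow> complex) \<Rightarrow> complex \<Rightarrow> complex) \<Rightarrow> bool" where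
  "bounded_dirichlet_operator p \<alpha> q \<beta> T \<longleftrightarrow>
     (\<forall>f\<in>dirichlet_space p \<alpha>. T f \<in> dirichlet_space q \<beta>) \<and>
     (\<exists>C. \<forall>f\<in>dirichlet_space p \<alpha>. dirichlet_norm q \<beta> (T f) \<le> C * dirichlet_norm p \<alpha> f)"

definition arc_length :: "complex set \<Rightarrow> real" where
  "arc_length I = measure lborel {t \<in> {0..<2 * pi}. cis t \<in> I} / (2 * pi)"

text \<open>Arcs may be open, closed or half-open, and may be the whole circle; empty and one-point arcs
  are excluded.\<close>

definition circle_arc :: "complex set \<Rightarrow> bool" where
  "circle_arc I \<longleftrightarrow>
     (\<exists>a J. is_interval J \<and> J \<subseteq> {a..a + 2 * pi} \<and> I = cis ` J) \<and> 0 < arc_length I"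

definition carleson_square :: "complex set \<Rightarrow> complex set" where
  "carleson_square I = {of_real r * w | r w. w \<in> I \<and> 1 - arc_length I \<le> r \<and> r < 1}"

definition carleson_measure :: "real \<Rightarrow> complex measure \<Rightarrow> bool" where
  "carleson_measure s \<mu> \<longleftrightarrow>
     (\<exists>C>0. \<forall>I. circle_arc I \<longrightarrow>
        emeasure \<mu> (carleson_square I) \<le> ennreal (C * arc_length I powr s))"

definition volterra_measure :: "(complex \<Rightarrow> complex) \<Rightarrow> real \<Rightarrow> real \<Rightarrow> complex measure" where
  "volterra_measure g q \<beta> =
     density disk_area (\<lambda>z. ennreal ((1 - (norm z)\<^sup>2) powr \<beta> * norm (deriv g z) powr q))"

end

theory Submission
  imports Defs
begin

text \<open>
  Since \<open>(T\<^sub>g f)' = f g'\<close> and \<open>T\<^sub>g f\<close> vanishes at the origin, boundedness of \<open>T\<^sub>g\<close> means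
  \<open>\<integral> \<bar>f\<bar>\<^sup>q d\<mu> \<le> C \<parallel>f\<parallel>\<^sup>q\<close> for all \<open>f\<close> in the Dirichlet space. Necessity is seen on the functions
  \<open>(1 - cnj a z)\<^bsup>-n\<^esup>\<close>, \<open>log (1 - cnj a z)\<close> and \<open>1\<close>.

  For sufficiency let \<open>\<tau> = (\<alpha> + 2 - p) / p\<close>. Integrating \<open>f'\<close> along a radius through the dyadic Whitney
  boxes and estimating \<open>f'\<close> on each box by the sub-mean value property bounds \<open>\<bar>f\<bar>\<close> on a box of
  generation \<open>n\<close> by a sum \<open>A = \<Sum>\<^sub>k 2\<^bsup>k\<tau>\<^esup> h(Q\<^sub>k)\<close> over its ancestors, where \<open>\<Sum>\<^sub>Q h(Q)\<^sup>p\<close> is at most a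
  multiple of \<open>\<parallel>f\<parallel>\<^sup>p\<close>. For \<open>\<tau> < 0\<close> this makes \<open>f\<close> bounded. Otherwise a Hardy inequality on the dyadic
  tree is needed. For \<open>p > 1\<close>, telescoping \<open>A\<^sup>q\<close> along the path bounds \<open>\<integral> A\<^sup>q d\<mu>\<close> by a sum over \<open>Q\<close> that
  involves only the mass of the Carleson square of \<open>Q\<close>. Young's inequality separates \<open>h\<close>, and because
  \<open>q > p\<close> the remaining sum along each path is dominated by a convergent integral and comes back to a
  small multiple of \<open>\<integral> A\<^sup>q d\<mu>\<close>. The case \<open>p \<le> 1\<close> follows since \<open>A\<^sup>p \<le> \<Sum>\<^sub>k (2\<^bsup>k\<tau>\<^esup> h(Q\<^sub>k))\<^sup>p\<close>.
\<close>

section \<open>A Hardy inequality on trees\<close>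

text \<open>For p > 1 the conditions in (1) and (2) are the same condition on the tree. With w_j =
  2^(j \<tau>), p' = p/(p-1) and V_k = sum of w_j^p' over j \<le> k, it says that the Carleson
  square of a box of generation k has mass at most B V_k^(-q/p'). For \<tau> > 0 the sum V_k is
  comparable to its last term, which produces the power |I|^(q \<tau>); for \<tau> = 0 it is k + 1,
  which is comparable to log(1/|I|) for k \<ge> 1. The obstacle is that such a condition looks at
  one square at a time, while the inequality concerns all h at once. Two facts overcome it: Hoelder
  along a path caps A^p' by V_k when h has norm 1, and q/p - 1 > 0 makes the tail of the resulting
  one-dimensional integral converge. Absorbing a multiple of the integral of A^q into itself is
  legitimate only if that integral is finite. The trees are therefore cut at a finite depth, and
  every constant must be independent of the depth. Since \<alpha> > -1, an exponent p \<le> 1 forces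
  \<tau> > 0, so the reduction of small exponents is needed for geometric weights only.\<close>

lemma powr_MVT:
  fixes c u v :: real
  assumes "0 < u \<or> 0 < c" "0 \<le> u" "u < v"
  obtains z where "u < z" "z < v" "v powr c - u powr c = (v - u) * (c * z powr (c - 1))"
proof -
  \<comment> \<open>Differentiability is used on the open interval only; at \<open>u = 0\<close>
    continuity is enough, and that is what \<open>0 < c\<close> provides.\<close>
  have "continuous_on {u..v} (\<lambda>t. t powr c)"
    using assms by (auto intro!: continuous_intros continuous_on_powr')
  moreover have D: "DERIV (\<lambda>t. t powr c) x :> c * x powr (c - 1)" if "u < x" for x
    using that assms by (auto intro!: derivative_eq_intros)
  ultimately obtain l z where z: "u < z" "z < v" "DERIV (\<lambda>t. t powr c) z :> l" "v powr c - u powr c = (v - u) * l"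
    using MVT[of u v "\<lambda>t. t powr c"] assms(3) real_differentiable_def by blast
  with D[OF z(1)] DERIV_unique have "l = c * z powr (c - 1)" by blast
  with z that show ?thesis by blast
qed

text \<open>For c \<le> 1 the derivative c t^(c-1) decreases, so its value at the right endpoint
  times the step is at most the increment of t^c. \<open>powr_neg_tangent\<close> is the counterpart
  for t^(-1-d). Both serve to compare a sum with an integral.\<close>

lemma powr_concave_tangent:
  fixes c u v :: real
  assumes "0 < c" "c \<le> 1" "0 \<le> u" "u \<le> v" "0 < v"
  shows "c * (v powr (c - 1) * (v - u)) \<le> v powr c - u powr c"
proof (cases "u = v")
  case False
  with assms obtain z where z: "u < z" "z < v" "v powr c - u powr c = (v - u) * (c * z powr (c - 1))"
    using powr_MVT[of u c v] by auto
  have "v powr (c - 1) \<le> z powr (c - 1)" using z assms by (intro powr_mono2') auto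
  then have "(v - u) * (c * v powr (c - 1)) \<le> (v - u) * (c * z powr (c - 1))"
    using assms by (intro mult_left_mono) auto
  then show ?thesis using z(3) by (simp add: mult_ac)
qed auto

lemma powr_neg_tangent:
  fixes d u v :: real
  assumes "0 < d" "0 < u" "u \<le> v"
  shows "d * (v powr (- 1 - d) * (v - u)) \<le> u powr (- d) - v powr (- d)"
proof (cases "u = v")
  case False
  with assms obtain z where z: "u < z" "z < v" "v powr (- d) - u powr (- d) = (v - u) * (- d * z powr (- d - 1))"
    using powr_MVT[of u "- d" v] by auto
  have "v powr (- d - 1) \<le> z powr (- d - 1)" using z assms by (intro powr_mono2') auto
  then have "(v - u) * (d * v powr (- d - 1)) \<le> (v - u) * (d * z powr (- d - 1))"
    using assms by (intro mult_left_mono) auto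
  also have "\<dots> = u powr (- d) - v powr (- d)" using z(3) by (simp add: algebra_simps)
  also have "- d - 1 = - 1 - d" by simp
  finally show ?thesis by (simp add: mult_ac)
qed auto

text \<open>The left side is a right-endpoint Riemann sum, with nodes \<open>W k\<close> and steps
  \<open>v k\<close>, of t^(-1-d) min(Y,t)^(c+d). This function is t^(c-1) up to Y and a multiple of
  t^(-1-d) beyond, hence decreasing, and its integral over (0, \<infinity>) is Y^c (1/c + 1/d). The
  exponent c gives convergence at 0, d at infinity.\<close>

lemma sum_le_truncated_powr_integral:
  fixes v :: "nat \<Rightarrow> real" and c d Y :: real
  assumes c: "0 < c" "c \<le> 1" and d: "0 < d" and Y: "0 \<le> Y" and v: "\<And>k. 0 < v k"
  defines "W \<equiv> \<lambda>k. \<Sum>j\<le>k. v j"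
  shows "(\<Sum>k\<le>n. v k * W k powr (- 1 - d) * min Y (W k) powr (c + d)) \<le> (1 / c + 1 / d) * Y powr c"
proof (cases "Y = 0")
  case True
  have "0 < W k" for k unfolding W_def using v by (intro sum_pos) auto
  then have "min Y (W k) = 0" for k using True by (simp add: min_def less_imp_le)
  then show ?thesis using True by simp
next
  case False
  then have Y0: "0 < Y" using Y by simp
  \<comment> \<open>The primitive of the integrand that vanishes at 0; the second branch is
    normalized so that the two agree at t = Y.\<close>
  define G where "G t = (if t \<le> Y then t powr c / c
    else Y powr c / c + (Y powr c - Y powr (c + d) * t powr (- d)) / d)" for t
  have mono_int: "t powr (- 1 - d) * min Y t powr (c + d) * (t - s) \<le> G t - G s"
    if st: "0 \<le> s" "s \<le> t" "0 < t" for s t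
  proof -
    have low: "t powr (- 1 - d) * min Y t powr (c + d) * (t - s) \<le> G t - G s" 
      if "0 \<le> s" "s \<le> t" "0 < t" "t \<le> Y" for s t
    proof -
      have "t powr (- 1 - d) * t powr (c + d) = t powr (c - 1)"
        by (simp flip: powr_add)
      then show ?thesis
        using powr_concave_tangent[OF c that(1,2,3)] that c unfolding G_def
        by (simp add: field_simps min_absorb2)
    qed
    have high: "t powr (- 1 - d) * Y powr (c + d) * (t - s)
        \<le> (Y powr c - Y powr (c + d) * t powr (- d)) / d - (Y powr c - Y powr (c + d) * s powr (- d)) / d" 
      if "s \<le> t" "Y \<le> s" for s t
    proof -
      have "Y powr (c + d) * (d * (t powr (- 1 - d) * (t - s))) \<le> Y powr (c + d) * (s powr (- d) - t powr (- d))"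
        using powr_neg_tangent[OF d, of s t] that Y0 by (intro mult_left_mono) auto
      then have "t powr (- 1 - d) * Y powr (c + d) * (t - s) \<le> Y powr (c + d) * (s powr (- d) - t powr (- d)) / d"
        using d by (simp add: pos_le_divide_eq mult_ac)
      then show ?thesis by (simp add: algebra_simps flip: diff_divide_distrib)
    qed
    have YY: "Y powr (c + d) * Y powr (- d) = Y powr c" by (simp flip: powr_add)
    consider "t \<le> Y" | "Y < s" | "s \<le> Y" "Y < t" by linarith
    then show ?thesis
    proof cases
      case 1 then show ?thesis using low st by blast
    next
      case 2 then show ?thesis using high[of s t] st unfolding G_def by (simp add: min_absorb1)
    next
      case 3
      \<comment> \<open>The step straddles the corner at Y and is cut there. On the left piece the
        value at t is first raised to the larger value at Y.\<close>
      have "t powr (- 1 - d) * Y powr (c + d) * (Y - s) \<le> Y powr (- 1 - d) * Y powr (c + d) * (Y - s)"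
        using 3 Y0 d by (intro mult_right_mono powr_mono2') auto
      also have "\<dots> \<le> Y powr c / c - s powr c / c"
        using low[of s Y] 3 st Y0 unfolding G_def by simp
      finally have a: "t powr (- 1 - d) * Y powr (c + d) * (Y - s) \<le> Y powr c / c - s powr c / c" .
      have b: "t powr (- 1 - d) * Y powr (c + d) * (t - Y) \<le> (Y powr c - Y powr (c + d) * t powr (- d)) / d"
        using high[of Y t] 3 YY by simp
      have "G t - G s = Y powr c / c - s powr c / c + (Y powr c - Y powr (c + d) * t powr (- d)) / d"
        using 3 by (simp add: G_def)
      moreover have "t powr (- 1 - d) * min Y t powr (c + d) * (t - s) =
        t powr (- 1 - d) * Y powr (c + d) * (Y - s) + t powr (- 1 - d) * Y powr (c + d) * (t - Y)"
        using 3 by (simp add: min_absorb1 algebra_simps)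
      ultimately show ?thesis using a b by linarith
    qed
  qed
  have Wpos: "0 < W k" for k unfolding W_def using v by (intro sum_pos) auto
  have "(\<Sum>k\<le>n. v k * W k powr (- 1 - d) * min Y (W k) powr (c + d)) \<le> G (W n)"
  proof (induction n)
    case 0
    then show ?case using mono_int[of 0 "W 0"] Wpos[of 0] Y0 v[of 0] by (simp add: G_def W_def mult_ac)
  next
    case (Suc n)
    have "W (Suc n) - W n = v (Suc n)" by (simp add: W_def)
    then show ?case using Suc mono_int[of "W n" "W (Suc n)"] Wpos[of n] Wpos[of "Suc n"] v[of "Suc n"]
      by (simp add: mult_ac)
  qed
  also have "G (W n) \<le> (1 / c + 1 / d) * Y powr c"
  proof (cases "W n \<le> Y")
    case True
    then have "W n powr c \<le> Y powr c" using c Wpos[of n] by (intro powr_mono2) auto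
    then show ?thesis using True c d by (simp add: G_def field_simps add_increasing)
  next
    case False
    have "0 \<le> Y powr (c + d) * W n powr (- d)" by simp
    then show ?thesis using False c d by (simp add: G_def field_simps)
  qed
  finally show ?thesis .
qed

lemma powr_diff_le_tangent:
  fixes q x y :: real
  assumes "1 \<le> q" "0 \<le> y" "y \<le> x"
  shows "x powr q - y powr q \<le> q * ((x - y) * x powr (q - 1))"
proof (cases "x = y")
  case False
  with assms obtain z where z: "y < z" "z < x" "x powr q - y powr q = (x - y) * (q * z powr (q - 1))"
    using powr_MVT[of y q x] by auto
  have "z powr (q - 1) \<le> x powr (q - 1)" using z assms by (intro powr_mono2) auto
  then have "(x - y) * (q * z powr (q - 1)) \<le> (x - y) * (q * x powr (q - 1))"
    using assms by (intro mult_left_mono) auto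
  then show ?thesis using z(3) by (simp add: mult_ac)
qed auto

section \<open>Path sums and shadows on a finite tree\<close>

text \<open>The tree is given by its levels and by the map sending a node to its ancestor at a given
  level, which matches integer division of dyadic indices. Finiteness keeps all sums real, so that a
  multiple of a sum can be subtracted from both sides.\<close>

locale finite_tree =
  fixes T :: "'a set" and lev :: "'a \<Rightarrow> nat" and anc :: "nat \<Rightarrow> 'a \<Rightarrow> 'a"
  assumes finite_T: "finite T"
    and anc_in: "\<And>z j. z \<in> T \<Longrightarrow> j \<le> lev z \<Longrightarrow> anc j z \<in> T"
    and lev_anc: "\<And>z j. z \<in> T \<Longrightarrow> j \<le> lev z \<Longrightarrow> lev (anc j z) = j"
    and anc_anc: "\<And>z i j. z \<in> T \<Longrightarrow> i \<le> j \<Longrightarrow> j \<le> lev z \<Longrightarrow> anc i (anc j z) = anc i z"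
    and anc_self: "\<And>z. z \<in> T \<Longrightarrow> anc (lev z) z = z"
begin

definition path_sum :: "(nat \<Rightarrow> real) \<Rightarrow> ('a \<Rightarrow> real) \<Rightarrow> 'a \<Rightarrow> real" where
  "path_sum w h z = (\<Sum>j\<le>lev z. w j * h (anc j z))"

definition shadow :: "('a \<Rightarrow> real) \<Rightarrow> 'a \<Rightarrow> real" where
  "shadow m Q = (\<Sum>z | z \<in> T \<and> lev Q \<le> lev z \<and> anc (lev Q) z = Q. m z)"

lemma path_sum_anc:
  assumes "z \<in> T" "k \<le> lev z"
  shows "path_sum w h (anc k z) = (\<Sum>j\<le>k. w j * h (anc j z))"
  unfolding path_sum_def using assms by (simp add: lev_anc anc_anc)

text \<open>Pairs of a node and one of its ancestors are summed in the two possible orders. An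
  ancestor is determined by its level, so the ancestors of z correspond to the levels up to
  \<open>lev z\<close>.\<close>

lemma sum_paths_eq_sum_shadows:
  "(\<Sum>z\<in>T. m z * (\<Sum>k\<le>lev z. F (anc k z))) = (\<Sum>Q\<in>T. F Q * shadow m Q)"
proof -
  have "(\<Sum>z\<in>T. m z * (\<Sum>k\<le>lev z. F (anc k z)))
      = (\<Sum>z\<in>T. \<Sum>Q | Q \<in> T \<and> lev Q \<le> lev z \<and> anc (lev Q) z = Q. m z * F Q)"
  proof (intro sum.cong refl)
    fix z assume z: "z \<in> T"
    have "bij_betw (\<lambda>k. anc k z) {..lev z} {Q \<in> T. lev Q \<le> lev z \<and> anc (lev Q) z = Q}"
      using z by (intro bij_betwI[where g = lev]) (auto simp: lev_anc anc_in)
    then show "m z * (\<Sum>k\<le>lev z. F (anc k z))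
        = (\<Sum>Q | Q \<in> T \<and> lev Q \<le> lev z \<and> anc (lev Q) z = Q. m z * F Q)"
      by (simp add: sum_distrib_left sum.reindex_bij_betw[where g = "\<lambda>Q. m z * F Q", symmetric])
  qed
  also have "\<dots> = (\<Sum>Q\<in>T. \<Sum>z | z \<in> T \<and> lev Q \<le> lev z \<and> anc (lev Q) z = Q. m z * F Q)"
    using finite_T by (rule sum.swap_restrict[OF _ finite_T])
  finally show ?thesis by (simp add: shadow_def sum_distrib_left mult.commute)
qed

text \<open>Hoelder's inequality along one path, obtained from Young's inequality after dividing by
  U = V^(1/p'). The nodes of a path are distinct, so their part of the sum of h^p is at most 1. The
  bound A^p' \<le> V is what later truncates the sum along a path.\<close>

lemma path_sum_le_Holder:
  fixes p :: real and w :: "nat \<Rightarrow> real"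
  assumes p: "1 < p" and w: "\<And>k. 0 < w k" and h: "\<And>z. 0 \<le> h z"
    and H: "(\<Sum>z\<in>T. h z powr p) \<le> 1" and z: "z \<in> T"
  shows "path_sum w h z \<le> (\<Sum>j\<le>lev z. w j powr (p / (p - 1))) powr (1 - 1 / p)"
proof -
  define p' where "p' = p / (p - 1)"
  define V where "V = (\<Sum>j\<le>lev z. w j powr p')"
  have p': "1 < p'" "1 / p + 1 / p' = 1" "1 - 1 / p = 1 / p'" using p by (auto simp: p'_def field_simps)
  have V: "0 < V" unfolding V_def using w by (intro sum_pos) (auto simp: less_imp_neq[THEN not_sym])
  define U where "U = V powr (1 / p')"
  have U: "0 < U" using V by (simp add: U_def)
  have UV: "U powr p' = V" using V p' by (simp add: U_def powr_powr)
  have inj: "inj_on (\<lambda>j. anc j z) {..lev z}"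
    by (intro inj_on_inverseI[where g = lev]) (simp add: lev_anc z)
  have "path_sum w h z / U = (\<Sum>j\<le>lev z. h (anc j z) * (w j / U))"
    unfolding path_sum_def by (simp add: sum_divide_distrib mult_ac)
  also have "\<dots> \<le> (\<Sum>j\<le>lev z. h (anc j z) powr p / p + (w j / U) powr p' / p')"
    using U w h p p' by (intro sum_mono Youngs_inequality) (auto simp: less_imp_le)
  also have "\<dots> = (\<Sum>j\<le>lev z. h (anc j z) powr p) / p + (\<Sum>j\<le>lev z. w j powr p') / V / p'"
    using U w by (simp add: sum.distrib sum_divide_distrib powr_divide UV less_imp_le)
  also have "(\<Sum>j\<le>lev z. h (anc j z) powr p) \<le> 1"
  proof -
    have "(\<Sum>j\<le>lev z. h (anc j z) powr p) = (\<Sum>Q\<in>(\<lambda>j. anc j z) ` {..lev z}. h Q powr p)"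
      using inj by (simp add: sum.reindex)
    also have "\<dots> \<le> (\<Sum>z\<in>T. h z powr p)"
      using z anc_in finite_T by (intro sum_mono2) auto
    finally show ?thesis using H by linarith
  qed
  also have "(\<Sum>j\<le>lev z. w j powr p') / V = 1" using V by (simp add: V_def)
  finally have "path_sum w h z / U \<le> 1 / p + 1 / p'" using p by (simp add: divide_right_mono)
  then have "path_sum w h z \<le> U" using p' U by simp
  then show ?thesis unfolding U_def V_def p'(3)[symmetric] unfolding p'_def .
qed

text \<open>Write X for the left side, M(Q) for the shadow of Q and Y(Q) = w A^(q-1) M(Q).
  Telescoping gives X \<le> q times the sum of h Y, and the mass condition gives that the sum of
  Y^p' is at most K X. Young's inequality with a large parameter t then leaves X \<le> q t^p / p +
  X/2.\<close>

lemma sum_path_sum_powr_le_normalized: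
  fixes p q B :: real
  assumes p: "1 < p" and q: "p < q" and B: "0 \<le> B"
    and w: "\<And>k. 0 < w k" and h: "\<And>z. 0 \<le> h z" and m: "\<And>z. 0 \<le> m z"
    and H: "(\<Sum>z\<in>T. h z powr p) \<le> 1"
    and M: "\<And>Q. Q \<in> T \<Longrightarrow>
      shadow m Q \<le> B * (\<Sum>j\<le>lev Q. w j powr (p / (p - 1))) powr (- (q * (1 - 1 / p)))"
  shows "(\<Sum>z\<in>T. m z * path_sum w h z powr q)
    \<le> 2 * q / p * (2 * q * (B powr (1 / (p - 1)) * (p / (p - 1) + p / (q - p))) + 1) powr (p - 1)"
proof -
  define p' where "p' = p / (p - 1)"
  have p': "1 < p'" "1 / p + 1 / p' = 1" "1 - 1 / p = 1 / p'" "p' - 1 = 1 / (p - 1)" 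
    using p by (auto simp: p'_def field_simps)
  define A where "A = path_sum w h"
  define v where "v j = w j powr p'" for j
  define V where "V k = (\<Sum>j\<le>k. v j)" for k
  define c where "c = 1 - 1 / p"
  define d where "d = q / p - 1"
  define K where "K = B powr (1 / (p - 1)) * (p / (p - 1) + p / (q - p))"
  have c: "0 < c" "c \<le> 1" and d: "0 < d" using p q by (auto simp: c_def d_def field_simps)
  have K: "0 \<le> K" using p q by (auto simp: K_def)
  have v: "0 < v j" for j using w[of j] by (simp add: v_def)
  have V: "0 < V k" for k unfolding V_def using v by (intro sum_pos) auto
  have A0: "0 \<le> A z" for z
    unfolding A_def path_sum_def using w h by (intro sum_nonneg mult_nonneg_nonneg) (auto simp: less_imp_le)
  have A_anc: "A (anc k z) = (\<Sum>j\<le>k. w j * h (anc j z))" if "z \<in> T" "k \<le> lev z" for z k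
    using path_sum_anc[OF that] by (simp add: A_def)
  have A_anc_le: "A (anc k z) \<le> A z" if "z \<in> T" "k \<le> lev z" for z k
    unfolding A_anc[OF that] unfolding A_def path_sum_def using that w h
    by (intro sum_mono2) (auto simp: less_imp_le)
  have AV: "A z \<le> V (lev z) powr c" if "z \<in> T" for z
    using path_sum_le_Holder[OF p w h H that] by (simp add: A_def V_def v_def p'_def c_def)
  have M0: "0 \<le> shadow m Q" for Q unfolding shadow_def using m by (intro sum_nonneg) auto
  define X where "X = (\<Sum>z\<in>T. m z * A z powr q)"
  define Y where "Y Q = w (lev Q) * A Q powr (q - 1) * shadow m Q" for Q
  have Y0: "0 \<le> Y Q" for Q unfolding Y_def using w M0 by (simp add: less_imp_le)
  \<comment> \<open>Each increment of A^q along the path is at most q times the increment of A times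
    A^(q-1) at the lower end, where A is larger.\<close>
  have telescope: "A z powr q \<le> (\<Sum>k\<le>lev z. q * (w k * h (anc k z) * A (anc k z) powr (q - 1)))" 
    if z: "z \<in> T" for z
  proof -
    have "A (anc n z) powr q \<le> (\<Sum>k\<le>n. q * (w k * h (anc k z) * A (anc k z) powr (q - 1)))"
      if "n \<le> lev z" for n
      using that
    proof (induction n)
      case 0
      have "A (anc 0 z) = w 0 * h (anc 0 z)" using A_anc[OF z, of 0] by simp
      then show ?case
        using powr_diff_le_tangent[of q 0 "A (anc 0 z)"] A0[of "anc 0 z"] p q by simp
    next
      case (Suc n)
      have "A (anc (Suc n) z) = A (anc n z) + w (Suc n) * h (anc (Suc n) z)"
        using Suc.prems A_anc[OF z] by simp
      then show ?case
        using powr_diff_le_tangent[of q "A (anc n z)" "A (anc (Suc n) z)"] A0[of "anc n z"] p q Suc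
          w[of "Suc n"] h[of "anc (Suc n) z"]
        by simp
    qed
    from this[of "lev z"] show ?thesis using anc_self[OF z] by simp
  qed
  have "X \<le> (\<Sum>z\<in>T. m z * (\<Sum>k\<le>lev z. q * (w k * h (anc k z) * A (anc k z) powr (q - 1))))"
    unfolding X_def using telescope m by (intro sum_mono mult_left_mono) auto
  also have "\<dots> = (\<Sum>z\<in>T. m z * (\<Sum>k\<le>lev z.
      (\<lambda>Q. q * (w (lev Q) * h Q * A Q powr (q - 1))) (anc k z)))"
    by (intro sum.cong refl arg_cong2[where f = "(*)"]) (simp add: lev_anc)
  also have "\<dots> = (\<Sum>Q\<in>T. q * (h Q * Y Q))"
    by (subst sum_paths_eq_sum_shadows) (simp add: Y_def mult_ac)
  finally have X1: "X \<le> q * (\<Sum>Q\<in>T. h Q * Y Q)" by (simp add: sum_distrib_left)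

  \<comment> \<open>In M^p' = M^(1/(p-1)) M only the first factor is estimated by the hypothesis.
    Because q (1 - 1/p) / (p-1) = q/p = 1 + d, it turns into V^(-1-d); the second factor is kept, to
    be unfolded again into a sum over descendants.\<close>
  have Yp: "Y Q powr p' \<le> B powr (1 / (p - 1)) * (v (lev Q) * V (lev Q) powr (- 1 - d) *
      A Q powr (q - 1) * A Q powr ((q - 1) / (p - 1))) * shadow m Q" if Q: "Q \<in> T" for Q
  proof (cases "shadow m Q = 0")
    case False
    then have Mp: "0 < shadow m Q" using M0[of Q] by simp
    have "Y Q powr p' = v (lev Q) * A Q powr ((q - 1) * p') * shadow m Q powr p'"
      unfolding Y_def v_def using w M0 by (simp add: powr_mult powr_powr less_imp_le)
    also have "(q - 1) * p' = (q - 1) + (q - 1) / (p - 1)"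
      using p by (simp add: p'_def field_simps)
    also have "shadow m Q powr p' = shadow m Q powr (1 / (p - 1)) * shadow m Q"
      using Mp p'(4) by (simp add: powr_mult_base mult.commute flip: p'(4))
    finally have Yeq: "Y Q powr p' = shadow m Q powr (1 / (p - 1)) *
        (v (lev Q) * A Q powr (q - 1 + (q - 1) / (p - 1)) * shadow m Q)" by (simp add: mult_ac)
    have "shadow m Q powr (1 / (p - 1)) \<le> (B * V (lev Q) powr (- (q * (1 - 1 / p)))) powr (1 / (p - 1))"
      using M[OF Q] M0[of Q] p by (intro powr_mono2) (auto simp: V_def v_def p'_def)
    also have "\<dots> = B powr (1 / (p - 1)) * V (lev Q) powr (- 1 - d)"
    proof -
      have "(q * (1 - 1 / p)) * (1 / (p - 1)) = 1 + d" using p by (simp add: d_def field_simps)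
      then show ?thesis using B by (simp add: powr_mult powr_powr)
    qed
    finally have "Y Q powr p' \<le> (B powr (1 / (p - 1)) * V (lev Q) powr (- 1 - d)) *
        (v (lev Q) * A Q powr (q - 1 + (q - 1) / (p - 1)) * shadow m Q)"
      unfolding Yeq using v[of "lev Q"] Mp by (intro mult_right_mono) (auto simp: less_imp_le)
    then show ?thesis by (simp add: powr_add mult_ac)
  qed (use p' in \<open>simp add: Y_def\<close>)
  \<comment> \<open>The factor A^(q-1) is replaced by its value at the end of the path. The other
    one equals (A^p')^(c+d), where A^p' is bounded both by its end value and by V_k, hence by their
    minimum. The truncated integral then contributes (A^p')^c = A, which completes A^(q-1) to
    A^q.\<close>
  have inner: "(\<Sum>k\<le>lev z. v k * V k powr (- 1 - d) * A (anc k z) powr (q - 1) * A (anc k z) powr ((q - 1) / (p - 1)))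
      \<le> A z powr q * (p / (p - 1) + p / (q - p))" if z: "z \<in> T" for z
  proof -
    have e: "(c + d) * p' = (q - 1) / (p - 1)" "p' * c = 1"
      using p by (auto simp: c_def d_def p'_def field_simps)
    have "(\<Sum>k\<le>lev z. v k * V k powr (- 1 - d) * A (anc k z) powr (q - 1) * A (anc k z) powr ((q - 1) / (p - 1)))
      \<le> (\<Sum>k\<le>lev z. A z powr (q - 1) * (v k * V k powr (- 1 - d) * min (A z powr p') (V k) powr (c + d)))"
    proof (intro sum_mono)
      fix k assume "k \<in> {..lev z}"
      then have k: "k \<le> lev z" by simp
      have a: "A (anc k z) powr (q - 1) \<le> A z powr (q - 1)"
        using A_anc_le[OF z k] A0 p q by (intro powr_mono2) auto
      have "A (anc k z) powr p' \<le> (V k powr c) powr p'"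
        using AV[OF anc_in[OF z k]] A0 p' by (intro powr_mono2) (auto simp: lev_anc[OF z k])
      also have "\<dots> = V k" using e V[of k] by (simp add: powr_powr mult.commute)
      finally have "A (anc k z) powr p' \<le> min (A z powr p') (V k)"
        using A_anc_le[OF z k] A0 p' by (auto intro: powr_mono2)
      then have "(A (anc k z) powr p') powr (c + d) \<le> min (A z powr p') (V k) powr (c + d)"
        using c d by (intro powr_mono2) auto
      then have b: "A (anc k z) powr ((q - 1) / (p - 1)) \<le> min (A z powr p') (V k) powr (c + d)"
        by (simp add: powr_powr mult.commute[of p'] e)
      show "v k * V k powr (- 1 - d) * A (anc k z) powr (q - 1) * A (anc k z) powr ((q - 1) / (p - 1))
        \<le> A z powr (q - 1) * (v k * V k powr (- 1 - d) * min (A z powr p') (V k) powr (c + d))"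
        using mult_left_mono[OF mult_mono[OF a b], of "v k * V k powr (- 1 - d)"] v[of k]
        by (simp add: mult_ac less_imp_le)
    qed
    also have "\<dots> \<le> A z powr (q - 1) * ((1 / c + 1 / d) * (A z powr p') powr c)"
      unfolding sum_distrib_left[symmetric] V_def
      by (intro mult_left_mono sum_le_truncated_powr_integral c d v) auto
    also have "\<dots> = A z powr q * (1 / c + 1 / d)"
      using A0[of z] e powr_mult_base[of "A z" "q - 1"] by (simp add: powr_powr mult.commute)
    also have "1 / c + 1 / d = p / (p - 1) + p / (q - p)"
      using p q by (simp add: c_def d_def field_simps)
    finally show ?thesis .
  qed
  have "(\<Sum>Q\<in>T. Y Q powr p') \<le> (\<Sum>Q\<in>T. B powr (1 / (p - 1)) * (v (lev Q) * V (lev Q) powr (- 1 - d) *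
      A Q powr (q - 1) * A Q powr ((q - 1) / (p - 1))) * shadow m Q)"
    by (intro sum_mono Yp)
  also have "\<dots> = (\<Sum>z\<in>T. m z * (\<Sum>k\<le>lev z. B powr (1 / (p - 1)) * (v k * V k powr (- 1 - d) * 
      A (anc k z) powr (q - 1) * A (anc k z) powr ((q - 1) / (p - 1)))))"
    unfolding sum_paths_eq_sum_shadows[symmetric]
    by (intro sum.cong refl arg_cong2[where f = "(*)"]) (auto simp: lev_anc)
  also have "\<dots> \<le> (\<Sum>z\<in>T. m z * (B powr (1 / (p - 1)) * (A z powr q * (p / (p - 1) + p / (q - p)))))"
    unfolding sum_distrib_left[symmetric]
    by (intro sum_mono mult_left_mono inner m) auto
  also have "\<dots> = K * X" by (simp add: K_def X_def sum_distrib_left sum_distrib_right mult_ac)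
  finally have X2: "(\<Sum>Q\<in>T. Y Q powr p') \<le> K * X" .

  \<comment> \<open>Chosen with t^p' = 2 q K + 1, so that the term q K X / t^p' is at most X/2; the
    summand 1 keeps t positive when K = 0.\<close>
  define t where "t = (2 * q * K + 1) powr (1 / p')"
  have t0: "0 < 2 * q * K + 1" using K p q by (intro add_nonneg_pos) auto
  then have t: "0 < t" by (simp add: t_def)
  have tp': "t powr p' = 2 * q * K + 1" using t0 p' by (simp add: t_def powr_powr)
  have tp: "t powr p = (2 * q * K + 1) powr (p - 1)"
    using t0 p by (simp add: t_def powr_powr p'_def)
  have X0: "0 \<le> X" unfolding X_def using m by (intro sum_nonneg) auto
  have "(\<Sum>Q\<in>T. h Q * Y Q) = (\<Sum>Q\<in>T. (t * h Q) * (Y Q / t))" using t by simp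
  also have "\<dots> \<le> (\<Sum>Q\<in>T. (t * h Q) powr p / p + (Y Q / t) powr p' / p')"
    using t h Y0 p p' by (intro sum_mono Youngs_inequality) auto
  also have "\<dots> = t powr p / p * (\<Sum>Q\<in>T. h Q powr p) + (\<Sum>Q\<in>T. Y Q powr p') / t powr p' / p'"
    using t h Y0 by (simp add: sum.distrib powr_mult powr_divide sum_divide_distrib sum_distrib_left)
  also have "\<dots> \<le> t powr p / p * 1 + (K * X) / t powr p' / p'"
    using H X2 p p' by (intro add_mono mult_left_mono divide_right_mono) auto
  also have "(K * X) / t powr p' / p' \<le> (K * X) / t powr p'"
    using divide_left_mono[of 1 p' "(K * X) / t powr p'"] p' K X0 by simp
  finally have "q * (\<Sum>Q\<in>T. h Q * Y Q) \<le> q * (t powr p / p * 1 + (K * X) / t powr p')"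
    using p q by (intro mult_left_mono) auto
  then have "X \<le> q * (t powr p / p) + q * ((K * X) / t powr p')"
    using X1 by (simp only: distrib_left mult_1_right)
  moreover have "q * ((K * X) / t powr p') \<le> X / 2"
    using t0 X0 by (simp add: tp' divide_le_eq algebra_simps)
  ultimately have "X \<le> q * (t powr p / p) + X / 2" by linarith
  then have "X \<le> 2 * q / p * t powr p" by simp
  then show ?thesis unfolding tp by (simp add: X_def A_def K_def)
qed

text \<open>Both sides are homogeneous of degree q in h, so h is divided by its p-norm. The norm 0
  is treated apart: all path sums vanish then.\<close>

lemma sum_path_sum_powr_le:
  fixes p q B :: real
  assumes p: "1 < p" and q: "p < q" and B: "0 \<le> B"
    and w: "\<And>k. 0 < w k" and h: "\<And>z. 0 \<le> h z" and m: "\<And>z. 0 \<le> m z"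
    and M: "\<And>Q. Q \<in> T \<Longrightarrow>
      shadow m Q \<le> B * (\<Sum>j\<le>lev Q. w j powr (p / (p - 1))) powr (- (q * (1 - 1 / p)))"
  shows "(\<Sum>z\<in>T. m z * path_sum w h z powr q)
    \<le> 2 * q / p * (2 * q * (B powr (1 / (p - 1)) * (p / (p - 1) + p / (q - p))) + 1) powr (p - 1)
       * (\<Sum>z\<in>T. h z powr p) powr (q / p)"
    (is "_ \<le> ?C * _")
proof (cases "(\<Sum>z\<in>T. h z powr p) = 0")
  case True
  then have "h z = 0" if "z \<in> T" for z
    using that finite_T by (simp add: sum_nonneg_eq_0_iff)
  then have "path_sum w h z = 0" if "z \<in> T" for z
    using that anc_in by (simp add: path_sum_def)
  then show ?thesis using True p q by simp
next
  case False
  define H where "H = (\<Sum>z\<in>T. h z powr p) powr (1 / p)"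
  have H: "0 < H" using False by (simp add: H_def)
  have s0: "0 \<le> (\<Sum>z\<in>T. h z powr p)" by (intro sum_nonneg) auto
  have Hp: "H powr p = (\<Sum>z\<in>T. h z powr p)" using s0 p by (simp add: H_def powr_powr)
  have path: "path_sum w (\<lambda>z. h z / H) z = path_sum w h z / H" for z
    by (simp add: path_sum_def sum_divide_distrib)
  have "0 \<le> path_sum w h z" for z
    unfolding path_sum_def using w h by (intro sum_nonneg mult_nonneg_nonneg) (auto simp: less_imp_le)
  then have "(\<Sum>z\<in>T. m z * path_sum w h z powr q) / H powr q
      = (\<Sum>z\<in>T. m z * path_sum w (\<lambda>z. h z / H) z powr q)"
    using H by (simp add: path powr_divide sum_divide_distrib)
  also have "\<dots> \<le> ?C"
  proof (intro sum_path_sum_powr_le_normalized p q B w m M)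
    show "0 \<le> h z / H" for z using h H by simp
    show "(\<Sum>z\<in>T. (h z / H) powr p) \<le> 1"
      using h H by (simp add: powr_divide Hp False flip: sum_divide_distrib)
  qed
  finally have "(\<Sum>z\<in>T. m z * path_sum w h z powr q) \<le> ?C * H powr q"
    using H by (simp add: pos_divide_le_eq)
  also have "H powr q = (\<Sum>z\<in>T. h z powr p) powr (q / p)"
    using s0 by (simp add: H_def powr_powr)
  finally show ?thesis .
qed

end

section \<open>Geometric weights and exponents at most one\<close>

text \<open>After division by the sum every term is at most 1, and a power \<open>r\<close> \<ge> 1
  can only lower it.\<close>

lemma sum_powr_superadditive:
  fixes r :: real
  assumes r: "1 \<le> r" and x: "\<And>i. i \<in> I \<Longrightarrow> 0 \<le> x i" and I: "finite I"
  shows "(\<Sum>i\<in>I. x i powr r) \<le> (\<Sum>i\<in>I. x i) powr r"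
proof (cases "(\<Sum>i\<in>I. x i) = 0")
  case True
  then show ?thesis using x I by (simp add: sum_nonneg_eq_0_iff)
next
  case False
  define S where "S = (\<Sum>i\<in>I. x i)"
  have S: "0 < S" using False x by (simp add: S_def sum_nonneg order.not_eq_order_implies_strict)
  have "(\<Sum>i\<in>I. x i powr r) / S powr r = (\<Sum>i\<in>I. (x i / S) powr r)"
    using S x by (simp add: sum_divide_distrib powr_divide)
  also have "\<dots> \<le> (\<Sum>i\<in>I. x i / S)"
  proof (intro sum_mono)
    fix i assume i: "i \<in> I"
    have "x i \<le> S" unfolding S_def using x I i by (intro member_le_sum) auto
    then have "(x i / S) powr r \<le> (x i / S) powr 1"
      using S x[OF i] r by (intro powr_mono') auto
    then show "(x i / S) powr r \<le> x i / S" using S x[OF i] by simp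
  qed
  also have "\<dots> = 1" using S by (simp add: S_def flip: sum_divide_distrib)
  finally show ?thesis using S by (simp add: S_def pos_divide_le_eq)
qed

lemma sum_powr_subadditive:
  fixes r :: real
  assumes r: "0 < r" "r \<le> 1" and x: "\<And>i. i \<in> I \<Longrightarrow> 0 \<le> x i" and I: "finite I"
  shows "(\<Sum>i\<in>I. x i) powr r \<le> (\<Sum>i\<in>I. x i powr r)"
proof -
  have "(\<Sum>i\<in>I. (x i powr r) powr (1 / r)) \<le> (\<Sum>i\<in>I. x i powr r) powr (1 / r)"
    using r I by (intro sum_powr_superadditive) auto
  also have "(\<Sum>i\<in>I. (x i powr r) powr (1 / r)) = (\<Sum>i\<in>I. x i)"
    using r x by (simp add: powr_powr)
  finally have "(\<Sum>i\<in>I. x i) powr r \<le> ((\<Sum>i\<in>I. x i powr r) powr (1 / r)) powr r"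
    using r x by (intro powr_mono2 sum_nonneg) auto
  then show ?thesis using r by (simp add: powr_powr sum_nonneg)
qed

lemma geometric_sum_powr_le:
  fixes s :: real
  assumes "0 < s"
  shows "(\<Sum>j\<le>k. 2 powr (real j * s)) \<le> 1 / (1 - 2 powr (- s)) * 2 powr (real k * s)"
proof -
  have lt1: "2 powr (- s) < 1" using powr_less_mono[of "-s" 0 "2::real"] assms by simp
  have e: "2 powr (- s) * 2 powr (real (Suc k) * s) = 2 powr (real k * s)" for k
    by (simp add: algebra_simps flip: powr_add)
  have "(1 - 2 powr (- s)) * (\<Sum>j\<le>k. 2 powr (real j * s)) \<le> 2 powr (real k * s)"
  proof (induction k)
    case (Suc k)
    then show ?case using e[of k] by (simp add: algebra_simps)
  qed (use lt1 in auto)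
  then show ?thesis using lt1 by (simp add: field_simps)
qed

text \<open>For geometric weights V_k is at most a constant times 2^(k s) with s = \<tau> p/(p-1),
  and s q (1 - 1/p) = \<tau> q. Since V_k enters with a negative power, this upper bound suffices to
  pass from the mass condition in closed form to the one with V_k. The quantifiers record that
  \<open>C\<close> works for all trees.\<close>

lemma tree_embedding_geometric_gt1:
  fixes p q \<tau> B :: real
  assumes p: "1 < p" "p < q" and \<tau>: "0 < \<tau>" and B: "0 \<le> B"
  shows "\<exists>C\<ge>0. \<forall>(T :: 'a set) lev anc m h. finite_tree T lev anc \<longrightarrow> (\<forall>z. 0 \<le> m z) \<longrightarrow> (\<forall>z. 0 \<le> h z) \<longrightarrow>
    (\<forall>Q\<in>T. finite_tree.shadow T lev anc m Q \<le> B * 2 powr (- (real (lev Q) * (\<tau> * q)))) \<longrightarrow>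
    (\<Sum>z\<in>T. m z * finite_tree.path_sum lev anc (\<lambda>j. 2 powr (real j * \<tau>)) h z powr q)
      \<le> C * (\<Sum>z\<in>T. h z powr p) powr (q / p)"
proof -
  define s where "s = \<tau> * (p / (p - 1))"
  have s: "0 < s" using p \<tau> by (simp add: s_def)
  define K where "K = 1 / (1 - 2 powr (- s))"
  have K: "0 < K" using powr_less_mono[of "-s" 0 "2::real"] s by (simp add: K_def)
  define r where "r = q * (1 - 1 / p)"
  have r: "0 < r" using p by (simp add: r_def field_simps)
  have sr: "s * r = \<tau> * q" using p by (simp add: s_def r_def field_simps)
  define B' where "B' = B * K powr r"
  have B': "0 \<le> B'" using B by (simp add: B'_def)
  define C where "C = 2 * q / p * (2 * q * (B' powr (1 / (p - 1)) * (p / (p - 1) + p / (q - p))) + 1) powr (p - 1)"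
  have bound: "2 powr (- (real k * (\<tau> * q))) \<le> K powr r * (\<Sum>j\<le>k. (2 powr (real j * \<tau>)) powr (p / (p - 1))) powr (- r)"
    (is "_ \<le> _ * ?V powr _") for k
  proof -
    have V: "?V = (\<Sum>j\<le>k. 2 powr (real j * s))" by (simp add: powr_powr s_def mult_ac)
    have V0: "0 < ?V" unfolding V by (intro sum_pos) auto
    have "?V \<le> K * 2 powr (real k * s)" unfolding V K_def by (rule geometric_sum_powr_le[OF s])
    then have "(K * 2 powr (real k * s)) powr (- r) \<le> ?V powr (- r)"
      using r V0 by (intro powr_mono2') auto
    moreover have "(K * 2 powr (real k * s)) powr (- r) = K powr (- r) * 2 powr (- (real k * (\<tau> * q)))"
      using K by (simp add: powr_mult powr_powr flip: sr) (simp add: mult_ac)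
    ultimately have "K powr r * (K powr (- r) * 2 powr (- (real k * (\<tau> * q)))) \<le> K powr r * ?V powr (- r)"
      by (intro mult_left_mono) auto
    moreover have "K powr r * K powr (- r) = 1" using K by (simp flip: powr_add)
    ultimately show ?thesis by (simp flip: mult.assoc)
  qed
  show ?thesis
  proof (intro exI[of _ C] conjI allI impI)
    show "0 \<le> C" using p by (simp add: C_def)
    fix T :: "'a set" and lev anc and m h :: "'a \<Rightarrow> real"
    assume T: "finite_tree T lev anc" and m: "\<forall>z. 0 \<le> m z" and h: "\<forall>z. 0 \<le> h z"
      and sh: "\<forall>Q\<in>T. finite_tree.shadow T lev anc m Q \<le> B * 2 powr (- (real (lev Q) * (\<tau> * q)))"
    show "(\<Sum>z\<in>T. m z * finite_tree.path_sum lev anc (\<lambda>j. 2 powr (real j * \<tau>)) h z powr q)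
      \<le> C * (\<Sum>z\<in>T. h z powr p) powr (q / p)"
      unfolding C_def
    proof (intro finite_tree.sum_path_sum_powr_le[OF T p B'])
      fix Q assume "Q \<in> T"
      then have "finite_tree.shadow T lev anc m Q \<le> B * 2 powr (- (real (lev Q) * (\<tau> * q)))" using sh by blast
      also have "\<dots> \<le> B * (K powr r * (\<Sum>j\<le>lev Q. (2 powr (real j * \<tau>)) powr (p / (p - 1))) powr (- r))"
        by (intro mult_left_mono bound B)
      finally show "finite_tree.shadow T lev anc m Q
          \<le> B' * (\<Sum>j\<le>lev Q. (2 powr (real j * \<tau>)) powr (p / (p - 1))) powr (- (q * (1 - 1 / p)))"
        by (simp add: B'_def r_def)
    qed (use m h in auto)
  qed
qed

text \<open>For p \<le> 1 the p-th power of a path sum is at most the path sum of h^p with rate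
  \<tau> p. The target exponent becomes q/p > 1, and \<tau> p (q/p) = \<tau> q leaves the mass
  condition unchanged.\<close>

lemma tree_embedding_geometric:
  fixes p q \<tau> B :: real
  assumes p: "0 < p" "p < q" and \<tau>: "0 < \<tau>" and B: "0 \<le> B"
  shows "\<exists>C\<ge>0. \<forall>(T :: 'a set) lev anc m h. finite_tree T lev anc \<longrightarrow> (\<forall>z. 0 \<le> m z) \<longrightarrow> (\<forall>z. 0 \<le> h z) \<longrightarrow>
    (\<forall>Q\<in>T. finite_tree.shadow T lev anc m Q \<le> B * 2 powr (- (real (lev Q) * (\<tau> * q)))) \<longrightarrow>
    (\<Sum>z\<in>T. m z * finite_tree.path_sum lev anc (\<lambda>j. 2 powr (real j * \<tau>)) h z powr q)
      \<le> C * (\<Sum>z\<in>T. h z powr p) powr (q / p)"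
proof (cases "1 < p")
  case True
  then show ?thesis using tree_embedding_geometric_gt1 assms by blast
next
  case False
  \<comment> \<open>The source exponent for h^p would be 1, where the inequality for exponents above
    1 does not apply. Any number strictly between 1 and q/p serves, here the midpoint, because the
    sum of (h^p)^p2 is at most the p2-th power of the sum of h^p.\<close>
  define p2 where "p2 = (1 + q / p) / 2"
  have p2: "1 < p2" "p2 < q / p" using p by (auto simp: p2_def field_simps)
  have \<tau>p: "0 < \<tau> * p" "\<tau> * p * (q / p) = \<tau> * q" using \<tau> p by auto
  obtain C where C: "0 \<le> C" and main: "\<And>(T :: 'a set) lev anc m h. finite_tree T lev anc \<Longrightarrow> (\<forall>z. 0 \<le> m z) \<Longrightarrow> (\<forall>z. 0 \<le> h z) \<Longrightarrow>
    (\<forall>Q\<in>T. finite_tree.shadow T lev anc m Q \<le> B * 2 powr (- (real (lev Q) * (\<tau> * q)))) \<Longrightarrow>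
    (\<Sum>z\<in>T. m z * finite_tree.path_sum lev anc (\<lambda>j. 2 powr (real j * (\<tau> * p))) h z powr (q / p))
      \<le> C * (\<Sum>z\<in>T. h z powr p2) powr (q / p / p2)"
    using tree_embedding_geometric_gt1[OF p2 \<tau>p(1) B, where 'a = 'a] unfolding \<tau>p(2) by blast
  show ?thesis
  proof (intro exI[of _ C] conjI allI impI C)
    fix T :: "'a set" and lev anc and m h :: "'a \<Rightarrow> real"
    assume T: "finite_tree T lev anc" and m: "\<forall>z. 0 \<le> m z" and h: "\<forall>z. 0 \<le> h z"
      and sh: "\<forall>Q\<in>T. finite_tree.shadow T lev anc m Q \<le> B * 2 powr (- (real (lev Q) * (\<tau> * q)))"
    interpret finite_tree T lev anc by (rule T)
    have "path_sum (\<lambda>j. 2 powr (real j * \<tau>)) h z powr q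
        \<le> path_sum (\<lambda>j. 2 powr (real j * (\<tau> * p))) (\<lambda>z. h z powr p) z powr (q / p)" for z
    proof -
      have "path_sum (\<lambda>j. 2 powr (real j * \<tau>)) h z powr p
          \<le> (\<Sum>j\<le>lev z. (2 powr (real j * \<tau>) * h (anc j z)) powr p)"
        unfolding path_sum_def using p False h by (intro sum_powr_subadditive) auto
      also have "\<dots> = path_sum (\<lambda>j. 2 powr (real j * (\<tau> * p))) (\<lambda>z. h z powr p) z"
        unfolding path_sum_def using h by (simp add: powr_mult powr_powr mult_ac)
      finally have "(path_sum (\<lambda>j. 2 powr (real j * \<tau>)) h z powr p) powr (q / p)
          \<le> path_sum (\<lambda>j. 2 powr (real j * (\<tau> * p))) (\<lambda>z. h z powr p) z powr (q / p)"
        using p by (intro powr_mono2) auto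
      then show ?thesis using p by (simp add: powr_powr)
    qed
    then have "(\<Sum>z\<in>T. m z * path_sum (\<lambda>j. 2 powr (real j * \<tau>)) h z powr q)
        \<le> (\<Sum>z\<in>T. m z * path_sum (\<lambda>j. 2 powr (real j * (\<tau> * p))) (\<lambda>z. h z powr p) z powr (q / p))"
      using m by (intro sum_mono mult_left_mono) auto
    also have "\<dots> \<le> C * (\<Sum>z\<in>T. (h z powr p) powr p2) powr (q / p / p2)"
      using m sh by (intro main T) auto
    also have "\<dots> \<le> C * ((\<Sum>z\<in>T. h z powr p) powr p2) powr (q / p / p2)"
      using p p2 C finite_T by (intro mult_left_mono powr_mono2 sum_powr_superadditive sum_nonneg) auto
    also have "((\<Sum>z\<in>T. h z powr p) powr p2) powr (q / p / p2) = (\<Sum>z\<in>T. h z powr p) powr (q / p)"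
      using p2 by (simp add: powr_powr)
    finally show "(\<Sum>z\<in>T. m z * path_sum (\<lambda>j. 2 powr (real j * \<tau>)) h z powr q)
      \<le> C * (\<Sum>z\<in>T. h z powr p) powr (q / p)"
      .
  qed
qed

section \<open>Polar coordinates and sub-mean values\<close>

lemma sets_borel_ball [measurable]: "ball a r \<in> sets borel"
  and sets_borel_cball [measurable]: "cball a r \<in> sets borel"
  by auto

lemma borel_measurable_Complex [measurable]:
  assumes "f \<in> borel_measurable M" "g \<in> borel_measurable M"
  shows "(\<lambda>x. Complex (f x) (g x)) \<in> borel_measurable M"
proof -
  have "(\<lambda>x. complex_of_real (f x) + \<i> * complex_of_real (g x)) \<in> borel_measurable M"
    using assms by measurable
  then show ?thesis by (simp add: Complex_eq)
qed

lemma borel_measurable_cis [measurable]: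
  assumes "f \<in> borel_measurable M"
  shows "(\<lambda>x. cis (f x)) \<in> borel_measurable M"
  using assms by (simp add: cis.code)

lemma borel_measurable_Arg2pi [measurable]: "Arg2pi \<in> borel_measurable borel"
  unfolding borel_measurable_iff_le using closed_Arg2pi2pi_le by auto

section \<open>Polar coordinates from Fubini and one-dimensional substitutions\<close>

lemma lborel_complex: "(lborel :: complex measure) = distr (lborel \<Otimes>\<^sub>M lborel) borel (\<lambda>(x, y). Complex x y)"
proof (rule lborel_eqI)
  fix l u :: complex
  assume le: "\<And>b. b \<in> Basis \<Longrightarrow> l \<bullet> b \<le> u \<bullet> b"
  have [simp]: "Re l \<le> Re u" "Im l \<le> Im u"
    using le[of 1] le[of \<i>] by (auto simp: Basis_complex_def inner_complex_def)
  have "(\<lambda>(x, y). Complex x y) -` box l u = {Re l<..<Re u} \<times> {Im l<..<Im u}"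
    by (auto simp: box_def Basis_complex_def inner_complex_def)
  then show "emeasure (distr (lborel \<Otimes>\<^sub>M lborel) borel (\<lambda>(x, y). Complex x y)) (box l u)
      = (\<Prod>b\<in>Basis. (u - l) \<bullet> b)"
    by (simp add: emeasure_distr space_pair_measure lborel.emeasure_pair_measure_Times
      Basis_complex_def inner_complex_def ennreal_mult)
qed simp

lemma nn_integral_complex_iterated:
  fixes F :: "complex \<Rightarrow> ennreal"
  assumes [measurable]: "F \<in> borel_measurable borel"
  shows "(\<integral>\<^sup>+z. F z \<partial>lborel) = (\<integral>\<^sup>+y. \<integral>\<^sup>+x. F (Complex x y) \<partial>lborel \<partial>lborel)"
proof -
  have "(\<integral>\<^sup>+z. F z \<partial>lborel) = (\<integral>\<^sup>+(x, y). F (Complex x y) \<partial>(lborel \<Otimes>\<^sub>M lborel))"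
    by (subst lborel_complex) (simp add: nn_integral_distr case_prod_unfold)
  also have "\<dots> = (\<integral>\<^sup>+y. \<integral>\<^sup>+x. F (Complex x y) \<partial>lborel \<partial>lborel)"
    by (subst lborel_pair.nn_integral_snd[symmetric]) (simp_all add: case_prod_unfold)
  finally show ?thesis .
qed

text \<open>The substitution is made on compact intervals whose images under tan are [-(n+1), n+1];
  both sides then increase to the full integrals.\<close>

lemma nn_integral_substitution_tan:
  fixes f :: "real \<Rightarrow> ennreal"
  assumes [measurable]: "f \<in> borel_measurable borel"
  shows "(\<integral>\<^sup>+m. f m \<partial>lborel) =
    (\<integral>\<^sup>+x. f (tan x) * ennreal (1 + (tan x)\<^sup>2) * indicator {- pi / 2<..<pi / 2} x \<partial>lborel)"
proof -
  have [measurable]: "tan \<in> borel_measurable (borel :: real measure)"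
    unfolding tan_def[abs_def] by measurable
  define b where "b n = arctan (real (Suc n))" for n
  have b: "0 < b n" "b n < pi / 2" for n
    using arctan_ubound[of "Suc n"] by (auto simp: b_def)
  have step: "(\<integral>\<^sup>+m. f m * indicator {- real (Suc n)..real (Suc n)} m \<partial>lborel) =
    (\<integral>\<^sup>+x. f (tan x) * ennreal (1 + (tan x)\<^sup>2) * indicator {- b n..b n} x \<partial>lborel)" for n
  proof -
    have cos: "cos x \<noteq> 0" if "x \<in> {- b n..b n}" for x
    proof -
      have "0 < cos x" by (intro cos_gt_zero_pi) (use that b[of n] in auto)
      then show ?thesis by simp
    qed
    have "(\<integral>\<^sup>+m. f m * indicator {tan (- b n)..tan (b n)} m \<partial>lborel) =
      (\<integral>\<^sup>+x. f (tan x) * ennreal (1 + (tan x)\<^sup>2) * indicator {- b n..b n} x \<partial>lborel)"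
    proof (rule nn_integral_substitution_aux)
      show "(tan has_real_derivative 1 + (tan x)\<^sup>2) (at x)" if "x \<in> {- b n..b n}" for x
        using cos[OF that] by (auto intro!: derivative_eq_intros simp: tan_def power2_eq_square field_simps)
      show "continuous_on {- b n..b n} (\<lambda>x. 1 + (tan x)\<^sup>2)"
        using cos by (intro continuous_intros) auto
    qed (use b[of n] in auto)
    moreover have "tan (b n) = real (Suc n)" "tan (- b n) = - real (Suc n)"
      by (simp_all add: b_def tan_arctan)
    ultimately show ?thesis by simp
  qed
  have mono_b: "b m \<le> b n" if "m \<le> n" for m n using that by (simp add: b_def arctan_le_iff)
  have lim: "(\<lambda>n. \<integral>\<^sup>+x. g x * indicator {- c n..c n} x \<partial>lborel) \<longlonglongrightarrow> (\<integral>\<^sup>+x. g x * indicator S x \<partial>lborel)"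
    if [measurable]: "g \<in> borel_measurable borel" and c: "\<And>m n. m \<le> n \<Longrightarrow> c m \<le> c n"
      and S: "\<And>n. {- c n..c n} \<subseteq> S" "\<And>x. x \<in> S \<Longrightarrow> \<exists>n. x \<in> {- c n..c n}" and [measurable]: "S \<in> sets borel"
    for g :: "real \<Rightarrow> ennreal" and c :: "nat \<Rightarrow> real" and S
  proof (rule nn_integral_LIMSEQ)
    show "incseq (\<lambda>n x. g x * indicator {- c n..c n} x)"
    proof (intro incseq_SucI le_funI)
      fix n x
      have "c n \<le> c (Suc n)" by (intro c) simp
      then show "g x * indicator {- c n..c n} x \<le> g x * indicator {- c (Suc n)..c (Suc n)} x"
        by (auto split: split_indicator)
    qed
    show "(\<lambda>n. g x * indicator {- c n..c n} x) \<longlonglongrightarrow> g x * indicator S x" for x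
    proof (cases "x \<in> S")
      case True
      then obtain N where N: "x \<in> {- c N..c N}" using S by blast
      have "\<forall>n\<ge>N. g x * indicator {- c n..c n} x = g x * indicator S x"
      proof (intro allI impI)
        fix n assume "N \<le> n"
        then have "c N \<le> c n" by (rule c)
        then have "x \<in> {- c n..c n}" using N by auto
        then show "g x * indicator {- c n..c n} x = g x * indicator S x" using True by simp
      qed
      then show ?thesis by (intro tendsto_eventually) (auto simp: eventually_sequentially)
    next
      case False
      then have "x \<notin> {- c n..c n}" for n using S by blast
      then show ?thesis using False by simp
    qed
  qed auto
  have A: "(\<lambda>n. \<integral>\<^sup>+m. f m * indicator {- real (Suc n)..real (Suc n)} m \<partial>lborel) \<longlonglongrightarrow> (\<integral>\<^sup>+m. f m * indicator UNIV m \<partial>lborel)"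
  proof (rule lim)
    fix x :: real
    obtain n where "\<bar>x\<bar> < real n" using reals_Archimedean2 by blast
    then show "\<exists>n. x \<in> {- real (Suc n)..real (Suc n)}" by (intro exI[of _ n]) auto
  qed auto
  have B: "(\<lambda>n. \<integral>\<^sup>+x. f (tan x) * ennreal (1 + (tan x)\<^sup>2) * indicator {- b n..b n} x \<partial>lborel)
    \<longlonglongrightarrow> (\<integral>\<^sup>+x. f (tan x) * ennreal (1 + (tan x)\<^sup>2) * indicator {- pi / 2<..<pi / 2} x \<partial>lborel)"
  proof (rule lim)
    show "{- b n..b n} \<subseteq> {- pi / 2<..<pi / 2}" for n using b[of n] by auto
    fix x assume x: "x \<in> {- pi / 2<..<pi / 2}"
    obtain n where n: "\<bar>tan x\<bar> < real n" using reals_Archimedean2 by blast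
    have "arctan (tan x) = x" using x by (intro arctan_tan) auto
    moreover have "arctan (tan x) \<le> b n" "- b n \<le> arctan (tan x)"
      using n by (auto simp: b_def arctan_le_iff simp flip: arctan_minus)
    ultimately show "\<exists>n. x \<in> {- b n..b n}" by (intro exI[of _ n]) auto
  qed (use mono_b in auto)
  show ?thesis using LIMSEQ_unique[OF A[unfolded step] B] by simp
qed

text \<open>Points are first described by y and m = x/y, with Jacobian |y|. After exchanging the
  order of integration, y = r / sqrt(1 + m^2) makes r a signed distance from 0, and m = tan x makes
  the density 1/(1 + m^2) cancel. The radius runs over the whole line and the angle over a half
  circle.\<close>

lemma nn_integral_polar_line:
  fixes F :: "complex \<Rightarrow> ennreal"
  assumes [measurable]: "F \<in> borel_measurable borel"
  shows "(\<integral>\<^sup>+z. F z \<partial>lborel) =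
    (\<integral>\<^sup>+x. (\<integral>\<^sup>+r. ennreal \<bar>r\<bar> * F (of_real r * cis x) \<partial>lborel) * indicator {0<..<pi} x \<partial>lborel)"
proof -
  have "(\<integral>\<^sup>+z. F z \<partial>lborel) = (\<integral>\<^sup>+y. \<integral>\<^sup>+m. ennreal \<bar>y\<bar> * F (Complex (y * m) y) \<partial>lborel \<partial>lborel)"
    unfolding nn_integral_complex_iterated[OF assms]
  proof (rule nn_integral_cong_AE, use AE_lborel_singleton[of 0] in eventually_elim)
    fix y :: real assume "y \<noteq> 0"
    then show "(\<integral>\<^sup>+x. F (Complex x y) \<partial>lborel) = (\<integral>\<^sup>+m. ennreal \<bar>y\<bar> * F (Complex (y * m) y) \<partial>lborel)"
      by (subst nn_integral_real_affine[of _ y 0]) (simp_all add: nn_integral_cmult)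
  qed
  also have "\<dots> = (\<integral>\<^sup>+m. \<integral>\<^sup>+y. ennreal \<bar>y\<bar> * F (Complex (y * m) y) \<partial>lborel \<partial>lborel)"
    by (rule lborel_pair.Fubini') measurable
  also have "\<dots> = (\<integral>\<^sup>+m. ennreal (1 / (1 + m\<^sup>2)) * (\<integral>\<^sup>+r. ennreal \<bar>r\<bar> * F (of_real (r / sqrt (1 + m\<^sup>2)) * Complex m 1) \<partial>lborel) \<partial>lborel)"
  proof (rule nn_integral_cong)
    fix m :: real
    define c where "c = 1 / sqrt (1 + m\<^sup>2)"
    have c: "0 < c" "c * c = 1 / (1 + m\<^sup>2)"
      by (simp_all add: c_def add_pos_nonneg)
    have "(\<integral>\<^sup>+y. ennreal \<bar>y\<bar> * F (Complex (y * m) y) \<partial>lborel)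
        = ennreal c * (\<integral>\<^sup>+r. ennreal \<bar>c * r\<bar> * F (Complex (c * r * m) (c * r)) \<partial>lborel)"
      using c by (subst nn_integral_real_affine[of _ c 0]) simp_all
    also have "(\<integral>\<^sup>+r. ennreal \<bar>c * r\<bar> * F (Complex (c * r * m) (c * r)) \<partial>lborel)
        = (\<integral>\<^sup>+r. ennreal c * (ennreal \<bar>r\<bar> * F (of_real (r * c) * Complex m 1)) \<partial>lborel)"
    proof (intro nn_integral_cong)
      fix r :: real
      have "Complex (c * r * m) (c * r) = of_real (r * c) * Complex m 1"
        by (simp add: complex_eq_iff)
      then show "ennreal \<bar>c * r\<bar> * F (Complex (c * r * m) (c * r))
          = ennreal c * (ennreal \<bar>r\<bar> * F (of_real (r * c) * Complex m 1))"
        using c by (simp only: abs_mult ennreal_mult abs_ge_zero mult.assoc) simp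
    qed
    also have "\<dots> = ennreal c * (\<integral>\<^sup>+r. ennreal \<bar>r\<bar> * F (of_real (r * c) * Complex m 1) \<partial>lborel)"
      by (intro nn_integral_cmult) measurable
    finally show "(\<integral>\<^sup>+y. ennreal \<bar>y\<bar> * F (Complex (y * m) y) \<partial>lborel) = ennreal (1 / (1 + m\<^sup>2)) * (\<integral>\<^sup>+r. ennreal \<bar>r\<bar> * F (of_real (r / sqrt (1 + m\<^sup>2)) * Complex m 1) \<partial>lborel)"
      using c by (simp add: c(2)[symmetric] ennreal_mult mult.assoc) (simp add: c_def)
  qed
  also have "\<dots> = (\<integral>\<^sup>+x. ennreal (1 / (1 + (tan x)\<^sup>2)) * (\<integral>\<^sup>+r. ennreal \<bar>r\<bar> * F (of_real (r / sqrt (1 + (tan x)\<^sup>2)) * Complex (tan x) 1) \<partial>lborel)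
      * ennreal (1 + (tan x)\<^sup>2) * indicator {- pi / 2<..<pi / 2} x \<partial>lborel)"
    by (rule nn_integral_substitution_tan) measurable
  also have "\<dots> = (\<integral>\<^sup>+x. (\<integral>\<^sup>+r. ennreal \<bar>r\<bar> * F (of_real r * cis (pi / 2 - x)) \<partial>lborel) * indicator {- pi / 2<..<pi / 2} x \<partial>lborel)"
  proof (intro nn_integral_cong)
    fix x :: real
    show "ennreal (1 / (1 + (tan x)\<^sup>2)) * (\<integral>\<^sup>+r. ennreal \<bar>r\<bar> * F (of_real (r / sqrt (1 + (tan x)\<^sup>2)) * Complex (tan x) 1) \<partial>lborel)
      * ennreal (1 + (tan x)\<^sup>2) * indicator {- pi / 2<..<pi / 2} x
      = (\<integral>\<^sup>+r. ennreal \<bar>r\<bar> * F (of_real r * cis (pi / 2 - x)) \<partial>lborel) * indicator {- pi / 2<..<pi / 2} x"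
    proof (cases "x \<in> {- pi / 2<..<pi / 2}")
      case True
      have cx: "0 < cos x" using True by (intro cos_gt_zero_pi) auto
      have "1 + (tan x)\<^sup>2 = 1 / (cos x)\<^sup>2" using cx sin_cos_squared_add[of x]
        by (simp add: tan_def field_simps)
      then have s: "sqrt (1 + (tan x)\<^sup>2) = 1 / cos x" using cx by (simp add: real_sqrt_divide)
      have z: "of_real (r / sqrt (1 + (tan x)\<^sup>2)) * Complex (tan x) 1 = of_real r * cis (pi / 2 - x)" for r
        unfolding s using cx by (simp add: complex_eq_iff tan_def sin_diff cos_diff)
      have "0 < 1 + (tan x)\<^sup>2" by (simp add: add_pos_nonneg)
      then have "ennreal (1 / (1 + (tan x)\<^sup>2)) * ennreal (1 + (tan x)\<^sup>2) = 1"
        by (simp del: ennreal_plus flip: ennreal_mult)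
      then have "ennreal (1 / (1 + (tan x)\<^sup>2)) * X * ennreal (1 + (tan x)\<^sup>2) = X" for X
        by (metis mult.assoc mult.commute mult_1)
      then show ?thesis unfolding z using True by simp
    qed simp
  qed
  also have "\<dots> = (\<integral>\<^sup>+x. (\<integral>\<^sup>+r. ennreal \<bar>r\<bar> * F (of_real r * cis x) \<partial>lborel) * indicator {0<..<pi} x \<partial>lborel)"
    by (subst (2) nn_integral_real_affine[of _ "-1" "pi / 2"])
      (auto intro!: nn_integral_cong split: split_indicator)
  finally show ?thesis .
qed

text \<open>A negative radius at angle x is the positive radius at angle pi + x, which supplies the
  missing half circle.\<close>

lemma nn_integral_polar:
  fixes F :: "complex \<Rightarrow> ennreal"
  assumes [measurable]: "F \<in> borel_measurable borel"
  shows "(\<integral>\<^sup>+z. F z \<partial>lborel) =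
    (\<integral>\<^sup>+x. (\<integral>\<^sup>+r. ennreal r * F (of_real r * cis x) * indicator {0<..} r \<partial>lborel) * indicator {0..2 * pi} x \<partial>lborel)"
proof -
  define G where "G x = (\<integral>\<^sup>+r. ennreal r * F (of_real r * cis x) * indicator {0<..} r \<partial>lborel)" for x
  have [measurable]: "G \<in> borel_measurable borel" unfolding G_def by measurable
  have "(\<integral>\<^sup>+r. ennreal \<bar>r\<bar> * F (of_real r * cis x) \<partial>lborel) = G x + G (pi + x)" for x
  proof -
    have "(\<integral>\<^sup>+r. ennreal \<bar>r\<bar> * F (of_real r * cis x) \<partial>lborel)
      = (\<integral>\<^sup>+r. ennreal r * F (of_real r * cis x) * indicator {0<..} r
          + ennreal (- r) * F (of_real r * cis x) * indicator {0<..} (- r) \<partial>lborel)"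
      by (intro nn_integral_cong) (auto split: split_indicator simp: ennreal_neg)
    also have "\<dots> = G x + (\<integral>\<^sup>+r. ennreal (- r) * F (of_real r * cis x) * indicator {0<..} (- r) \<partial>lborel)"
      unfolding G_def by (intro nn_integral_add) auto
    also have "(\<integral>\<^sup>+r. ennreal (- r) * F (of_real r * cis x) * indicator {0<..} (- r) \<partial>lborel)
      = (\<integral>\<^sup>+r. ennreal r * F (of_real (- r) * cis x) * indicator {0<..} r \<partial>lborel)"
      by (subst nn_integral_real_affine[of _ "-1" 0]) auto
    also have "\<dots> = G (pi + x)"
      unfolding G_def by (simp flip: cis_mult)
    finally show ?thesis .
  qed
  then have "(\<integral>\<^sup>+z. F z \<partial>lborel) = (\<integral>\<^sup>+x. (G x + G (pi + x)) * indicator {0<..<pi} x \<partial>lborel)"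
    unfolding nn_integral_polar_line[OF assms] by simp
  also have "\<dots> = (\<integral>\<^sup>+x. G x * indicator {0<..<pi} x \<partial>lborel) + (\<integral>\<^sup>+x. G (pi + x) * indicator {0<..<pi} x \<partial>lborel)"
    by (simp add: distrib_right nn_integral_add)
  also have "(\<integral>\<^sup>+x. G (pi + x) * indicator {0<..<pi} x \<partial>lborel) = (\<integral>\<^sup>+x. G x * indicator {pi<..<2 * pi} x \<partial>lborel)"
    by (subst (2) nn_integral_real_affine[of _ 1 pi]) (auto intro!: nn_integral_cong split: split_indicator)
  also have "(\<integral>\<^sup>+x. G x * indicator {0<..<pi} x \<partial>lborel) + (\<integral>\<^sup>+x. G x * indicator {pi<..<2 * pi} x \<partial>lborel)
    = (\<integral>\<^sup>+x. G x * indicator {0<..<pi} x + G x * indicator {pi<..<2 * pi} x \<partial>lborel)"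
    by (intro nn_integral_add[symmetric]) auto
  also have "\<dots> = (\<integral>\<^sup>+x. G x * indicator {0..2 * pi} x \<partial>lborel)"
    using AE_lborel_singleton[of 0] AE_lborel_singleton[of pi] AE_lborel_singleton[of "2 * pi"]
    by (intro nn_integral_cong_AE, eventually_elim) (auto split: split_indicator)
  finally show ?thesis by (simp add: G_def)
qed

section \<open>Sub-mean value inequalities over disks\<close>

lemma holomorphic_le_circle_mean:
  assumes F: "F holomorphic_on cball w r" and r: "0 < r"
  shows "ennreal (2 * pi * norm (F w)) \<le> (\<integral>\<^sup>+x. ennreal (norm (F (w + of_real r * cis x))) * indicator {0..2 * pi} x \<partial>lborel)"
proof -
  define h where "h x = F (w + of_real r * cis x) * \<i>" for x
  have "((\<lambda>u. F u / (u - w)) has_contour_integral 2 * of_real pi * \<i> * F w) (circlepath w r)"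
    by (intro Cauchy_integral_circlepath_simple F) (use r in auto)
  then have "((\<lambda>x. F (w + of_real r * cis x) / (of_real r * cis x) * of_real r * \<i> * cis x) has_integral 2 * of_real pi * \<i> * F w) {0..2 * pi}"
    unfolding circlepath_def by (subst (asm) has_contour_integral_part_circlepath_iff) auto
  then have int: "(h has_integral 2 * of_real pi * \<i> * F w) {0..2 * pi}"
    using r by (simp add: h_def[abs_def])
  have "continuous_on {0..2 * pi} h"
    unfolding h_def using r
    by (intro continuous_intros continuous_on_compose2[OF holomorphic_on_imp_continuous_on[OF F]])
      (auto simp: dist_norm norm_mult)
  then have si: "set_integrable lborel {0..2 * pi} h"
    by (rule borel_integrable_atLeastAtMost')
  have "ennreal (2 * pi * norm (F w)) = ennreal (norm (LBINT x:{0..2 * pi}. h x))"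
    using int set_borel_integral_eq_integral(2)[OF si] by (simp add: integral_unique norm_mult)
  also have "\<dots> \<le> (\<integral>\<^sup>+x. ennreal (norm (indicator {0..2 * pi} x *\<^sub>R h x)) \<partial>lborel)"
    unfolding set_lebesgue_integral_def
    by (intro integral_norm_bound_ennreal) (use si in \<open>simp add: set_integrable_def\<close>)
  also have "\<dots> = (\<integral>\<^sup>+x. ennreal (norm (F (w + of_real r * cis x))) * indicator {0..2 * pi} x \<partial>lborel)"
    by (intro nn_integral_cong) (auto simp: h_def norm_mult split: split_indicator)
  finally show ?thesis .
qed

lemma continuous_on_indicator_borel_ennreal:
  fixes f :: "complex \<Rightarrow> real"
  assumes "continuous_on A f" "A \<in> sets borel"
  shows "(\<lambda>z. ennreal (f z) * indicator A z) \<in> borel_measurable borel"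
proof -
  have "(\<lambda>z. ennreal (indicator A z *\<^sub>R f z)) \<in> borel_measurable borel"
    using borel_measurable_continuous_on_indicator[OF assms(2,1)] by measurable
  also have "(\<lambda>z. ennreal (indicator A z *\<^sub>R f z)) = (\<lambda>z. ennreal (f z) * indicator A z)"
    by (auto split: split_indicator)
  finally show ?thesis .
qed

text \<open>The circle estimates are integrated against r dr, whose total over [0, R] is R^2/2, and
  polar coordinates around \<open>w\<close> reassemble the circles into the disk.\<close>

lemma holomorphic_le_disk_mean:
  assumes F: "F holomorphic_on cball w R" and R: "0 < R"
  shows "ennreal (pi * R\<^sup>2 * norm (F w)) \<le> (\<integral>\<^sup>+z. ennreal (norm (F z)) * indicator (cball w R) z \<partial>lborel)"
proof -
  define H where "H z = ennreal (norm (F (w + z))) * indicator (cball 0 R) z" for z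
  have H0: "(\<lambda>z. ennreal (norm (F z)) * indicator (cball w R) z) \<in> borel_measurable borel"
    using holomorphic_on_imp_continuous_on[OF F]
    by (intro continuous_on_indicator_borel_ennreal continuous_intros) auto
  have H_eq: "H = (\<lambda>z. (\<lambda>z. ennreal (norm (F z)) * indicator (cball w R) z) (w + z))"
    by (auto simp: H_def dist_norm split: split_indicator)
  have [measurable]: "H \<in> borel_measurable borel"
    unfolding H_eq by (rule measurable_compose[OF _ H0]) measurable
  have "ennreal (pi * R\<^sup>2 * norm (F w)) = ennreal (2 * pi * norm (F w)) * ennreal (R\<^sup>2 / 2)"
    by (simp add: mult_ac flip: ennreal_mult)
  also have "ennreal (R\<^sup>2 / 2) = (\<integral>\<^sup>+r. ennreal r * indicator {0..R} r \<partial>lborel)"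
    using R by (subst nn_integral_FTC_Icc[where F = "\<lambda>r. r\<^sup>2 / 2"]) (auto intro!: derivative_eq_intros)
  also have "ennreal (2 * pi * norm (F w)) * \<dots> = (\<integral>\<^sup>+r. ennreal (2 * pi * norm (F w)) * (ennreal r * indicator {0..R} r) \<partial>lborel)"
    by (intro nn_integral_cmult[symmetric]) measurable
  also have "\<dots> \<le> (\<integral>\<^sup>+r. \<integral>\<^sup>+x. ennreal r * H (of_real r * cis x) * indicator {0<..} r * indicator {0..2 * pi} x \<partial>lborel \<partial>lborel)"
  proof (intro nn_integral_mono)
    fix r :: real
    show "ennreal (2 * pi * norm (F w)) * (ennreal r * indicator {0..R} r)
      \<le> (\<integral>\<^sup>+x. ennreal r * H (of_real r * cis x) * indicator {0<..} r * indicator {0..2 * pi} x \<partial>lborel)"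
    proof (cases "0 < r \<and> r \<le> R")
      case True
      have "ennreal (2 * pi * norm (F w)) * ennreal r
        \<le> (\<integral>\<^sup>+x. ennreal (norm (F (w + of_real r * cis x))) * indicator {0..2 * pi} x \<partial>lborel) * ennreal r"
        using True F by (intro mult_right_mono holomorphic_le_circle_mean) (auto intro: holomorphic_on_subset)
      also have "\<dots> = (\<integral>\<^sup>+x. H (of_real r * cis x) * indicator {0..2 * pi} x \<partial>lborel) * ennreal r"
        using True by (simp add: H_def dist_norm norm_mult)
      also have "\<dots> = (\<integral>\<^sup>+x. H (of_real r * cis x) * indicator {0..2 * pi} x * ennreal r \<partial>lborel)"
        by (intro nn_integral_multc[symmetric]) measurable
      finally show ?thesis using True by (simp add: mult_ac)
    next
      case False
      then have "ennreal r * indicator {0..R} r = 0" by (cases "r = 0") (auto split: split_indicator)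
      then show ?thesis by (simp only: mult_zero_right zero_le)
    qed
  qed
  also have "\<dots> = (\<integral>\<^sup>+x. \<integral>\<^sup>+r. ennreal r * H (of_real r * cis x) * indicator {0<..} r * indicator {0..2 * pi} x \<partial>lborel \<partial>lborel)"
    by (rule lborel_pair.Fubini') measurable
  also have "\<dots> = (\<integral>\<^sup>+z. H z \<partial>lborel)"
    by (subst nn_integral_polar) (simp_all add: nn_integral_multc)
  also have "\<dots> = (\<integral>\<^sup>+z. ennreal (norm (F z)) * indicator (cball w R) z \<partial>lborel)"
  proof -
    have "(\<integral>\<^sup>+z. ennreal (norm (F z)) * indicator (cball w R) z \<partial>lborel)
        = (\<integral>\<^sup>+z. ennreal (norm (F z)) * indicator (cball w R) z \<partial>distr lborel borel ((+) w))"
      by (simp add: lborel_distr_plus)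
    also have "\<dots> = (\<integral>\<^sup>+z. H z \<partial>lborel)"
      unfolding H_eq by (rule nn_integral_distr) (use H0 in auto)
    finally show ?thesis by simp
  qed
  finally show ?thesis .
qed

text \<open>The maximum of \<open>\<bar>F z\<bar> (R - \<bar>z - w\<bar>)\<^bsup>2/p\<^esup>\<close> serves to deduce the sub-mean value
  property for every exponent from the case \<open>p = 1\<close>, without knowing that \<open>\<bar>F\<bar>\<^sup>p\<close> is subharmonic.\<close>

lemma holomorphic_powr_le_disk_mean:
  fixes p :: real
  assumes p: "0 < p"
  shows "\<exists>C>0. \<forall>F w R. F holomorphic_on cball w R \<longrightarrow> 0 < R \<longrightarrow>
    ennreal (norm (F w) powr p) \<le> ennreal (C / R\<^sup>2) * (\<integral>\<^sup>+z. ennreal (norm (F z) powr p) * indicator (cball w R) z \<partial>lborel)"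
proof -
  \<comment> \<open>At the maximum point y, with \<rho> half the distance from y to the boundary
    circle, K bounds |F| on the disk of radius \<rho> around y, while |F y| = 2^(-2/p) K = 2 c K.
    Points with |F| \<le> c K therefore contribute at most half of the mean that dominates |F
    y|.\<close>
  define c where "c = 2 powr (- 2 / p) / (2 :: real)"
  define D where "D = max 1 (c powr (1 - p))"
  have c: "0 < c" by (simp add: c_def)
  have D: "1 \<le> D" by (simp add: D_def)
  define C where "C = D / (c * pi)"
  have C: "0 < C" using c D by (simp add: C_def)
  show ?thesis
  proof (intro exI[of _ C] conjI allI impI C)
    fix F w R assume F: "F holomorphic_on cball w R" and R: "0 < (R :: real)"
    let ?I = "\<integral>\<^sup>+z. ennreal (norm (F z) powr p) * indicator (cball w R) z \<partial>lborel"
    show "ennreal (norm (F w) powr p) \<le> ennreal (C / R\<^sup>2) * ?I"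
    proof (cases "F w = 0 \<or> ?I = \<infinity>")
      case True
      have "0 < C / R\<^sup>2" using C R by simp
      then show ?thesis using True p by (auto simp: ennreal_mult_top)
    next
      case False
      then have "?I < \<infinity>" by (auto simp: less_top)
      then obtain i where i: "?I = ennreal i" "0 \<le> i" by (cases ?I) auto
      have contF: "continuous_on (cball w R) F" using F by (rule holomorphic_on_imp_continuous_on)
      define \<phi> where "\<phi> z = norm (F z) * (R - dist w z) powr (2 / p)" for z
      have "continuous_on (cball w R) \<phi>"
        unfolding \<phi>_def using contF p by (intro continuous_intros continuous_on_powr') auto
      then obtain y where y: "y \<in> cball w R" "\<And>z. z \<in> cball w R \<Longrightarrow> \<phi> z \<le> \<phi> y"
        using continuous_attains_sup[of "cball w R" \<phi>] R by auto
      have \<phi>w: "\<phi> w = norm (F w) * R powr (2 / p)" by (simp add: \<phi>_def)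
      have "0 < \<phi> w" using False R by (simp add: \<phi>w)
      then have M: "0 < \<phi> y" using y(2)[of w] R by auto
      define \<rho> where "\<rho> = (R - dist w y) / 2"
      have \<rho>: "0 < \<rho>" using M y(1) by (cases "dist w y = R") (auto simp: \<phi>_def \<rho>_def)
      have sub: "cball y \<rho> \<subseteq> cball w R"
      proof
        fix z assume "z \<in> cball y \<rho>"
        then show "z \<in> cball w R" using dist_triangle[of w z y] \<rho> by (auto simp: \<rho>_def)
      qed
      define K where "K = \<phi> y * \<rho> powr (- 2 / p)"
      have K: "0 < K" using M \<rho> by (simp add: K_def)
      have Fy: "norm (F y) = 2 * (c * K)"
      proof -
        have "R - dist w y = 2 * \<rho>" by (simp add: \<rho>_def)
        then have "\<phi> y = norm (F y) * (2 * \<rho>) powr (2 / p)" by (simp add: \<phi>_def)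
        also have "\<dots> = norm (F y) * 2 powr (2 / p) * \<rho> powr (2 / p)" using \<rho> by (simp add: powr_mult)
        finally show ?thesis using \<rho> by (simp add: K_def c_def powr_minus field_simps)
      qed
      have FK: "norm (F z) \<le> K" if z: "z \<in> cball y \<rho>" for z
      proof -
        have "\<rho> \<le> R - dist w z" using z dist_triangle[of w z y] by (auto simp: \<rho>_def field_simps)
        then have "norm (F z) * \<rho> powr (2 / p) \<le> \<phi> z"
          unfolding \<phi>_def using \<rho> p by (intro mult_left_mono powr_mono2) auto
        also have "\<dots> \<le> \<phi> y" using y(2) z sub by blast
        finally show ?thesis using \<rho> by (simp add: K_def powr_minus field_simps)
      qed
      \<comment> \<open>Either x is at most c K, or x/K lies between c and 1, where x^(1-p) is
        comparable to K^(1-p). This trades the first power of |F| for its p-th power at the cost of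
        a term that can be absorbed.\<close>
      have x_le: "x \<le> D * K powr (1 - p) * x powr p + c * K" if x: "0 \<le> x" "x \<le> K" for x
      proof (cases "x \<le> c * K")
        case True
        then show ?thesis using D by (simp add: add_increasing)
      next
        case False
        moreover have "0 < c * K" using c K by simp
        ultimately have x0: "0 < x" "c \<le> x / K" using K by (linarith, simp add: pos_le_divide_eq)
        have "(x / K) powr (1 - p) \<le> D"
        proof (cases "p \<le> 1")
          case True
          then have "(x / K) powr (1 - p) \<le> 1" using x0 x K by (intro powr_le1) auto
          then show ?thesis using D by linarith
        next
          case False
          then have "(x / K) powr (1 - p) \<le> c powr (1 - p)" using x0 c by (intro powr_mono2') auto
          then show ?thesis by (simp add: D_def)
        qed
        then have "x powr (1 - p) \<le> D * K powr (1 - p)" using x0 K by (simp add: powr_divide field_simps)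
        then have "x powr (1 - p) * x powr p \<le> D * K powr (1 - p) * x powr p" by (intro mult_right_mono) auto
        moreover have "x powr (1 - p) * x powr p = x" using x0 by (simp flip: powr_add)
        ultimately show ?thesis using c K by (simp add: add_increasing2)
      qed
      have area: "emeasure lborel (cball y \<rho>) = ennreal (pi * \<rho>\<^sup>2)"
        using \<rho> by (simp add: emeasure_cball unit_ball_vol_2)
      have meas: "(\<lambda>z. ennreal (norm (F z) powr p) * indicator (cball w R) z) \<in> borel_measurable borel"
        using contF p by (intro continuous_on_indicator_borel_ennreal continuous_intros continuous_on_powr') auto
      have "ennreal (pi * \<rho>\<^sup>2 * norm (F y)) \<le> (\<integral>\<^sup>+z. ennreal (norm (F z)) * indicator (cball y \<rho>) z \<partial>lborel)"
        using F sub \<rho> by (intro holomorphic_le_disk_mean) (auto intro: holomorphic_on_subset)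
      also have "\<dots> \<le> (\<integral>\<^sup>+z. ennreal (D * K powr (1 - p)) * (ennreal (norm (F z) powr p) * indicator (cball w R) z)
          + ennreal (c * K) * indicator (cball y \<rho>) z \<partial>lborel)"
      proof (intro nn_integral_mono)
        fix z
        show "ennreal (norm (F z)) * indicator (cball y \<rho>) z \<le> ennreal (D * K powr (1 - p)) * (ennreal (norm (F z) powr p) * indicator (cball w R) z)
          + ennreal (c * K) * indicator (cball y \<rho>) z"
        proof (cases "z \<in> cball y \<rho>")
          case True
          then have "z \<in> cball w R" using sub by blast
          moreover have "ennreal (norm (F z)) \<le> ennreal (D * K powr (1 - p) * norm (F z) powr p + c * K)"
            using x_le[OF _ FK[OF True]] by (intro ennreal_leI) auto
          ultimately show ?thesis using True c K D by (simp add: ennreal_mult)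
        qed simp
      qed
      also have "\<dots> = ennreal (D * K powr (1 - p)) * ?I + ennreal (c * K) * ennreal (pi * \<rho>\<^sup>2)"
        by (subst nn_integral_add) (use meas in \<open>auto simp: nn_integral_cmult area\<close>)
      also have "\<dots> = ennreal (D * K powr (1 - p) * i + c * K * (pi * \<rho>\<^sup>2))"
        unfolding i using i(2) c K D by (simp add: ennreal_mult)
      finally have "pi * \<rho>\<^sup>2 * norm (F y) \<le> D * K powr (1 - p) * i + c * K * (pi * \<rho>\<^sup>2)"
        using i(2) c K D by (subst (asm) ennreal_le_iff) auto
      then have "c * pi * K * \<rho>\<^sup>2 \<le> D * K powr (1 - p) * i" by (simp add: Fy algebra_simps)
      then have "c * pi * K * \<rho>\<^sup>2 * K powr (p - 1) \<le> D * K powr (1 - p) * i * K powr (p - 1)"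
        by (intro mult_right_mono) auto
      then have "c * pi * ((K * K powr (p - 1)) * \<rho>\<^sup>2) \<le> D * i * (K powr (1 - p) * K powr (p - 1))"
        by (simp only: mult_ac)
      moreover have "K powr (1 - p) * K powr (p - 1) = 1" using K by (simp flip: powr_add)
      moreover have "K * K powr (p - 1) = K powr p" using K by (simp add: powr_mult_base)
      ultimately have "c * pi * (K powr p * \<rho>\<^sup>2) \<le> D * i" by simp
      moreover have "K powr p * \<rho>\<^sup>2 = \<phi> y powr p"
      proof -
        have "K powr p = \<phi> y powr p * \<rho> powr (- 2)" using M \<rho> p by (simp add: K_def powr_mult powr_powr)
        moreover have "\<rho> powr (- 2) * \<rho>\<^sup>2 = 1" using \<rho> by (simp add: powr_minus powr_numeral)
        ultimately show ?thesis by simp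
      qed
      moreover have "c * pi * (norm (F w) powr p * R\<^sup>2) \<le> c * pi * \<phi> y powr p"
      proof (intro mult_left_mono)
        have "norm (F w) powr p * R\<^sup>2 = \<phi> w powr p"
          unfolding \<phi>w using R p by (simp add: powr_mult powr_powr powr_numeral)
        also have "\<dots> \<le> \<phi> y powr p" using y(2)[of w] R p \<open>0 < \<phi> w\<close> by (intro powr_mono2) auto
        finally show "norm (F w) powr p * R\<^sup>2 \<le> \<phi> y powr p" .
      qed (use c in auto)
      ultimately have "c * pi * (norm (F w) powr p * R\<^sup>2) \<le> D * i" by simp
      then have "norm (F w) powr p \<le> C / R\<^sup>2 * i" using c R by (simp add: C_def field_simps)
      then show ?thesis unfolding i using C i(2) by (simp add: ennreal_mult[symmetric] ennreal_leI)
    qed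
  qed
qed

section \<open>Integrals of powers of the Szego kernel\<close>

text \<open>For |x| \<le> pi/2 the distance from 1 to the line through 0 at angle x is |sin x|; for
  larger angles the real part is already at least 1. The radius \<open>t\<close> may exceed 1, since
  it will also be a quotient of two moduli.\<close>

lemma norm_one_minus_cis_ge:
  assumes x: "\<bar>x\<bar> \<le> pi" and t: "0 \<le> t"
  shows "\<bar>x\<bar> / pi \<le> norm (1 - of_real t * cis x)"
proof (cases "\<bar>x\<bar> \<le> pi / 2")
  case True
  have sin_ge: "y / pi \<le> sin y" if "0 \<le> y" "y \<le> pi / 2" for y
  proof (cases "y \<le> pi / 3")
    case True
    show ?thesis
    proof (cases "y = 0")
      case False
      then have "0 < y" using that by simp
      then obtain z where z: "0 < z" "z < y" "sin y - sin 0 = (y - 0) * cos z"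
        using MVT2[of 0 y sin cos] DERIV_sin by blast
      have "cos (pi / 3) \<le> cos z" using z True by (intro cos_monotone_0_pi_le) auto
      then have "y * (1 / 2) \<le> sin y" using z that by (simp add: cos_60 mult_left_mono)
      moreover have "y / pi \<le> y / 2" using that pi_ge_two by (intro divide_left_mono) auto
      ultimately show ?thesis by linarith
    qed simp
  next
    case False
    have "sin (pi / 3) \<le> sin y" using False that by (intro sin_monotone_2pi_le) auto
    moreover have "1 / 2 \<le> sqrt 3 / 2" by (simp add: real_le_rsqrt)
    moreover have "y / pi \<le> 1 / 2" using that by (simp add: field_simps)
    ultimately show ?thesis unfolding sin_60 by linarith
  qed
  have "\<bar>x\<bar> / pi \<le> \<bar>sin x\<bar>"
    using sin_ge[of "\<bar>x\<bar>"] True by (cases "0 \<le> x") auto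
  also have "\<bar>sin x\<bar> \<le> norm (1 - of_real t * cis x)"
  proof -
    have "(1 - t * cos x)\<^sup>2 + (t * sin x)\<^sup>2 - (sin x)\<^sup>2 = (t - cos x)\<^sup>2"
      using sin_cos_squared_add[of x] by algebra
    then have "(sin x)\<^sup>2 \<le> (1 - t * cos x)\<^sup>2 + (t * sin x)\<^sup>2" by (smt (verit) zero_le_power2)
    then have "sqrt ((sin x)\<^sup>2) \<le> sqrt ((1 - t * cos x)\<^sup>2 + (t * sin x)\<^sup>2)" by (rule real_sqrt_le_mono)
    then show ?thesis by (simp add: norm_complex_def)
  qed
  finally show ?thesis .
next
  case False
  then have "cos \<bar>x\<bar> \<le> 0" using cos_monotone_0_pi_le[of "pi / 2" "\<bar>x\<bar>"] x by simp
  then have "1 \<le> 1 - t * cos x" using t by (simp add: mult_nonneg_nonpos)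
  also have "\<dots> \<le> norm (1 - of_real t * cis x)"
    using abs_Re_le_cmod[of "1 - of_real t * cis x"] by simp
  finally have "1 \<le> norm (1 - of_real t * cis x)" .
  moreover have "\<bar>x\<bar> / pi \<le> 1" using x by simp
  ultimately show ?thesis by linarith
qed

lemma angle_mod_2pi:
  assumes "0 \<le> x" "x \<le> 2 * pi" "0 \<le> y" "y \<le> 2 * pi"
  shows "\<exists>m\<in>{-1, 0, 1}. \<bar>x - y - 2 * pi * m\<bar> \<le> pi"
  using assms by (cases "x - y > pi"; cases "x - y < - pi") auto

lemma nn_integral_shifted_abs_powr:
  fixes b d c :: real
  assumes b: "1 < b" and d: "0 < d"
  shows "(\<integral>\<^sup>+x. ennreal ((d + \<bar>x - c\<bar>) powr (- b)) \<partial>lborel) = ennreal (2 / (b - 1) * d powr (1 - b))"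
proof -
  let ?f = "\<lambda>x. (d + \<bar>x\<bar>) powr (- b)"
  have half: "(\<integral>\<^sup>+x. ennreal (?f x) * indicator {0..} x \<partial>lborel) = ennreal (d powr (1 - b) / (b - 1))"
  proof -
    have lim: "((\<lambda>x. (d + x) powr (1 - b)) \<longlongrightarrow> 0) at_top"
      using b by (intro tendsto_neg_powr filterlim_tendsto_add_at_top[OF tendsto_const]) (auto simp: filterlim_ident)
    have "(\<integral>\<^sup>+x. ennreal (?f x) * indicator {0..} x \<partial>lborel) = ennreal (0 - (- ((d + 0) powr (1 - b) / (b - 1))))"
    proof (rule nn_integral_FTC_atLeast)
      show "((\<lambda>x. - ((d + x) powr (1 - b) / (b - 1))) \<longlongrightarrow> 0) at_top"
        using tendsto_minus[OF tendsto_divide[OF lim tendsto_const[of "b - 1"]]] b by simp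
      fix x :: real assume "0 \<le> x"
      then have "((\<lambda>x. - ((d + x) powr (1 - b) / (b - 1))) has_real_derivative
          - ((1 - b) * (d + x) powr (- b) / (b - 1))) (at x)"
        using d b by (auto intro!: derivative_eq_intros)
      moreover have "- ((1 - b) * (d + x) powr (- b) / (b - 1)) = (d + x) powr (- b)"
      proof -
        have "(1 - b) * (d + x) powr (- b) = - ((b - 1) * (d + x) powr (- b))" by (simp add: algebra_simps)
        then show ?thesis using b by simp
      qed
      ultimately show "((\<lambda>x. - ((d + x) powr (1 - b) / (b - 1))) has_real_derivative ?f x) (at x)"
        using \<open>0 \<le> x\<close> by simp
    qed auto
    then show ?thesis by simp
  qed
  have "(\<integral>\<^sup>+x. ennreal ((d + \<bar>x - c\<bar>) powr (- b)) \<partial>lborel) = (\<integral>\<^sup>+x. ennreal (?f x) \<partial>lborel)"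
    by (subst nn_integral_real_affine[of _ 1 c]) auto
  also have "\<dots> = (\<integral>\<^sup>+x. ennreal (?f x) * indicator {0..} x + ennreal (?f x) * indicator {..0} x \<partial>lborel)"
    using AE_lborel_singleton[of 0] by (intro nn_integral_cong_AE, eventually_elim) (auto split: split_indicator)
  also have "\<dots> = (\<integral>\<^sup>+x. ennreal (?f x) * indicator {0..} x \<partial>lborel) + (\<integral>\<^sup>+x. ennreal (?f x) * indicator {..0} x \<partial>lborel)"
    by (intro nn_integral_add) auto
  also have "(\<integral>\<^sup>+x. ennreal (?f x) * indicator {..0} x \<partial>lborel) = (\<integral>\<^sup>+x. ennreal (?f x) * indicator {0..} x \<partial>lborel)"
    by (subst nn_integral_real_affine[of _ "-1" 0]) (auto intro!: nn_integral_cong split: split_indicator)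
  finally show ?thesis unfolding half using b by (simp flip: ennreal_plus)
qed

text \<open>The modulus dominates 1 - |a|, 1 - r and the angular distance divided by pi, hence a
  third of their sum. Both arguments lie in [0, 2 pi], so three shifts by multiples of 2 pi cover
  all cases.\<close>

lemma norm_one_minus_cnj_mult_ge:
  assumes a: "norm a < 1" and r: "0 \<le> r" "r < 1" and x: "0 \<le> x" "x \<le> 2 * pi"
  shows "\<exists>m\<in>{-1, 0, 1}. (1 - norm a + (1 - r) + \<bar>x - (Arg2pi a + 2 * pi * m)\<bar>) / (3 * pi)
    \<le> norm (1 - cnj a * (of_real r * cis x))"
proof -
  have "\<exists>m\<in>{-1, 0, 1}. \<bar>x - Arg2pi a - 2 * pi * m\<bar> \<le> pi"
    using x Arg2pi[of a] by (intro angle_mod_2pi) auto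
  then obtain m where m: "m \<in> {-1, 0, 1}" "\<bar>x - Arg2pi a - 2 * pi * m\<bar> \<le> pi" by blast
  define y where "y = x - (Arg2pi a + 2 * pi * m)"
  have a_eq: "a = of_real (norm a) * cis (Arg2pi a)" using Arg2pi_eq[of a] by (simp add: cis_conv_exp)
  have cis_m: "cis (2 * pi * m) = 1" using m(1) by (auto simp: complex_eq_iff)
  have "cnj a * (of_real r * cis x) = of_real (norm a * r) * cis (x - Arg2pi a)"
    by (subst a_eq) (simp add: cis_cnj cis_divide[symmetric] cis_inverse[symmetric] field_simps)
  also have "cis (x - Arg2pi a) = cis y"
    unfolding y_def diff_diff_eq[symmetric] cis_divide[symmetric] cis_m by simp
  finally have eq: "cnj a * (of_real r * cis x) = of_real (norm a * r) * cis y" .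
  let ?n = "norm (1 - cnj a * (of_real r * cis x))"
  have "\<bar>y\<bar> / pi \<le> ?n" unfolding eq using m(2) r by (intro norm_one_minus_cis_ge) (auto simp: y_def algebra_simps)
  moreover have n1: "1 - norm a * r \<le> ?n"
    using norm_triangle_ineq2[of 1 "cnj a * (of_real r * cis x)"] r by (simp add: norm_mult)
  then have "1 - norm a \<le> ?n" "1 - r \<le> ?n"
    using mult_left_mono[of r 1 "norm a"] mult_right_mono[of "norm a" 1 r] r a by auto
  moreover have "(1 - norm a) / pi \<le> 1 - norm a" "(1 - r) / pi \<le> 1 - r"
    using a r divide_left_mono[of 1 pi "1 - norm a"] divide_left_mono[of 1 pi "1 - r"] pi_gt3 by auto
  ultimately have "(1 - norm a) / pi + (1 - r) / pi + \<bar>y\<bar> / pi \<le> 3 * ?n" by linarith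
  then have "(1 - norm a + (1 - r) + \<bar>y\<bar>) / pi \<le> 3 * ?n" by (simp only: add_divide_distrib)
  then have "(1 - norm a + (1 - r) + \<bar>y\<bar>) / (3 * pi) \<le> ?n"
    by (simp only: pos_divide_le_eq pi_gt_zero mult_pos_pos zero_less_numeral mult_ac)
  then show ?thesis unfolding y_def using m(1) by blast
qed

abbreviation kernel_integral :: "real \<Rightarrow> real \<Rightarrow> complex \<Rightarrow> ennreal" where
  "kernel_integral \<alpha> b a \<equiv>
    (\<integral>\<^sup>+z. ennreal ((1 - (norm z)\<^sup>2) powr \<alpha> * norm (1 - cnj a * z) powr (- b)) * indicator unit_disk z \<partial>lborel)"

text \<open>With e = 1 - |a| and u = 1 - r, integration over the angle leaves u^\<alpha> (e +
  u)^(1-b), with the factor 6/(b-1) from three shifts of 2/(b-1) each. The last integral stays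
  unevaluated because it is a power for b > \<alpha> + 2 and a logarithm for b = \<alpha> +
  2.\<close>

lemma nn_integral_disk_kernel_le:
  fixes \<alpha> b :: real and a :: complex
  assumes \<alpha>: "-1 < \<alpha>" and b: "1 < b" and a: "norm a < 1"
  shows "kernel_integral \<alpha> b a
    \<le> ennreal (2 powr \<bar>\<alpha>\<bar> * (3 * pi) powr b * (6 / (b - 1))) *
       (ennreal ((1 - norm a) powr (\<alpha> + 2 - b) / (\<alpha> + 1)) + (\<integral>\<^sup>+u. ennreal (u powr (\<alpha> + 1 - b)) * indicator {1 - norm a..1} u \<partial>lborel))"
proof -
  define e where "e = 1 - norm a"
  have e: "0 < e" "e \<le> 1" using a by (auto simp: e_def)
  define H where "H z = ennreal ((1 - (norm z)\<^sup>2) powr \<alpha> * norm (1 - cnj a * z) powr (- b)) * indicator unit_disk z" for z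
  have [measurable]: "H \<in> borel_measurable borel" unfolding H_def by measurable
  define c where "c m = Arg2pi a + 2 * pi * m" for m
  define A where "A = 2 powr \<bar>\<alpha>\<bar> * (3 * pi) powr b"
  have A: "0 \<le> A" by (simp add: A_def)
  have pointwise: "ennreal r * H (of_real r * cis x) * indicator {0<..} r * indicator {0..2 * pi} x
    \<le> (ennreal (A * (1 - r) powr \<alpha>) * (\<Sum>m\<in>{-1, 0, 1}. ennreal ((e + (1 - r) + \<bar>x - c m\<bar>) powr (- b)))) * indicator {0..1} r" for r x
  proof (cases "0 < r \<and> r < 1 \<and> x \<in> {0..2 * pi}")
    case True
    have "\<exists>m\<in>{-1, 0, 1}. (e + (1 - r) + \<bar>x - c m\<bar>) / (3 * pi) \<le> norm (1 - cnj a * (of_real r * cis x))"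
      unfolding e_def c_def by (rule norm_one_minus_cnj_mult_ge[OF a]) (use True in auto)
    then obtain m where m: "m \<in> {-1, 0, 1}" "(e + (1 - r) + \<bar>x - c m\<bar>) / (3 * pi) \<le> norm (1 - cnj a * (of_real r * cis x))"
      by blast
    have pos: "0 < e + (1 - r) + \<bar>x - c m\<bar>" using e True by linarith
    have "norm (1 - cnj a * (of_real r * cis x)) powr (- b) \<le> ((e + (1 - r) + \<bar>x - c m\<bar>) / (3 * pi)) powr (- b)"
      using m pos b by (intro powr_mono2') auto
    also have "\<dots> = (3 * pi) powr b * (e + (1 - r) + \<bar>x - c m\<bar>) powr (- b)"
      using pos by (subst powr_divide) (auto simp: powr_minus field_simps)
    finally have n: "norm (1 - cnj a * (of_real r * cis x)) powr (- b) \<le> (3 * pi) powr b * (e + (1 - r) + \<bar>x - c m\<bar>) powr (- b)" .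
    have "(1 + r) powr \<alpha> \<le> (1 + r) powr \<bar>\<alpha>\<bar>" using True by (intro powr_mono) auto
    also have "\<dots> \<le> 2 powr \<bar>\<alpha>\<bar>" using True by (intro powr_mono2) auto
    finally have "(1 + r) powr \<alpha> * (1 - r) powr \<alpha> \<le> 2 powr \<bar>\<alpha>\<bar> * (1 - r) powr \<alpha>" by (intro mult_right_mono) auto
    also have "(1 + r) powr \<alpha> * (1 - r) powr \<alpha> = (1 - r\<^sup>2) powr \<alpha>"
      using True by (simp add: power2_eq_square algebra_simps flip: powr_mult)
    finally have w: "(1 - r\<^sup>2) powr \<alpha> \<le> 2 powr \<bar>\<alpha>\<bar> * (1 - r) powr \<alpha>" .
    have "r * ((1 - r\<^sup>2) powr \<alpha> * norm (1 - cnj a * (of_real r * cis x)) powr (- b))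
      \<le> 1 * ((2 powr \<bar>\<alpha>\<bar> * (1 - r) powr \<alpha>) * ((3 * pi) powr b * (e + (1 - r) + \<bar>x - c m\<bar>) powr (- b)))"
      using True by (intro mult_mono n w) auto
    also have "\<dots> = A * (1 - r) powr \<alpha> * (e + (1 - r) + \<bar>x - c m\<bar>) powr (- b)"
      by (simp add: A_def mult_ac)
    finally have "ennreal (r * ((1 - r\<^sup>2) powr \<alpha> * norm (1 - cnj a * (of_real r * cis x)) powr (- b)))
      \<le> ennreal (A * (1 - r) powr \<alpha> * (e + (1 - r) + \<bar>x - c m\<bar>) powr (- b))" by (rule ennreal_leI)
    also have "\<dots> = ennreal (A * (1 - r) powr \<alpha>) * ennreal ((e + (1 - r) + \<bar>x - c m\<bar>) powr (- b))"
      using A by (intro ennreal_mult) auto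
    also have "\<dots> \<le> ennreal (A * (1 - r) powr \<alpha>) * (\<Sum>m\<in>{-1, 0, 1}. ennreal ((e + (1 - r) + \<bar>x - c m\<bar>) powr (- b)))"
      by (intro mult_left_mono member_le_sum m) auto
    finally show ?thesis using True by (simp add: H_def norm_mult ennreal_mult)
  next
    case False
    then have "ennreal r * H (of_real r * cis x) * indicator {0<..} r * indicator {0..2 * pi} x = 0"
      by (auto simp: H_def norm_mult split: split_indicator)
    then show ?thesis by (simp only: zero_le)
  qed
  have "(\<integral>\<^sup>+z. H z \<partial>lborel) = (\<integral>\<^sup>+x. \<integral>\<^sup>+r. ennreal r * H (of_real r * cis x) * indicator {0<..} r * indicator {0..2 * pi} x \<partial>lborel \<partial>lborel)"
    by (subst nn_integral_polar) (simp_all add: nn_integral_multc)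
  also have "\<dots> \<le> (\<integral>\<^sup>+x. \<integral>\<^sup>+r. (ennreal (A * (1 - r) powr \<alpha>) * (\<Sum>m\<in>{-1, 0, 1}. ennreal ((e + (1 - r) + \<bar>x - c m\<bar>) powr (- b)))) * indicator {0..1} r \<partial>lborel \<partial>lborel)"
    by (intro nn_integral_mono pointwise)
  also have "\<dots> = (\<integral>\<^sup>+r. \<integral>\<^sup>+x. (ennreal (A * (1 - r) powr \<alpha>) * (\<Sum>m\<in>{-1, 0, 1}. ennreal ((e + (1 - r) + \<bar>x - c m\<bar>) powr (- b)))) * indicator {0..1} r \<partial>lborel \<partial>lborel)"
    by (rule lborel_pair.Fubini') measurable
  also have "\<dots> = (\<integral>\<^sup>+r. ennreal (A * (6 / (b - 1))) * (ennreal ((1 - r) powr \<alpha> * (e + (1 - r)) powr (1 - b)) * indicator {0..1} r) \<partial>lborel)"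
  proof (rule nn_integral_cong)
    fix r :: real
    show "(\<integral>\<^sup>+x. (ennreal (A * (1 - r) powr \<alpha>) * (\<Sum>m\<in>{-1, 0, 1}. ennreal ((e + (1 - r) + \<bar>x - c m\<bar>) powr (- b)))) * indicator {0..1} r \<partial>lborel)
      = ennreal (A * (6 / (b - 1))) * (ennreal ((1 - r) powr \<alpha> * (e + (1 - r)) powr (1 - b)) * indicator {0..1} r)"
    proof (cases "r \<in> {0..1}")
      case True
      then have d: "0 < e + (1 - r)" using e by simp
      have "(\<integral>\<^sup>+x. (\<Sum>m\<in>{-1, 0, 1}. ennreal ((e + (1 - r) + \<bar>x - c m\<bar>) powr (- b))) \<partial>lborel)
        = (\<Sum>m\<in>{-1, 0, 1 :: real}. ennreal (2 / (b - 1) * (e + (1 - r)) powr (1 - b)))"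
        by (subst nn_integral_sum) (auto simp: nn_integral_shifted_abs_powr[OF b d])
      also have "\<dots> = ennreal (3 * (2 / (b - 1) * (e + (1 - r)) powr (1 - b)))"
        using b by (subst ennreal_mult) auto
      also have "\<dots> = ennreal (6 / (b - 1) * (e + (1 - r)) powr (1 - b))" by simp
      finally show ?thesis using True A b
        by (simp add: nn_integral_cmult mult_ac flip: ennreal_mult)
    qed simp
  qed
  also have "\<dots> = ennreal (A * (6 / (b - 1))) * (\<integral>\<^sup>+r. ennreal ((1 - r) powr \<alpha> * (e + (1 - r)) powr (1 - b)) * indicator {0..1} r \<partial>lborel)"
    by (intro nn_integral_cmult) measurable
  also have "(\<integral>\<^sup>+r. ennreal ((1 - r) powr \<alpha> * (e + (1 - r)) powr (1 - b)) * indicator {0..1} r \<partial>lborel)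
    = (\<integral>\<^sup>+u. ennreal (u powr \<alpha> * (e + u) powr (1 - b)) * indicator {0..1} u \<partial>lborel)"
    by (subst nn_integral_real_affine[of _ "-1" 1]) (auto intro!: nn_integral_cong split: split_indicator)
  \<comment> \<open>The integral is split at u = e, and e + u is replaced by the larger of e and u;
    the power 1 - b is negative.\<close>
  also have "\<dots> \<le> (\<integral>\<^sup>+u. ennreal (e powr (1 - b)) * (ennreal (u powr \<alpha>) * indicator {0..e} u) + ennreal (u powr (\<alpha> + 1 - b)) * indicator {e..1} u \<partial>lborel)"
  proof (intro nn_integral_mono)
    fix u :: real
    have "ennreal (u powr \<alpha> * (e + u) powr (1 - b)) \<le> ennreal (e powr (1 - b)) * ennreal (u powr \<alpha>)" if "u \<in> {0..e}"
    proof -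
      have "(e + u) powr (1 - b) \<le> e powr (1 - b)" using that e b by (intro powr_mono2') auto
      then show ?thesis by (simp add: mult_left_mono mult.commute ennreal_leI flip: ennreal_mult)
    qed
    moreover have "ennreal (u powr \<alpha> * (e + u) powr (1 - b)) \<le> ennreal (u powr (\<alpha> + 1 - b))" if "u \<in> {e..1}"
    proof -
      have "(e + u) powr (1 - b) \<le> u powr (1 - b)" using that e b by (intro powr_mono2') auto
      then have "u powr \<alpha> * (e + u) powr (1 - b) \<le> u powr \<alpha> * u powr (1 - b)" by (intro mult_left_mono) auto
      then show ?thesis using that e by (intro ennreal_leI) (simp add: add_diff_eq flip: powr_add)
    qed
    ultimately show "ennreal (u powr \<alpha> * (e + u) powr (1 - b)) * indicator {0..1} u
      \<le> ennreal (e powr (1 - b)) * (ennreal (u powr \<alpha>) * indicator {0..e} u) + ennreal (u powr (\<alpha> + 1 - b)) * indicator {e..1} u"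
      using e by (auto split: split_indicator intro: add_increasing add_increasing2)
  qed
  also have "\<dots> = ennreal (e powr (1 - b)) * (\<integral>\<^sup>+u. ennreal (u powr \<alpha>) * indicator {0..e} u \<partial>lborel) + (\<integral>\<^sup>+u. ennreal (u powr (\<alpha> + 1 - b)) * indicator {e..1} u \<partial>lborel)"
    by (subst nn_integral_add) (auto simp: nn_integral_cmult)
  also have "(\<integral>\<^sup>+u. ennreal (u powr \<alpha>) * indicator {0..e} u \<partial>lborel) = ennreal (e powr (\<alpha> + 1) / (\<alpha> + 1))"
    using nn_integral_has_integral_lebesgue[OF _ has_integral_powr_from_0[of \<alpha> e]] \<alpha> e
    by (simp add: mult.commute ennreal_mult' ennreal_indicator)
  also have "ennreal (e powr (1 - b)) * ennreal (e powr (\<alpha> + 1) / (\<alpha> + 1)) = ennreal (e powr (\<alpha> + 2 - b) / (\<alpha> + 1))"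
    using \<alpha> by (simp add: algebra_simps flip: ennreal_mult powr_add)
  finally show ?thesis by (simp add: H_def A_def e_def mult_left_mono mult.assoc)
qed

lemma nn_integral_disk_kernel_le_powr:
  fixes \<alpha> b :: real
  assumes \<alpha>: "-1 < \<alpha>" and b: "\<alpha> + 2 < b"
  shows "\<exists>C>0. \<forall>a. norm a < 1 \<longrightarrow>
    kernel_integral \<alpha> b a
      \<le> ennreal (C * (1 - norm a) powr (\<alpha> + 2 - b))"
proof -
  define A where "A = 2 powr \<bar>\<alpha>\<bar> * (3 * pi) powr b * (6 / (b - 1))"
  have A: "0 < A" using \<alpha> b by (simp add: A_def)
  define C where "C = A * (1 / (\<alpha> + 1) + 1 / (b - \<alpha> - 2))"
  have C: "0 < C" using A \<alpha> b by (simp add: C_def add_pos_pos)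
  show ?thesis
  proof (intro exI[of _ C] conjI allI impI C)
    fix a :: complex assume a: "norm a < 1"
    define e where "e = 1 - norm a"
    have e: "0 < e" "e \<le> 1" using a by (auto simp: e_def)
    have "(\<integral>\<^sup>+u. ennreal (u powr (\<alpha> + 1 - b)) * indicator {e..1} u \<partial>lborel) = ennreal (1 powr (\<alpha> + 2 - b) / (\<alpha> + 2 - b) - e powr (\<alpha> + 2 - b) / (\<alpha> + 2 - b))"
    proof (intro nn_integral_FTC_Icc)
      fix u assume "u \<in> {e..1}"
      then have "((\<lambda>u. u powr c / c) has_real_derivative u powr (c - 1)) (at u)" if "c \<noteq> 0" for c
        using e that by (auto intro!: derivative_eq_intros)
      from this[of "\<alpha> + 2 - b"]
      moreover have "\<alpha> + 2 - b - 1 = \<alpha> + 1 - b" by simp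
      ultimately show "((\<lambda>u. u powr (\<alpha> + 2 - b) / (\<alpha> + 2 - b)) has_real_derivative u powr (\<alpha> + 1 - b)) (at u)"
        using b by simp
    qed (use e in auto)
    also have "\<dots> \<le> ennreal (e powr (\<alpha> + 2 - b) / (b - \<alpha> - 2))"
      using b by (intro ennreal_leI) (simp add: field_simps)
    finally have "kernel_integral \<alpha> b a
      \<le> ennreal A * (ennreal (e powr (\<alpha> + 2 - b) / (\<alpha> + 1)) + ennreal (e powr (\<alpha> + 2 - b) / (b - \<alpha> - 2)))"
      using \<alpha> b unfolding A_def e_def
      by (intro order_trans[OF nn_integral_disk_kernel_le[OF \<alpha> _ a]] mult_left_mono add_left_mono) auto
    also have "\<dots> = ennreal (C * e powr (\<alpha> + 2 - b))"
      using A \<alpha> b by (simp add: C_def algebra_simps flip: ennreal_plus ennreal_mult)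
    finally show "kernel_integral \<alpha> b a
      \<le> ennreal (C * (1 - norm a) powr (\<alpha> + 2 - b))" by (simp add: e_def)
  qed
qed

lemma nn_integral_disk_kernel_le_ln:
  fixes \<alpha> :: real
  assumes \<alpha>: "-1 < \<alpha>"
  shows "\<exists>C>0. \<forall>a. norm a < 1 \<longrightarrow>
    kernel_integral \<alpha> (\<alpha> + 2) a
      \<le> ennreal (C * (1 + ln (1 / (1 - norm a))))"
proof -
  define A where "A = 2 powr \<bar>\<alpha>\<bar> * (3 * pi) powr (\<alpha> + 2) * (6 / (\<alpha> + 2 - 1))"
  have A: "0 < A" using \<alpha> by (simp add: A_def)
  define C where "C = A * (1 / (\<alpha> + 1) + 1)"
  have C: "0 < C" using A \<alpha> by (simp add: C_def add_pos_pos)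
  show ?thesis
  proof (intro exI[of _ C] conjI allI impI C)
    fix a :: complex assume a: "norm a < 1"
    define e where "e = 1 - norm a"
    have e: "0 < e" "e \<le> 1" using a by (auto simp: e_def)
    have "(\<integral>\<^sup>+u. ennreal (u powr (\<alpha> + 1 - (\<alpha> + 2))) * indicator {e..1} u \<partial>lborel) = ennreal (ln 1 - ln e)"
      using e by (intro nn_integral_FTC_Icc) (auto intro!: derivative_eq_intros simp: powr_minus divide_inverse)
    then have "kernel_integral \<alpha> (\<alpha> + 2) a
      \<le> ennreal A * (ennreal (1 / (\<alpha> + 1)) + ennreal (ln (1 / e)))"
      using nn_integral_disk_kernel_le[OF \<alpha> _ a, of "\<alpha> + 2"] \<alpha> a e unfolding A_def e_def
      by (simp add: ln_div)
    also have "\<dots> = ennreal (A * (1 / (\<alpha> + 1) + ln (1 / e)))"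
      using A \<alpha> e by (simp flip: ennreal_plus ennreal_mult)
    also have "\<dots> \<le> ennreal (C * (1 + ln (1 / e)))"
    proof (intro ennreal_leI)
      have "1 / (\<alpha> + 1) + ln (1 / e) \<le> (1 / (\<alpha> + 1) + 1) * (1 + ln (1 / e))"
        using \<alpha> e by (simp add: algebra_simps)
      then show "A * (1 / (\<alpha> + 1) + ln (1 / e)) \<le> C * (1 + ln (1 / e))"
        using A by (simp add: C_def mult.assoc mult_left_mono)
    qed
    finally show "kernel_integral \<alpha> (\<alpha> + 2) a
      \<le> ennreal (C * (1 + ln (1 / (1 - norm a))))" by (simp add: e_def)
  qed
qed

section \<open>Whitney boxes\<close>

definition gen :: "complex \<Rightarrow> nat" where
  "gen z = nat \<lfloor>log 2 (1 / (1 - norm z))\<rfloor>"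

definition arc_index :: "nat \<Rightarrow> complex \<Rightarrow> nat" where
  "arc_index k z = nat \<lfloor>2 ^ k * (Arg2pi z / (2 * pi))\<rfloor>"

text \<open>The boxes are closed, so that |f'| attains its maximum on each and radially consecutive
  ones share an edge. Where disjointness matters, the level sets of \<open>gen\<close> and
  \<open>arc_index\<close> are used instead.\<close>

definition whitney_box :: "nat \<Rightarrow> nat \<Rightarrow> complex set" where
  "whitney_box k i = (\<lambda>(r, x). of_real r * cis x) `
     ({1 - (1/2) ^ k..1 - (1/2) ^ Suc k} \<times> {2 * pi * (i / 2 ^ k)..2 * pi * (Suc i / 2 ^ k)})"

lemma gen_bounds:
  assumes "norm z < 1"
  shows "1 - (1/2) ^ gen z \<le> norm z" "norm z < 1 - (1/2) ^ Suc (gen z)"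
proof -
  have "1 \<le> 1 / (1 - norm z)" using assms by simp
  then have "0 \<le> log 2 (1 / (1 - norm z))" by (subst zero_le_log_cancel_iff) (use assms in auto)
  then have g: "int (gen z) = \<lfloor>log 2 (1 / (1 - norm z))\<rfloor>" by (simp add: gen_def)
  have "2 powr real (gen z) \<le> 1 / (1 - norm z) \<and> 1 / (1 - norm z) < 2 powr (real (gen z) + 1)"
    using floor_log_eq_powr_iff[of "1 / (1 - norm z)" 2 "int (gen z)"] assms by (simp flip: g)
  then have "2 ^ gen z \<le> 1 / (1 - norm z)" "1 / (1 - norm z) < 2 ^ Suc (gen z)"
    by (auto simp: powr_realpow powr_add)
  then show "1 - (1/2) ^ gen z \<le> norm z" "norm z < 1 - (1/2) ^ Suc (gen z)"
    using assms by (auto simp: field_simps power_one_over)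
qed

lemma arc_index_less: "arc_index k z < 2 ^ k"
proof -
  have "Arg2pi z / (2 * pi) < 1" using Arg2pi[of z] by simp
  then have "2 ^ k * (Arg2pi z / (2 * pi)) < 2 ^ k * 1" by (intro mult_strict_left_mono) auto
  then have "2 ^ k * (Arg2pi z / (2 * pi)) < real (2 ^ k)" by (simp only: mult_1_right of_nat_power of_nat_numeral)
  then have "\<lfloor>2 ^ k * (Arg2pi z / (2 * pi))\<rfloor> < int (2 ^ k)" by (simp add: floor_less_iff)
  then show ?thesis unfolding arc_index_def by (subst nat_less_iff) (use Arg2pi[of z] in auto)
qed

lemma arc_index_bounds:
  "2 * pi * (arc_index k z / 2 ^ k) \<le> Arg2pi z" "Arg2pi z < 2 * pi * (Suc (arc_index k z) / 2 ^ k)"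
proof -
  have "0 \<le> 2 ^ k * (Arg2pi z / (2 * pi))" using Arg2pi[of z] by simp
  then have "real (arc_index k z) \<le> 2 ^ k * (Arg2pi z / (2 * pi))" "2 ^ k * (Arg2pi z / (2 * pi)) < real (Suc (arc_index k z))"
    unfolding arc_index_def by linarith+
  then show "2 * pi * (arc_index k z / 2 ^ k) \<le> Arg2pi z" "Arg2pi z < 2 * pi * (Suc (arc_index k z) / 2 ^ k)"
    by (simp_all add: field_simps)
qed

lemma arc_index_div:
  assumes "j \<le> k"
  shows "arc_index k z div 2 ^ (k - j) = arc_index j z"
proof -
  have "(2::real) ^ k = 2 ^ (k - j) * 2 ^ j" using assms by (simp flip: power_add)
  then have "2 ^ k * (Arg2pi z / (2 * pi)) / real (2 ^ (k - j)) = 2 ^ j * (Arg2pi z / (2 * pi))"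
    by simp
  then have "\<lfloor>2 ^ j * (Arg2pi z / (2 * pi))\<rfloor> = \<lfloor>2 ^ k * (Arg2pi z / (2 * pi))\<rfloor> div int (2 ^ (k - j))"
    using floor_divide_real_eq_div[of "int (2 ^ (k - j))" "2 ^ k * (Arg2pi z / (2 * pi))"] by simp
  then show ?thesis unfolding arc_index_def by (simp add: nat_div_distrib Arg2pi nat_power_eq)
qed

lemma measurable_gen [measurable]: "gen \<in> borel \<rightarrow>\<^sub>M count_space UNIV"
  unfolding gen_def[abs_def] by measurable

lemma measurable_arc_index [measurable]: "arc_index k \<in> borel \<rightarrow>\<^sub>M count_space UNIV"
  unfolding arc_index_def[abs_def] by measurable

lemma compact_whitney_box: "compact (whitney_box k i)"
  unfolding whitney_box_def
  by (intro compact_continuous_image compact_Times compact_Icc) (auto intro!: continuous_intros simp: case_prod_unfold)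

lemma whitney_box_nonempty: "whitney_box k i \<noteq> {}"
  by (auto simp: whitney_box_def divide_right_mono)

lemma norm_whitney_box:
  assumes "z \<in> whitney_box k i"
  shows "1 - (1/2) ^ k \<le> norm z" "norm z \<le> 1 - (1/2) ^ Suc k"
proof -
  have "0 \<le> 1 - (1/2 :: real) ^ k" by (simp add: power_le_one)
  with assms show "1 - (1/2) ^ k \<le> norm z" "norm z \<le> 1 - (1/2) ^ Suc k"
    by (auto simp: whitney_box_def norm_mult)
qed

lemma whitney_box_subset_disk: "whitney_box k i \<subseteq> unit_disk"
proof
  fix z assume "z \<in> whitney_box k i"
  then have "norm z \<le> 1 - (1/2) ^ Suc k" by (rule norm_whitney_box)
  moreover have "0 < (1/2 :: real) ^ Suc k" by simp
  ultimately have "norm z < 1" by linarith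
  then show "z \<in> unit_disk" by simp
qed

text \<open>A box of generation k keeps distance 2^(-k-1) from the unit circle. Half of that as
  radius keeps the ball inside the disk, with 1 - |z| still comparable to 2^(-k).\<close>

lemma cball_whitney_box:
  assumes w: "w \<in> whitney_box k i" and z: "z \<in> cball w ((1/2) ^ (k + 2))"
  shows "(1/2) ^ (k + 2) \<le> 1 - norm z" "1 - norm z \<le> 5 / 4 * (1/2) ^ k"
proof -
  have "norm z \<le> norm w + (1/2) ^ (k + 2)" "norm w - (1/2) ^ (k + 2) \<le> norm z"
    using z norm_triangle_ineq3[of z w] by (auto simp: dist_norm norm_minus_commute)
  then show "(1/2) ^ (k + 2) \<le> 1 - norm z" "1 - norm z \<le> 5 / 4 * (1/2) ^ k"
    using norm_whitney_box[OF w] by auto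
qed

lemma radial_point_in_whitney_box:
  fixes j :: nat and r :: real
  assumes "1 - (1/2) ^ j \<le> r" "r \<le> 1 - (1/2) ^ Suc j"
  shows "of_real r * cis (Arg2pi z) \<in> whitney_box j (arc_index j z)"
  unfolding whitney_box_def using assms arc_index_bounds[where k = j and z = z]
  by (intro image_eqI[of _ _ "(r, Arg2pi z)"]) (auto simp: less_imp_le)

text \<open>The radius from 0 to z meets one box of each generation up to that of z, the one above
  the dyadic arc containing the argument of z, and its part in the box of generation j is no longer
  than 2^(-j).\<close>

lemma norm_le_sum_whitney_boxes:
  fixes s :: "nat \<Rightarrow> nat \<Rightarrow> real"
  assumes f: "f holomorphic_on unit_disk"
    and s: "\<And>k i z. z \<in> whitney_box k i \<Longrightarrow> norm (deriv f z) \<le> s k i"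
    and z: "norm z < 1"
  shows "norm (f z) \<le> norm (f 0) + (\<Sum>j\<le>gen z. (1/2) ^ j * s j (arc_index j z))"
proof -
  define c where "c = cis (Arg2pi z)"
  have s0: "0 \<le> s k i" for k i
    using s whitney_box_nonempty[of k i] norm_ge_zero order_trans by (metis ex_in_conv)
  have step: "norm (f (of_real r * c)) \<le> norm (f (of_real (1 - (1/2) ^ j) * c)) + (1/2) ^ j * s j (arc_index j z)"
    if r: "1 - (1/2) ^ j \<le> r" "r \<le> 1 - (1/2) ^ Suc j" for j r
  proof -
    let ?a = "of_real (1 - (1/2) ^ j) * c" and ?b = "of_real r * c"
    have seg: "x \<in> whitney_box j (arc_index j z)" if "x \<in> closed_segment ?a ?b" for x
    proof -
      obtain u where u: "0 \<le> u" "u \<le> 1" "x = (1 - u) *\<^sub>R ?a + u *\<^sub>R ?b" using \<open>x \<in> closed_segment ?a ?b\<close> by (auto simp: in_segment)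
      define t where "t = (1 - u) * (1 - (1/2) ^ j) + u * r"
      have "x = of_real t * c" unfolding u t_def by (simp add: scaleR_conv_of_real algebra_simps)
      moreover have "1 - (1/2) ^ j \<le> t" "t \<le> r"
        using mult_left_mono[OF r(1), of u] mult_left_mono[OF r(1), of "1 - u"] u by (auto simp: t_def algebra_simps)
      ultimately show ?thesis using radial_point_in_whitney_box[of j t z] r by (simp add: c_def)
    qed
    have "norm (f ?b - f ?a) \<le> s j (arc_index j z) * norm (?b - ?a)"
    proof (rule field_differentiable_bound)
      show "convex (closed_segment ?a ?b)" by (rule convex_closed_segment)
      fix x assume x: "x \<in> closed_segment ?a ?b"
      then have "x \<in> unit_disk" using seg whitney_box_subset_disk by blast
      then show "(f has_field_derivative deriv f x) (at x within closed_segment ?a ?b)"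
        using f by (intro holomorphic_derivI[OF _ open_ball] has_field_derivative_at_within)
      show "norm (deriv f x) \<le> s j (arc_index j z)" using s seg x by blast
    qed auto
    also have "norm (?b - ?a) = r - (1 - (1/2) ^ j)"
    proof -
      have "?b - ?a = of_real (r - (1 - (1/2) ^ j)) * c" by (simp add: algebra_simps)
      then show ?thesis using r by (simp only: norm_mult c_def norm_cis norm_of_real) simp
    qed
    also have "s j (arc_index j z) * \<dots> \<le> s j (arc_index j z) * (1/2) ^ j"
      using r s0 by (intro mult_left_mono) auto
    finally show ?thesis using norm_triangle_ineq2[of "f ?b" "f ?a"] by (simp add: mult.commute)
  qed
  have ind: "norm (f (of_real (1 - (1/2) ^ k) * c)) \<le> norm (f 0) + (\<Sum>j<k. (1/2) ^ j * s j (arc_index j z))" for k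
  proof (induction k)
    case (Suc k)
    then show ?case using step[of k "1 - (1/2) ^ Suc k"] by simp
  qed simp
  have "z = of_real (norm z) * c" using Arg2pi_eq[of z] by (simp add: c_def cis_conv_exp)
  then have "norm (f z) \<le> norm (f (of_real (1 - (1/2) ^ gen z) * c)) + (1/2) ^ gen z * s (gen z) (arc_index (gen z) z)"
    using step[of "gen z" "norm z"] gen_bounds[OF z] by simp
  with ind[of "gen z"] show ?thesis by (simp add: lessThan_Suc_atMost[symmetric])
qed

section \<open>Bounded overlap of the balls around Whitney boxes\<close>

lemma card_nats_near_le: "card {i::nat. \<bar>real i - x\<bar> \<le> 3 / 4} \<le> 2"
proof -
  have "{i::nat. \<bar>real i - x\<bar> \<le> 3 / 4} \<subseteq> {nat \<lceil>x - 3 / 4\<rceil>, Suc (nat \<lceil>x - 3 / 4\<rceil>)}"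
  proof
    fix i assume "i \<in> {i::nat. \<bar>real i - x\<bar> \<le> 3 / 4}"
    then have "\<bar>real i - x\<bar> \<le> 3 / 4" by simp
    then have "x - 3 / 4 \<le> real i" "real i \<le> x - 3 / 4 + 3 / 2" by linarith+
    then have "\<lceil>x - 3 / 4\<rceil> \<le> int i" "int i \<le> \<lceil>x - 3 / 4\<rceil> + 1" by linarith+
    then show "i \<in> {nat \<lceil>x - 3 / 4\<rceil>, Suc (nat \<lceil>x - 3 / 4\<rceil>)}" by auto
  qed
  then have "card {i::nat. \<bar>real i - x\<bar> \<le> 3 / 4} \<le> card {nat \<lceil>x - 3 / 4\<rceil>, Suc (nat \<lceil>x - 3 / 4\<rceil>)}"
    by (intro card_mono) auto
  then show ?thesis by simp
qed

lemma finite_nats_near: "finite {i::nat. \<bar>real i - x\<bar> \<le> c}"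
proof (rule finite_subset)
  show "{i::nat. \<bar>real i - x\<bar> \<le> c} \<subseteq> {..nat \<lceil>x + c\<rceil>}"
    by (auto simp: abs_le_iff) linarith
qed simp

text \<open>A ball containing z fixes the angle of its center up to a quarter of the length of a
  dyadic arc. Two indices remain for each of the three shifts by 2 pi. Generation 0 contains the
  origin, where the argument carries no information, but has a single box.\<close>

lemma card_whitney_balls_generation:
  assumes w: "\<And>i. w i \<in> whitney_box k i" and z: "norm z < 1"
  shows "card {i. i < 2 ^ k \<and> z \<in> cball (w i) ((1/2) ^ (k + 2))} \<le> 6"
proof (cases "k = 0")
  case True
  then have "{i. i < 2 ^ k \<and> z \<in> cball (w i) ((1/2) ^ (k + 2))} \<subseteq> {0}" by auto
  then have "card {i. i < 2 ^ k \<and> z \<in> cball (w i) ((1/2) ^ (k + 2))} \<le> card {0::nat}" by (intro card_mono) auto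
  then show ?thesis by simp
next
  case False
  \<comment> \<open>The shifted argument of z in units of the dyadic arc, minus 1/2. The center of
    arc i is at i + 1/2, the point \<open>w i\<close> is within 1/2 of it, and z within 1/4 of
    \<open>w i\<close>, whence the bound 3/4.\<close>
  define X where "X m = 2 ^ k * (Arg2pi z / (2 * pi) - m) - 1 / 2" for m :: real
  have "{i. i < 2 ^ k \<and> z \<in> cball (w i) ((1/2) ^ (k + 2))} \<subseteq> (\<Union>m\<in>{-1, 0, 1}. {i. \<bar>real i - X m\<bar> \<le> 3 / 4})"
  proof
    fix i assume "i \<in> {i. i < 2 ^ k \<and> z \<in> cball (w i) ((1/2) ^ (k + 2))}"
    then have i: "i < 2 ^ k" and zw: "norm (w i - z) \<le> (1/2) ^ (k + 2)" by (auto simp: dist_norm)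
    obtain r x where rx: "w i = of_real r * cis x" "1 - (1/2) ^ k \<le> r" "2 * pi * (i / 2 ^ k) \<le> x" "x \<le> 2 * pi * (Suc i / 2 ^ k)"
      using w[of i] by (auto simp: whitney_box_def)
    have "(1/2 :: real) ^ k \<le> (1/2) ^ 1" using False by (intro power_decreasing) auto
    then have r: "1 / 2 \<le> r" using rx(2) by simp
    have "real (Suc i) \<le> 2 ^ k" using i by (metis Suc_leI of_nat_le_iff of_nat_numeral of_nat_power)
    then have "real (Suc i) / 2 ^ k \<le> 1" by simp
    then have "2 * pi * (real (Suc i) / 2 ^ k) \<le> 2 * pi * 1" by (intro mult_left_mono) auto
    then have x: "0 \<le> x" "x \<le> 2 * pi" using rx(3,4) order_trans[of 0 "2 * pi * (i / 2 ^ k)" x] by auto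
    obtain m where m: "m \<in> {-1, 0, 1}" "\<bar>Arg2pi z - x - 2 * pi * m\<bar> \<le> pi"
      using angle_mod_2pi[of "Arg2pi z" x] x Arg2pi[of z] by (meson less_imp_le)
    define y where "y = Arg2pi z - x - 2 * pi * m"
    have cis_m: "cis (2 * pi * m) = 1" using m(1) by (auto simp: complex_eq_iff)
    have z_eq: "z = of_real (norm z) * cis (Arg2pi z)" using Arg2pi_eq[of z] by (simp add: cis_conv_exp)
    have "w i - z = of_real r * cis x * (1 - of_real (norm z / r) * cis y)"
    proof -
      have "cis x * cis y = cis (Arg2pi z)"
        unfolding y_def cis_mult by (simp add: cis_m flip: cis_divide)
      then have "of_real r * cis x * (of_real (norm z / r) * cis y) = of_real (norm z) * cis (Arg2pi z)"
        using r by (simp add: mult_ac)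
      then show ?thesis using z_eq by (simp add: rx(1) right_diff_distrib)
    qed
    then have "norm (w i - z) = r * norm (1 - of_real (norm z / r) * cis y)" using r by (simp add: norm_mult)
    moreover have "\<bar>y\<bar> / pi \<le> norm (1 - of_real (norm z / r) * cis y)"
      using m(2) r by (intro norm_one_minus_cis_ge) (auto simp: y_def)
    ultimately have "r * (\<bar>y\<bar> / pi) \<le> (1/2) ^ (k + 2)"
      using zw r mult_left_mono[of "\<bar>y\<bar> / pi" "norm (1 - of_real (norm z / r) * cis y)" r] by linarith
    moreover have "(1 / 2) * (\<bar>y\<bar> / pi) \<le> r * (\<bar>y\<bar> / pi)" using r by (intro mult_right_mono) auto
    moreover have "(1/2 :: real) ^ (k + 2) = (1/2) ^ k / 4" by (simp add: power2_eq_square)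
    ultimately have "\<bar>y\<bar> / pi \<le> (1/2) ^ k / 2" by linarith
    then have y: "2 ^ k * (\<bar>y\<bar> / (2 * pi)) \<le> 1 / 4" by (simp add: field_simps power_one_over)
    have "2 ^ k * (y / (2 * pi)) = X m + 1 / 2 - 2 ^ k * x / (2 * pi)"
      by (simp add: X_def y_def field_simps)
    moreover have "\<bar>2 ^ k * (y / (2 * pi))\<bar> \<le> 1 / 4" using y by (simp add: abs_mult)
    moreover have "real i \<le> 2 ^ k * x / (2 * pi)" "2 ^ k * x / (2 * pi) \<le> real i + 1"
      using rx(3,4) by (simp_all add: field_simps)
    ultimately have "\<bar>real i - X m\<bar> \<le> 3 / 4" by linarith
    then show "i \<in> (\<Union>m\<in>{-1, 0, 1}. {i. \<bar>real i - X m\<bar> \<le> 3 / 4})" using m(1) by blast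
  qed
  then have "card {i. i < 2 ^ k \<and> z \<in> cball (w i) ((1/2) ^ (k + 2))} \<le> card (\<Union>m\<in>{-1, 0, 1}. {i. \<bar>real i - X m\<bar> \<le> 3 / 4})"
    by (intro card_mono finite_UN_I finite_nats_near) auto
  also have "\<dots> \<le> (\<Sum>m\<in>{-1, 0, 1}. card {i. \<bar>real i - X m\<bar> \<le> 3 / 4})" by (intro card_UN_le) auto
  also have "\<dots> \<le> (\<Sum>m\<in>{-1, 0, 1 :: real}. 2)" by (intro sum_mono card_nats_near_le)
  also have "\<dots> = 6" by (simp add: card_insert_if)
  finally show ?thesis .
qed

text \<open>A ball of generation k that contains z forces 2^(-k-2) \<le> 1 - |z| \<le> (5/4) 2^(-k),
  which at most four consecutive generations satisfy; each contributes at most six balls.\<close>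

lemma card_whitney_balls:
  assumes w: "\<And>k i. w k i \<in> whitney_box k i" and z: "norm z < 1"
  shows "card {(k, i). k \<le> N \<and> i < 2 ^ k \<and> z \<in> cball (w k i) ((1/2) ^ (k + 2))} \<le> 24"
proof -
  define S where "S k = {i. i < 2 ^ k \<and> z \<in> cball (w k i) ((1/2) ^ (k + 2))}" for k
  define G where "G = {k. k \<le> N \<and> S k \<noteq> {}}"
  have G: "finite G" by (simp add: G_def)
  have S: "finite (S k)" for k by (simp add: S_def)
  have card_G: "card G \<le> 4"
  proof (cases "G = {}")
    case False
    define k0 where "k0 = Min G"
    have k0: "k0 \<in> G" "\<And>k. k \<in> G \<Longrightarrow> k0 \<le> k" using G False by (auto simp: k0_def)
    have bd: "(1/2) ^ (k + 2) \<le> 1 - norm z" "1 - norm z \<le> 5 / 4 * (1/2) ^ k" if k: "k \<in> G" for k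
    proof -
      obtain i where "z \<in> cball (w k i) ((1/2) ^ (k + 2))" using k unfolding G_def S_def by blast
      then show "(1/2) ^ (k + 2) \<le> 1 - norm z" "1 - norm z \<le> 5 / 4 * (1/2) ^ k" using cball_whitney_box w by blast+
    qed
    have "G \<subseteq> {k0..k0 + 3}"
    proof
      fix k assume k: "k \<in> G"
      have "k \<le> k0 + 3"
      proof (rule ccontr)
        assume "\<not> k \<le> k0 + 3"
        then have "(1/2 :: real) ^ k \<le> (1/2) ^ (k0 + 4)" by (intro power_decreasing) auto
        then have "1 - norm z \<le> 5 / 4 * (1/2) ^ (k0 + 4)" using bd(2)[OF k] by linarith
        also have "\<dots> < (1/2) ^ (k0 + 2)" by (simp add: eval_nat_numeral)
        also have "\<dots> \<le> 1 - norm z" using bd(1)[OF k0(1)] .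
        finally show False by simp
      qed
      then show "k \<in> {k0..k0 + 3}" using k0(2)[OF k] by simp
    qed
    then have "card G \<le> card {k0..k0 + 3}" by (intro card_mono) auto
    then show ?thesis by simp
  qed simp
  have "{(k, i). k \<le> N \<and> i < 2 ^ k \<and> z \<in> cball (w k i) ((1/2) ^ (k + 2))} = Sigma G S"
    by (auto simp: G_def S_def)
  then have "card {(k, i). k \<le> N \<and> i < 2 ^ k \<and> z \<in> cball (w k i) ((1/2) ^ (k + 2))} = (\<Sum>k\<in>G. card (S k))"
    using G S by simp
  also have "\<dots> \<le> (\<Sum>k\<in>G. 6)"
    unfolding S_def by (intro sum_mono card_whitney_balls_generation w z)
  also have "\<dots> \<le> 24" using card_G by simp
  finally show ?thesis .
qed

section \<open>Embeddings of Dirichlet spaces\<close>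

lemma sets_disk_area [measurable_cong]: "sets disk_area = sets (restrict_space borel unit_disk)"
  by (simp add: disk_area_def sets_restrict_space)

lemma space_disk_area: "space disk_area = unit_disk"
  by (simp add: disk_area_def space_scale_measure space_restrict_space)

lemma borel_measurable_disk_continuous:
  assumes "continuous_on unit_disk f"
  shows "f \<in> borel_measurable disk_area"
  using borel_measurable_continuous_on_restrict[OF assms]
  by (simp cong: measurable_cong_sets add: sets_disk_area)

lemma nn_integral_disk_area:
  assumes f: "f \<in> borel_measurable disk_area"
  shows "(\<integral>\<^sup>+z. f z \<partial>disk_area) = ennreal (1 / pi) * (\<integral>\<^sup>+z. f z * indicator unit_disk z \<partial>lborel)"
proof -
  have "f \<in> borel_measurable (restrict_space lborel unit_disk)"
    using f by (simp add: sets_disk_area sets_restrict_space cong: measurable_cong_sets)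
  then show ?thesis
    unfolding disk_area_def
    by (simp add: nn_integral_scale_measure nn_integral_restrict_space)
qed

lemma dirichlet_integrand_measurable:
  assumes "f holomorphic_on unit_disk"
  shows "(\<lambda>z. ennreal (norm (deriv f z) powr p * (1 - (norm z)\<^sup>2) powr \<alpha>)) \<in> borel_measurable disk_area"
proof -
  have [measurable]: "deriv f \<in> borel_measurable disk_area"
    using assms by (intro borel_measurable_disk_continuous holomorphic_on_imp_continuous_on holomorphic_deriv) auto
  have [measurable]: "(\<lambda>z. norm z) \<in> borel_measurable disk_area"
    by (intro borel_measurable_disk_continuous continuous_intros)
  show ?thesis by measurable
qed

lemma dirichlet_norm_powr:
  assumes "0 < p"
  shows "dirichlet_norm p \<alpha> f powr p = norm (f 0) powr p + enn2real (dirichlet_integral p \<alpha> f)"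
  using assms by (simp add: dirichlet_norm_def powr_powr)

section \<open>The dyadic tree and its coefficients\<close>

definition nodes :: "nat \<Rightarrow> (nat \<times> nat) set" where
  "nodes N = (SIGMA k:{..N}. {..<2 ^ k})"

definition ancestor :: "nat \<Rightarrow> nat \<times> nat \<Rightarrow> nat \<times> nat" where
  "ancestor j Q = (j, snd Q div 2 ^ (fst Q - j))"

lemma finite_nodes: "finite (nodes N)"
  by (auto simp: nodes_def)

lemma finite_tree_nodes: "finite_tree (nodes N) fst ancestor"
proof
  fix z j assume z: "z \<in> nodes N" "j \<le> fst z"
  have "2 ^ fst z = (2::nat) ^ j * 2 ^ (fst z - j)" using z by (simp flip: power_add)
  then have "snd z div 2 ^ (fst z - j) < 2 ^ j"
    using z by (auto simp: nodes_def less_mult_imp_div_less)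
  then show "ancestor j z \<in> nodes N" using z by (auto simp: nodes_def ancestor_def)
next
  fix z and i j :: nat assume "i \<le> j" "j \<le> fst (z :: nat \<times> nat)"
  then have "(2::nat) ^ (fst z - i) = 2 ^ (fst z - j) * 2 ^ (j - i)" by (simp flip: power_add)
  then show "ancestor i (ancestor j z) = ancestor i z" by (simp add: ancestor_def div_mult2_eq)
qed (auto simp: ancestor_def finite_nodes)

lemma powr_add_le_double:
  fixes a b p :: real
  assumes "0 < p" "0 \<le> a" "0 \<le> b"
  shows "(a + b) powr p \<le> 2 powr p * (a powr p + b powr p)"
proof -
  have "(a + b) powr p \<le> (2 * max a b) powr p" using assms by (intro powr_mono2) auto
  also have "\<dots> = 2 powr p * max a b powr p" using assms by (simp add: powr_mult)
  also have "max a b powr p \<le> a powr p + b powr p" by (simp add: max_def)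
  finally show ?thesis by simp
qed

text \<open>The sub-mean value property on the ball around the maximum point of |f'| in a box bounds
  the p-th power of its coefficient by the Dirichlet integral over that ball; bounded overlap sums
  these up. In \<open>C1\<close> the 16 comes from the squared radius and 4^|\<alpha>| from the
  weight.\<close>

lemma whitney_coefficients:
  fixes p \<alpha> :: real
  assumes p: "0 < p"
  shows "\<exists>C>0. \<forall>f\<in>dirichlet_space p \<alpha>. \<exists>h :: nat \<times> nat \<Rightarrow> real. (\<forall>Q. 0 \<le> h Q) \<and>
    (\<forall>N. (\<Sum>Q\<in>nodes N. h Q powr p) \<le> C * dirichlet_norm p \<alpha> f powr p) \<and>
    (\<forall>z\<in>unit_disk. norm (f z) \<le> (\<Sum>j\<le>gen z. 2 powr (real j * ((\<alpha> + 2 - p) / p)) * h (j, arc_index j z)))"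
proof -
  obtain C0 where C0: "0 < C0" "\<And>F w R. F holomorphic_on cball w R \<Longrightarrow> 0 < R \<Longrightarrow>
    ennreal (norm (F w) powr p) \<le> ennreal (C0 / R\<^sup>2) * (\<integral>\<^sup>+z. ennreal (norm (F z) powr p) * indicator (cball w R) z \<partial>lborel)"
    using holomorphic_powr_le_disk_mean[OF p] by blast
  define C1 where "C1 = 16 * C0 * 4 powr \<bar>\<alpha>\<bar>"
  have C1: "0 < C1" using C0 by (simp add: C1_def)
  define C where "C = 2 powr p * (24 * C1 * pi + 1)"
  have C: "0 < C" using C1 by (simp add: C_def add_pos_pos)
  show ?thesis
  proof (intro exI[of _ C] conjI ballI C)
    fix f assume f: "f \<in> dirichlet_space p \<alpha>"
    then have hol: "f holomorphic_on unit_disk" and fin: "dirichlet_integral p \<alpha> f < \<infinity>" by (auto simp: dirichlet_space_def)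
    define F where "F = deriv f"
    have holF: "F holomorphic_on unit_disk" unfolding F_def using hol by (intro holomorphic_deriv) auto
    have "\<exists>w\<in>whitney_box k i. \<forall>z\<in>whitney_box k i. norm (F z) \<le> norm (F w)" for k i
      using holF by (intro continuous_attains_sup compact_whitney_box whitney_box_nonempty continuous_intros
        continuous_on_subset[OF holomorphic_on_imp_continuous_on whitney_box_subset_disk])
    then obtain w where w: "\<And>k i. w k i \<in> whitney_box k i"
      "\<And>k i z. z \<in> whitney_box k i \<Longrightarrow> norm (F z) \<le> norm (F (w k i))" by metis
    define \<Phi> where "\<Phi> z = ennreal (norm (F z) powr p * (1 - (norm z)\<^sup>2) powr \<alpha>) * indicator unit_disk z" for z
    have I: "dirichlet_integral p \<alpha> f = ennreal (1 / pi) * (\<integral>\<^sup>+z. \<Phi> z \<partial>lborel)"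
      unfolding dirichlet_integral_def \<Phi>_def F_def by (rule nn_integral_disk_area) (rule dirichlet_integrand_measurable[OF hol])
    have [measurable]: "\<Phi> \<in> borel_measurable borel"
    proof -
      have "(\<lambda>z. ennreal (norm (deriv f z) powr p * (1 - (norm z)\<^sup>2) powr \<alpha>)) \<in> borel_measurable (restrict_space borel unit_disk)"
        using dirichlet_integrand_measurable[OF hol, of p \<alpha>] by (simp add: sets_disk_area cong: measurable_cong_sets)
      then show ?thesis
        unfolding \<Phi>_def F_def by (subst (asm) borel_measurable_restrict_space_iff_ennreal) auto
    qed
    \<comment> \<open>The scaling by 2^(-k (\<alpha>+2)/p) offsets the area 4^(-k) of the ball and
      the size 2^(-k \<alpha>) of the weight, and turns the factor 2^(-j) of the radial sum into
      2^(j \<tau>) with \<tau> = (\<alpha>+2-p)/p.\<close>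
    define h0 where "h0 Q = 2 powr (- (real (fst Q) * ((\<alpha> + 2) / p))) * norm (F (w (fst Q) (snd Q)))" for Q
    define B where "B Q = cball (w (fst Q) (snd Q)) ((1/2) ^ (fst Q + 2))" for Q
    have h0_le: "ennreal (h0 Q powr p) \<le> ennreal C1 * (\<integral>\<^sup>+z. \<Phi> z * indicator (B Q) z \<partial>lborel)" for Q
    proof -
      obtain k i where Q: "Q = (k, i)" by (cases Q)
      have sub: "cball (w k i) ((1/2) ^ (k + 2)) \<subseteq> unit_disk"
      proof
        fix z assume "z \<in> cball (w k i) ((1/2) ^ (k + 2))"
        then have "(1/2) ^ (k + 2) \<le> 1 - norm z" using cball_whitney_box w by blast
        moreover have "0 < (1/2 :: real) ^ (k + 2)" by simp
        ultimately have "norm z < 1" by linarith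
        then show "z \<in> unit_disk" by simp
      qed
      have weight: "1 \<le> 4 powr \<bar>\<alpha>\<bar> * 2 powr (real k * \<alpha>) * (1 - (norm z)\<^sup>2) powr \<alpha>"
        if z: "z \<in> cball (w k i) ((1/2) ^ (k + 2))" for z
      proof -
        \<comment> \<open>The rescaled distance lies between 1/4 and 4 on the ball, so t^\<alpha>
          \<ge> 4^(-|\<alpha>|) whatever the sign of \<alpha>.\<close>
        define t where "t = 2 ^ k * (1 - (norm z)\<^sup>2)"
        have b: "(1/2) ^ (k + 2) \<le> 1 - norm z" "1 - norm z \<le> 5 / 4 * (1/2) ^ k"
          using cball_whitney_box[OF w(1) z] by auto
        have z1: "norm z < 1" using z sub by auto
        have eq: "1 - (norm z)\<^sup>2 = (1 - norm z) * (1 + norm z)" by (simp add: power2_eq_square algebra_simps)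
        have "1 - norm z \<le> 1 - (norm z)\<^sup>2"
          unfolding eq using z1 mult_left_mono[of 1 "1 + norm z" "1 - norm z"] by simp
        then have lower: "(1/2) ^ (k + 2) \<le> 1 - (norm z)\<^sup>2" using b(1) by linarith
        have "1 - (norm z)\<^sup>2 \<le> (5 / 4 * (1/2) ^ k) * 2"
          unfolding eq using z1 b(2) by (intro mult_mono) auto
        also have "\<dots> \<le> 4 * (1/2) ^ k" by simp
        finally have upper: "1 - (norm z)\<^sup>2 \<le> 4 * (1/2) ^ k" .
        from lower upper have t: "1 / 4 \<le> t" "t \<le> 4" by (auto simp: t_def field_simps power_one_over)
        have "4 powr (- \<bar>\<alpha>\<bar>) \<le> t powr \<alpha>"
        proof (cases "0 \<le> \<alpha>")
          case True
          have "(1 / 4) powr \<alpha> \<le> t powr \<alpha>" using t True by (intro powr_mono2) auto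
          then show ?thesis using True by (simp add: powr_divide powr_minus_divide)
        next
          case False
          then have "4 powr \<alpha> \<le> t powr \<alpha>" using t by (intro powr_mono2') auto
          then show ?thesis using False by simp
        qed
        then have "4 powr \<bar>\<alpha>\<bar> * 4 powr (- \<bar>\<alpha>\<bar>) \<le> 4 powr \<bar>\<alpha>\<bar> * t powr \<alpha>" by (intro mult_left_mono) auto
        also have "t powr \<alpha> = 2 powr (real k * \<alpha>) * (1 - (norm z)\<^sup>2) powr \<alpha>"
          using z1 by (simp add: t_def powr_mult power_le_one powr_powr flip: powr_realpow)
        finally show ?thesis by (simp add: mult.assoc flip: powr_add)
      qed
      have "ennreal (norm (F (w k i)) powr p) \<le> ennreal (C0 / ((1/2) ^ (k + 2))\<^sup>2) *
        (\<integral>\<^sup>+z. ennreal (norm (F z) powr p) * indicator (cball (w k i) ((1/2) ^ (k + 2))) z \<partial>lborel)"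
        using holF sub by (intro C0) (auto intro: holomorphic_on_subset)
      also have "\<dots> \<le> ennreal (C0 / ((1/2) ^ (k + 2))\<^sup>2) *
        (\<integral>\<^sup>+z. ennreal (4 powr \<bar>\<alpha>\<bar> * 2 powr (real k * \<alpha>)) * (\<Phi> z * indicator (B Q) z) \<partial>lborel)"
      proof (intro mult_left_mono nn_integral_mono)
        fix z
        show "ennreal (norm (F z) powr p) * indicator (cball (w k i) ((1/2) ^ (k + 2))) z
          \<le> ennreal (4 powr \<bar>\<alpha>\<bar> * 2 powr (real k * \<alpha>)) * (\<Phi> z * indicator (B Q) z)"
        proof (cases "z \<in> cball (w k i) ((1/2) ^ (k + 2))")
          case True
          have "norm (F z) powr p * 1 \<le> norm (F z) powr p * (4 powr \<bar>\<alpha>\<bar> * 2 powr (real k * \<alpha>) * (1 - (norm z)\<^sup>2) powr \<alpha>)"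
            by (intro mult_left_mono weight True) auto
          then have "ennreal (norm (F z) powr p) \<le> ennreal (4 powr \<bar>\<alpha>\<bar> * 2 powr (real k * \<alpha>)) * ennreal (norm (F z) powr p * (1 - (norm z)\<^sup>2) powr \<alpha>)"
            by (simp add: mult_ac ennreal_leI flip: ennreal_mult)
          moreover have "z \<in> unit_disk" using sub True by blast
          ultimately show ?thesis using True by (simp add: \<Phi>_def B_def Q)
        qed simp
      qed simp
      also have "\<dots> = ennreal (C0 / ((1/2) ^ (k + 2))\<^sup>2) * (ennreal (4 powr \<bar>\<alpha>\<bar> * 2 powr (real k * \<alpha>)) *
        (\<integral>\<^sup>+z. \<Phi> z * indicator (B Q) z \<partial>lborel))"
        by (subst nn_integral_cmult) (auto simp: B_def)
      also have "\<dots> = ennreal (C1 * 2 powr (real k * (\<alpha> + 2))) * (\<integral>\<^sup>+z. \<Phi> z * indicator (B Q) z \<partial>lborel)"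
      proof -
        have "C0 / ((1/2) ^ (k + 2))\<^sup>2 = C0 * 16 * 2 powr (real k * 2)"
          by (simp add: power_one_over power_add power_mult_distrib powr_powr[symmetric] powr_realpow power2_eq_square field_simps)
        then have "C0 / ((1/2) ^ (k + 2))\<^sup>2 * (4 powr \<bar>\<alpha>\<bar> * 2 powr (real k * \<alpha>)) = C1 * 2 powr (real k * (\<alpha> + 2))"
          by (simp add: C1_def powr_add distrib_left)
        then show ?thesis using C0 by (simp flip: ennreal_mult mult.assoc)
      qed
      finally have le: "ennreal (norm (F (w k i)) powr p) \<le> ennreal (C1 * 2 powr (real k * (\<alpha> + 2))) * (\<integral>\<^sup>+z. \<Phi> z * indicator (B Q) z \<partial>lborel)" .
      have "ennreal (h0 Q powr p) = ennreal (2 powr (- (real k * (\<alpha> + 2)))) * ennreal (norm (F (w k i)) powr p)"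
        using p by (simp add: h0_def Q powr_mult powr_powr flip: ennreal_mult)
      also have "\<dots> \<le> ennreal (2 powr (- (real k * (\<alpha> + 2)))) * (ennreal (C1 * 2 powr (real k * (\<alpha> + 2))) * (\<integral>\<^sup>+z. \<Phi> z * indicator (B Q) z \<partial>lborel))"
        using le by (intro mult_left_mono) auto
      also have "\<dots> = ennreal (2 powr (- (real k * (\<alpha> + 2))) * (C1 * 2 powr (real k * (\<alpha> + 2)))) * (\<integral>\<^sup>+z. \<Phi> z * indicator (B Q) z \<partial>lborel)"
        using C1 by (simp add: ennreal_mult mult.assoc)
      also have "2 powr (- (real k * (\<alpha> + 2))) * (C1 * 2 powr (real k * (\<alpha> + 2))) = C1"
      proof -
        have "2 powr (- X) * 2 powr X = (1 :: real)" for X by (simp flip: powr_add)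
        then show ?thesis by (metis mult.left_commute mult.right_neutral)
      qed
      finally show ?thesis .
    qed
    have sum_h0: "(\<Sum>Q\<in>nodes N. h0 Q powr p) \<le> 24 * C1 * pi * enn2real (dirichlet_integral p \<alpha> f)" for N
    proof -
      have count: "\<Phi> z * (\<Sum>Q\<in>nodes N. indicator (B Q) z) \<le> 24 * \<Phi> z" for z
      proof (cases "norm z < 1")
        case True
        have "(\<Sum>Q\<in>nodes N. indicator (B Q) z :: nat) = card {Q \<in> nodes N. z \<in> B Q}"
          by (simp add: indicator_def finite_nodes Int_def flip: card_eq_sum sum.inter_filter)
        also have "{Q \<in> nodes N. z \<in> B Q} = {(k, i). k \<le> N \<and> i < 2 ^ k \<and> z \<in> cball (w k i) ((1/2) ^ (k + 2))}"
          by (auto simp: nodes_def B_def)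
        also have "card \<dots> \<le> 24" using w(1) True by (rule card_whitney_balls)
        finally have "of_nat (\<Sum>Q\<in>nodes N. indicator (B Q) z) \<le> (of_nat 24 :: ennreal)" by (rule of_nat_mono)
        moreover have "of_nat (indicator (B Q) z) = (indicator (B Q) z :: ennreal)" for Q by (simp split: split_indicator)
        ultimately have "(\<Sum>Q\<in>nodes N. indicator (B Q) z) \<le> (24 :: ennreal)" by simp
        then show ?thesis by (simp add: mult.commute mult_left_mono)
      qed (simp add: \<Phi>_def)
      have "ennreal (\<Sum>Q\<in>nodes N. h0 Q powr p) = (\<Sum>Q\<in>nodes N. ennreal (h0 Q powr p))" by simp
      also have "\<dots> \<le> (\<Sum>Q\<in>nodes N. ennreal C1 * (\<integral>\<^sup>+z. \<Phi> z * indicator (B Q) z \<partial>lborel))"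
        by (intro sum_mono h0_le)
      also have "\<dots> = ennreal C1 * (\<integral>\<^sup>+z. \<Phi> z * (\<Sum>Q\<in>nodes N. indicator (B Q) z) \<partial>lborel)"
        by (simp add: sum_distrib_left nn_integral_sum B_def)
      also have "\<dots> \<le> ennreal C1 * (\<integral>\<^sup>+z. 24 * \<Phi> z \<partial>lborel)"
        by (intro mult_left_mono nn_integral_mono count) auto
      also have "\<dots> = ennreal C1 * (24 * (\<integral>\<^sup>+z. \<Phi> z \<partial>lborel))"
        by (subst nn_integral_cmult) auto
      also have "(\<integral>\<^sup>+z. \<Phi> z \<partial>lborel) = ennreal pi * dirichlet_integral p \<alpha> f"
        unfolding I by (simp flip: mult.assoc ennreal_mult)
      also have "dirichlet_integral p \<alpha> f = ennreal (enn2real (dirichlet_integral p \<alpha> f))"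
        using fin by simp
      also have "ennreal C1 * (24 * (ennreal pi * ennreal (enn2real (dirichlet_integral p \<alpha> f))))
          = ennreal (C1 * (24 * (pi * enn2real (dirichlet_integral p \<alpha> f))))"
        using C1 by (simp add: ennreal_mult)
      finally show ?thesis using C1 by (simp add: mult_ac)
    qed
    \<comment> \<open>The value f(0) is carried by the root, which lies on every path and has weight
      1.\<close>
    define h where "h Q = h0 Q + (if Q = (0, 0) then norm (f 0) else 0)" for Q
    have h0: "0 \<le> h0 Q" for Q by (simp add: h0_def)
    show "\<exists>h :: nat \<times> nat \<Rightarrow> real. (\<forall>Q. 0 \<le> h Q) \<and>
      (\<forall>N. (\<Sum>Q\<in>nodes N. h Q powr p) \<le> C * dirichlet_norm p \<alpha> f powr p) \<and>
      (\<forall>z\<in>unit_disk. norm (f z) \<le> (\<Sum>j\<le>gen z. 2 powr (real j * ((\<alpha> + 2 - p) / p)) * h (j, arc_index j z)))"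
    proof (intro exI[of _ h] conjI allI ballI)
      show "0 \<le> h Q" for Q using h0 by (simp add: h_def)
      fix N
      have "(\<Sum>Q\<in>nodes N. h Q powr p) \<le> (\<Sum>Q\<in>nodes N. 2 powr p * (h0 Q powr p + (if Q = (0, 0) then norm (f 0) powr p else 0)))"
      proof (intro sum_mono)
        fix Q
        have "h Q powr p \<le> 2 powr p * (h0 Q powr p + (if Q = (0, 0) then norm (f 0) else 0) powr p)"
          unfolding h_def using p h0 by (intro powr_add_le_double) auto
        then show "h Q powr p \<le> 2 powr p * (h0 Q powr p + (if Q = (0, 0) then norm (f 0) powr p else 0))"
          using p by (simp split: if_splits)
      qed
      also have "\<dots> = 2 powr p * ((\<Sum>Q\<in>nodes N. h0 Q powr p) + norm (f 0) powr p)"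
      proof -
        have "(0, 0) \<in> nodes N" by (simp add: nodes_def)
        then show ?thesis by (simp add: sum.distrib finite_nodes flip: sum_distrib_left)
      qed
      also have "\<dots> \<le> 2 powr p * (24 * C1 * pi * enn2real (dirichlet_integral p \<alpha> f) + norm (f 0) powr p)"
        using sum_h0 by (intro mult_left_mono add_right_mono) auto
      also have "\<dots> \<le> 2 powr p * ((24 * C1 * pi + 1) * (norm (f 0) powr p + enn2real (dirichlet_integral p \<alpha> f)))"
        using C1 by (intro mult_left_mono) (auto simp: algebra_simps)
      finally show "(\<Sum>Q\<in>nodes N. h Q powr p) \<le> C * dirichlet_norm p \<alpha> f powr p"
        unfolding dirichlet_norm_powr[OF p] by (simp add: C_def mult.assoc)
    next
      fix z assume "z \<in> unit_disk"
      then have z: "norm z < 1" by simp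
      have "norm (f z) \<le> norm (f 0) + (\<Sum>j\<le>gen z. (1/2) ^ j * norm (F (w j (arc_index j z))))"
        using hol w(2) z unfolding F_def by (rule norm_le_sum_whitney_boxes)
      also have "(\<Sum>j\<le>gen z. (1/2) ^ j * norm (F (w j (arc_index j z)))) = (\<Sum>j\<le>gen z. 2 powr (real j * ((\<alpha> + 2 - p) / p)) * h0 (j, arc_index j z))"
      proof (intro sum.cong refl)
        fix j
        have "real j * ((\<alpha> + 2 - p) / p) + - (real j * ((\<alpha> + 2) / p)) = - real j" using p by (simp add: field_simps)
        then have "2 powr (real j * ((\<alpha> + 2 - p) / p)) * 2 powr (- (real j * ((\<alpha> + 2) / p))) = 2 powr (- real j)"
          by (simp only: powr_add[symmetric])
        also have "\<dots> = (1/2) ^ j" by (simp add: powr_minus powr_realpow power_one_over inverse_eq_divide)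
        finally have "2 powr (real j * ((\<alpha> + 2 - p) / p)) * 2 powr (- (real j * ((\<alpha> + 2) / p))) = (1/2) ^ j" .
        then show "(1/2) ^ j * norm (F (w j (arc_index j z))) = 2 powr (real j * ((\<alpha> + 2 - p) / p)) * h0 (j, arc_index j z)"
          unfolding h0_def fst_conv snd_conv by (simp only: mult.assoc[symmetric])
      qed
      also have "norm (f 0) + \<dots> = (\<Sum>j\<le>gen z. 2 powr (real j * ((\<alpha> + 2 - p) / p)) * h (j, arc_index j z))"
      proof -
        have "arc_index 0 z = 0" using arc_index_less[of 0 z] by simp
        then have "2 powr (real j * ((\<alpha> + 2 - p) / p)) * h (j, arc_index j z) = 2 powr (real j * ((\<alpha> + 2 - p) / p)) * h0 (j, arc_index j z)
            + (if j = 0 then norm (f 0) else 0)" for j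
          by (auto simp: h_def distrib_left)
        then show ?thesis by (simp add: sum.distrib)
      qed
      finally show "norm (f z) \<le> (\<Sum>j\<le>gen z. 2 powr (real j * ((\<alpha> + 2 - p) / p)) * h (j, arc_index j z))" .
    qed
  qed
qed

abbreviation dirichlet_embedding :: "real \<Rightarrow> real \<Rightarrow> real \<Rightarrow> complex measure \<Rightarrow> real \<Rightarrow> bool" where
  "dirichlet_embedding p \<alpha> q \<mu> C \<equiv> (\<forall>f\<in>dirichlet_space p \<alpha>.
    (\<integral>\<^sup>+z. ennreal (norm (f z) powr q) \<partial>\<mu>) \<le> ennreal (C * dirichlet_norm p \<alpha> f powr q))"

text \<open>The tree inequality and the profile \<open>bnd\<close> are parameters, so that power and
  logarithmic conditions share this passage from the tree to the disk. Node masses are the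
  \<mu>-masses of boxes. The constant does not depend on the depth N, and monotone convergence
  removes the truncation.\<close>

lemma embedding_from_tree:
  fixes p q \<alpha> C0 :: real and \<mu> :: "complex measure" and bnd :: "nat \<Rightarrow> real"
  assumes p: "0 < p" and q: "0 < q" and fin: "finite_measure \<mu>" and sets: "sets \<mu> = sets (restrict_space borel unit_disk)"
    and C0: "0 \<le> C0"
    and tree: "\<And>N m h. (\<And>Q. 0 \<le> m Q) \<Longrightarrow> (\<And>Q. 0 \<le> h Q) \<Longrightarrow>
      (\<And>Q. Q \<in> nodes N \<Longrightarrow> finite_tree.shadow (nodes N) fst ancestor m Q \<le> bnd (fst Q)) \<Longrightarrow>
      (\<Sum>Q\<in>nodes N. m Q * finite_tree.path_sum fst ancestor (\<lambda>j. 2 powr (real j * ((\<alpha> + 2 - p) / p))) h Q powr q)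
        \<le> C0 * (\<Sum>Q\<in>nodes N. h Q powr p) powr (q / p)"
    and bnd: "\<And>k i. i < 2 ^ k \<Longrightarrow> measure \<mu> {z \<in> unit_disk. k \<le> gen z \<and> arc_index k z = i} \<le> bnd k"
  shows "\<exists>C\<ge>0. dirichlet_embedding p \<alpha> q \<mu> C"
proof -
  interpret \<mu>: finite_measure \<mu> by (rule fin)
  note [measurable_cong] = sets
  have space: "space \<mu> = unit_disk" using sets_eq_imp_space_eq[OF sets] by simp
  have [measurable]: "gen \<in> \<mu> \<rightarrow>\<^sub>M count_space UNIV" "\<And>k. arc_index k \<in> \<mu> \<rightarrow>\<^sub>M count_space UNIV"
    unfolding measurable_cong_sets[OF sets refl] by (intro measurable_restrict_space1 measurable_gen measurable_arc_index)+
  obtain C1 where C1: "0 < C1" "\<And>f. f \<in> dirichlet_space p \<alpha> \<Longrightarrow> \<exists>h :: nat \<times> nat \<Rightarrow> real. (\<forall>Q. 0 \<le> h Q) \<and>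
    (\<forall>N. (\<Sum>Q\<in>nodes N. h Q powr p) \<le> C1 * dirichlet_norm p \<alpha> f powr p) \<and>
    (\<forall>z\<in>unit_disk. norm (f z) \<le> (\<Sum>j\<le>gen z. 2 powr (real j * ((\<alpha> + 2 - p) / p)) * h (j, arc_index j z)))"
    using whitney_coefficients[OF p, of \<alpha>] by blast
  define C where "C = C0 * C1 powr (q / p)"
  have C: "0 \<le> C" using C0 by (simp add: C_def)
  define box where "box Q = {z \<in> space \<mu>. gen z = fst Q \<and> arc_index (fst Q) z = snd Q}" for Q
  define m where "m Q = measure \<mu> (box Q)" for Q
  have [measurable]: "box Q \<in> sets \<mu>" for Q unfolding box_def by measurable
  show ?thesis
  proof (intro exI[of _ C] conjI ballI C)
    fix f assume f: "f \<in> dirichlet_space p \<alpha>"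
    then have hol: "f holomorphic_on unit_disk" by (simp add: dirichlet_space_def)
    have [measurable]: "f \<in> borel_measurable \<mu>"
      using borel_measurable_continuous_on_restrict[OF holomorphic_on_imp_continuous_on[OF hol]]
      by (simp cong: measurable_cong_sets add: sets)
    obtain h :: "nat \<times> nat \<Rightarrow> real" where h: "\<And>Q. 0 \<le> h Q"
      "\<And>N. (\<Sum>Q\<in>nodes N. h Q powr p) \<le> C1 * dirichlet_norm p \<alpha> f powr p"
      "\<And>z. z \<in> unit_disk \<Longrightarrow> norm (f z) \<le> (\<Sum>j\<le>gen z. 2 powr (real j * ((\<alpha> + 2 - p) / p)) * h (j, arc_index j z))"
      using C1(2)[OF f] by blast
    define A where "A = finite_tree.path_sum fst ancestor (\<lambda>j. 2 powr (real j * ((\<alpha> + 2 - p) / p))) h"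
    have A: "norm (f z) \<le> A (gen z, arc_index (gen z) z)" if "z \<in> unit_disk" for z
      using h(3)[OF that] unfolding A_def finite_tree.path_sum_def[OF finite_tree_nodes]
      by (simp add: ancestor_def arc_index_div)
    have shadow: "finite_tree.shadow (nodes N) fst ancestor m Q \<le> bnd (fst Q)" if Q: "Q \<in> nodes N" for N Q
    proof -
      define D where "D = {R \<in> nodes N. fst Q \<le> fst R \<and> ancestor (fst Q) R = Q}"
      have "finite D" by (simp add: D_def finite_nodes)
      have "(\<Sum>R\<in>D. m R) = measure \<mu> (\<Union>R\<in>D. box R)"
        unfolding m_def using \<open>finite D\<close>
        by (intro \<mu>.finite_measure_finite_Union[symmetric]) (auto simp: disjoint_family_on_def box_def prod_eq_iff)
      also have "\<dots> \<le> measure \<mu> {z \<in> space \<mu>. fst Q \<le> gen z \<and> arc_index (fst Q) z = snd Q}"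
      proof (intro \<mu>.finite_measure_mono)
        show "(\<Union>R\<in>D. box R) \<subseteq> {z \<in> space \<mu>. fst Q \<le> gen z \<and> arc_index (fst Q) z = snd Q}"
        proof
          fix z assume "z \<in> (\<Union>R\<in>D. box R)"
          then obtain R where R: "R \<in> D" "z \<in> box R" by blast
          then show "z \<in> {z \<in> space \<mu>. fst Q \<le> gen z \<and> arc_index (fst Q) z = snd Q}"
            using arc_index_div[of "fst Q" "fst R" z] by (auto simp: D_def box_def ancestor_def prod_eq_iff)
        qed
      qed measurable
      also have "\<dots> \<le> bnd (fst Q)" unfolding space using Q by (intro bnd) (auto simp: nodes_def)
      finally show ?thesis by (simp add: finite_tree.shadow_def[OF finite_tree_nodes] D_def)
    qed
    \<comment> \<open>Up to generation N the disk is the disjoint union of the boxes of the nodes,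
      and on each of them |f| is bounded by the path sum at its node.\<close>
    have trunc: "(\<integral>\<^sup>+z. ennreal (norm (f z) powr q) * indicator {z \<in> space \<mu>. gen z \<le> N} z \<partial>\<mu>) \<le> ennreal (C * dirichlet_norm p \<alpha> f powr q)" for N
    proof -
      have "(\<integral>\<^sup>+z. ennreal (norm (f z) powr q) * indicator {z \<in> space \<mu>. gen z \<le> N} z \<partial>\<mu>)
        \<le> (\<integral>\<^sup>+z. (\<Sum>Q\<in>nodes N. ennreal (A Q powr q) * indicator (box Q) z) \<partial>\<mu>)"
      proof (intro nn_integral_mono)
        fix z assume z: "z \<in> space \<mu>"
        show "ennreal (norm (f z) powr q) * indicator {z \<in> space \<mu>. gen z \<le> N} z \<le> (\<Sum>Q\<in>nodes N. ennreal (A Q powr q) * indicator (box Q) z)"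
        proof (cases "gen z \<le> N")
          case True
          let ?Q = "(gen z, arc_index (gen z) z)"
          have "ennreal (norm (f z) powr q) \<le> ennreal (A ?Q powr q) * indicator (box ?Q) z"
            using A[of z] z q by (auto simp: box_def space intro!: ennreal_leI powr_mono2)
          also have "\<dots> \<le> (\<Sum>Q\<in>nodes N. ennreal (A Q powr q) * indicator (box Q) z)"
            using True arc_index_less by (intro member_le_sum) (auto simp: finite_nodes nodes_def)
          finally show ?thesis using True z by simp
        qed simp
      qed
      also have "\<dots> = (\<Sum>Q\<in>nodes N. ennreal (A Q powr q) * emeasure \<mu> (box Q))"
        by (subst nn_integral_sum) (auto simp: nn_integral_cmult_indicator)
      also have "\<dots> = ennreal (\<Sum>Q\<in>nodes N. m Q * A Q powr q)"
        by (simp add: m_def \<mu>.emeasure_eq_measure mult.commute flip: ennreal_mult)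
      also have "\<dots> \<le> ennreal (C0 * (\<Sum>Q\<in>nodes N. h Q powr p) powr (q / p))"
        unfolding A_def by (intro ennreal_leI tree shadow h(1)) (simp_all add: m_def)
      also have "\<dots> \<le> ennreal (C0 * (C1 * dirichlet_norm p \<alpha> f powr p) powr (q / p))"
        using p q C0 h(2) by (intro ennreal_leI mult_left_mono powr_mono2 sum_nonneg) auto
      also have "C0 * (C1 * dirichlet_norm p \<alpha> f powr p) powr (q / p) = C * dirichlet_norm p \<alpha> f powr q"
        using C1(1) p by (simp add: C_def powr_mult powr_powr)
      finally show ?thesis .
    qed
    have "(\<lambda>N. \<integral>\<^sup>+z. ennreal (norm (f z) powr q) * indicator {z \<in> space \<mu>. gen z \<le> N} z \<partial>\<mu>)
      \<longlonglongrightarrow> (\<integral>\<^sup>+z. ennreal (norm (f z) powr q) * indicator (space \<mu>) z \<partial>\<mu>)"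
    proof (rule nn_integral_LIMSEQ)
      show "incseq (\<lambda>N z. ennreal (norm (f z) powr q) * indicator {z \<in> space \<mu>. gen z \<le> N} z)"
        by (auto simp: incseq_def le_fun_def split: split_indicator)
      fix z
      have "\<forall>N\<ge>gen z. ennreal (norm (f z) powr q) * indicator {z \<in> space \<mu>. gen z \<le> N} z = ennreal (norm (f z) powr q) * indicator (space \<mu>) z"
        by (auto split: split_indicator)
      then show "(\<lambda>N. ennreal (norm (f z) powr q) * indicator {z \<in> space \<mu>. gen z \<le> N} z) \<longlonglongrightarrow> ennreal (norm (f z) powr q) * indicator (space \<mu>) z"
        by (intro tendsto_eventually) (auto simp: eventually_sequentially)
    qed measurable
    then have "(\<integral>\<^sup>+z. ennreal (norm (f z) powr q) * indicator (space \<mu>) z \<partial>\<mu>) \<le> ennreal (C * dirichlet_norm p \<alpha> f powr q)"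
      using trunc by (intro LIMSEQ_le_const2) auto
    moreover have "(\<integral>\<^sup>+z. ennreal (norm (f z) powr q) * indicator (space \<mu>) z \<partial>\<mu>) = (\<integral>\<^sup>+z. ennreal (norm (f z) powr q) \<partial>\<mu>)"
      by (intro nn_integral_cong) simp
    ultimately show "(\<integral>\<^sup>+z. ennreal (norm (f z) powr q) \<partial>\<mu>) \<le> ennreal (C * dirichlet_norm p \<alpha> f powr q)" by simp
  qed
qed

section \<open>Volterra operators and Carleson squares\<close>

text \<open>The disk is starlike about 0 and f g' is holomorphic on it, so integrals over triangles
  with vertex 0 vanish and the radial integral is a primitive.\<close>

lemma volterra_has_field_derivative:
  assumes f: "f holomorphic_on unit_disk" and g: "g holomorphic_on unit_disk" and z: "z \<in> unit_disk"
  shows "(volterra g f has_field_derivative f z * deriv g z) (at z)"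
proof -
  have hol: "(\<lambda>w. f w * deriv g w) holomorphic_on unit_disk"
    using f g by (intro holomorphic_intros holomorphic_deriv) auto
  have "((\<lambda>x. contour_integral (linepath 0 x) (\<lambda>w. f w * deriv g w)) has_field_derivative f z * deriv g z) (at z)"
  proof (rule triangle_contour_integrals_starlike_primitive[where S = unit_disk])
    show "continuous_on unit_disk (\<lambda>w. f w * deriv g w)" using hol by (rule holomorphic_on_imp_continuous_on)
    show "closed_segment 0 y \<subseteq> unit_disk" if "y \<in> unit_disk" for y
      using that by (intro closed_segment_subset) auto
    fix b c :: complex assume bc: "closed_segment b c \<subseteq> unit_disk"
    have "b \<in> unit_disk" "c \<in> unit_disk" using bc ends_in_segment by blast+
    then have "convex hull {0, b, c} \<subseteq> unit_disk" by (intro hull_minimal) auto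
    then have "((\<lambda>w. f w * deriv g w) has_contour_integral 0) (linepath 0 b +++ linepath b c +++ linepath c 0)"
      by (intro Cauchy_theorem_triangle holomorphic_on_subset[OF hol])
    then show "contour_integral (linepath 0 b) (\<lambda>w. f w * deriv g w) + contour_integral (linepath b c) (\<lambda>w. f w * deriv g w)
        + contour_integral (linepath c 0) (\<lambda>w. f w * deriv g w) = 0"
      by (rule has_chain_integral_chain_integral3)
  qed (use z in auto)
  then show ?thesis unfolding volterra_def[abs_def] .
qed

lemma volterra_holomorphic:
  assumes "f holomorphic_on unit_disk" "g holomorphic_on unit_disk"
  shows "volterra g f holomorphic_on unit_disk"
  unfolding holomorphic_on_open[OF open_ball] using volterra_has_field_derivative[OF assms] by blast

lemma deriv_volterra:
  assumes "f holomorphic_on unit_disk" "g holomorphic_on unit_disk" "z \<in> unit_disk"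
  shows "deriv (volterra g f) z = f z * deriv g z"
  using volterra_has_field_derivative[OF assms] by (rule DERIV_imp_deriv)

lemma volterra_density_measurable:
  assumes "g holomorphic_on unit_disk"
  shows "(\<lambda>z. ennreal ((1 - (norm z)\<^sup>2) powr \<beta> * norm (deriv g z) powr q)) \<in> borel_measurable disk_area"
  using dirichlet_integrand_measurable[OF assms, of q \<beta>] by (simp add: mult.commute)

lemma sets_volterra_measure: "sets (volterra_measure g q \<beta>) = sets (restrict_space borel unit_disk)"
  by (simp add: volterra_measure_def sets_disk_area)

lemma space_volterra_measure: "space (volterra_measure g q \<beta>) = unit_disk"
  by (simp add: volterra_measure_def space_disk_area)

lemma dirichlet_integral_volterra:
  assumes f: "f holomorphic_on unit_disk" and g: "g holomorphic_on unit_disk"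
  shows "dirichlet_integral q \<beta> (volterra g f) = (\<integral>\<^sup>+z. ennreal (norm (f z) powr q) \<partial>volterra_measure g q \<beta>)"
proof -
  have [measurable]: "f \<in> borel_measurable disk_area"
    by (intro borel_measurable_disk_continuous holomorphic_on_imp_continuous_on f)
  have "(\<integral>\<^sup>+z. ennreal (norm (f z) powr q) \<partial>volterra_measure g q \<beta>)
    = (\<integral>\<^sup>+z. ennreal ((1 - (norm z)\<^sup>2) powr \<beta> * norm (deriv g z) powr q) * ennreal (norm (f z) powr q) \<partial>disk_area)"
    unfolding volterra_measure_def by (intro nn_integral_density volterra_density_measurable g) measurable
  also have "\<dots> = dirichlet_integral q \<beta> (volterra g f)"
    unfolding dirichlet_integral_def
    by (intro nn_integral_cong)
      (simp add: space_disk_area deriv_volterra[OF f g] norm_mult powr_mult mult_ac flip: ennreal_mult)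
  finally show ?thesis by simp
qed

lemma bounded_volterra_iff:
  assumes p: "0 < p" and q: "0 < q" and g: "g holomorphic_on unit_disk"
  shows "bounded_dirichlet_operator p \<alpha> q \<beta> (volterra g) \<longleftrightarrow>
    (\<exists>C\<ge>0. dirichlet_embedding p \<alpha> q (volterra_measure g q \<beta>) C)"
proof -
  have N0: "0 \<le> dirichlet_norm p \<alpha> f" for f by (simp add: dirichlet_norm_def)
  have T0: "volterra g f 0 = 0" for f by (simp add: volterra_def)
  show ?thesis
  proof
    assume "bounded_dirichlet_operator p \<alpha> q \<beta> (volterra g)"
    then obtain C where T: "\<And>f. f \<in> dirichlet_space p \<alpha> \<Longrightarrow> volterra g f \<in> dirichlet_space q \<beta>"
      and C: "\<And>f. f \<in> dirichlet_space p \<alpha> \<Longrightarrow> dirichlet_norm q \<beta> (volterra g f) \<le> C * dirichlet_norm p \<alpha> f"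
      unfolding bounded_dirichlet_operator_def by blast
    show "\<exists>C\<ge>0. dirichlet_embedding p \<alpha> q (volterra_measure g q \<beta>) C"
    proof (intro exI[of _ "\<bar>C\<bar> powr q"] conjI ballI)
      fix f assume f: "f \<in> dirichlet_space p \<alpha>"
      then have hol: "f holomorphic_on unit_disk" by (simp add: dirichlet_space_def)
      \<comment> \<open>The norm sees the integral through \<open>enn2real\<close>, which sends
        infinity to 0. Membership in the target space is what lets the norm bound be turned back
        into a bound on the integral.\<close>
      have fin: "dirichlet_integral q \<beta> (volterra g f) < \<infinity>" using T[OF f] by (simp add: dirichlet_space_def)
      have "dirichlet_norm q \<beta> (volterra g f) \<le> \<bar>C\<bar> * dirichlet_norm p \<alpha> f"
        using C[OF f] mult_right_mono[OF abs_ge_self[of C] N0[of f]] by linarith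
      then have "dirichlet_norm q \<beta> (volterra g f) powr q \<le> (\<bar>C\<bar> * dirichlet_norm p \<alpha> f) powr q"
        using q by (intro powr_mono2) (auto simp: dirichlet_norm_def)
      then have "enn2real (dirichlet_integral q \<beta> (volterra g f)) \<le> \<bar>C\<bar> powr q * dirichlet_norm p \<alpha> f powr q"
        using q N0 unfolding dirichlet_norm_powr[OF q] by (simp add: T0 powr_mult)
      then have "ennreal (enn2real (dirichlet_integral q \<beta> (volterra g f))) \<le> ennreal (\<bar>C\<bar> powr q * dirichlet_norm p \<alpha> f powr q)"
        by (rule ennreal_leI)
      then show "(\<integral>\<^sup>+z. ennreal (norm (f z) powr q) \<partial>volterra_measure g q \<beta>) \<le> ennreal (\<bar>C\<bar> powr q * dirichlet_norm p \<alpha> f powr q)"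
        unfolding dirichlet_integral_volterra[OF hol g, symmetric] ennreal_enn2real[OF fin[unfolded infinity_ennreal_def]] .
    qed simp
  next
    assume "\<exists>C\<ge>0. dirichlet_embedding p \<alpha> q (volterra_measure g q \<beta>) C"
    then obtain C where C: "0 \<le> C" "\<And>f. f \<in> dirichlet_space p \<alpha> \<Longrightarrow>
      (\<integral>\<^sup>+z. ennreal (norm (f z) powr q) \<partial>volterra_measure g q \<beta>) \<le> ennreal (C * dirichlet_norm p \<alpha> f powr q)" by blast
    have I: "dirichlet_integral q \<beta> (volterra g f) \<le> ennreal (C * dirichlet_norm p \<alpha> f powr q)" if "f \<in> dirichlet_space p \<alpha>" for f
      using C(2)[OF that] that g by (simp add: dirichlet_space_def dirichlet_integral_volterra)
    show "bounded_dirichlet_operator p \<alpha> q \<beta> (volterra g)"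
      unfolding bounded_dirichlet_operator_def
    proof (intro conjI ballI exI[of _ "C powr (1 / q)"])
      fix f assume f: "f \<in> dirichlet_space p \<alpha>"
      show "volterra g f \<in> dirichlet_space q \<beta>"
        using f I[OF f] volterra_holomorphic g by (auto simp: dirichlet_space_def intro: le_less_trans)
      have "enn2real (dirichlet_integral q \<beta> (volterra g f)) \<le> C * dirichlet_norm p \<alpha> f powr q"
        using I[OF f] C(1) by (intro enn2real_leI) auto
      then have "dirichlet_norm q \<beta> (volterra g f) \<le> (C * dirichlet_norm p \<alpha> f powr q) powr (1 / q)"
        unfolding dirichlet_norm_def[of q] using q by (intro powr_mono2) (auto simp: T0)
      then show "dirichlet_norm q \<beta> (volterra g f) \<le> C powr (1 / q) * dirichlet_norm p \<alpha> f"
        using q C(1) N0[of f] by (simp add: powr_mult powr_powr)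
    qed
  qed
qed

section \<open>Geometry of arcs and Carleson squares\<close>

text \<open>Half-open arcs make the squares of one generation disjoint and let them coincide with
  level sets of \<open>arc_index\<close>.\<close>

lemma carleson_square_dyadic:
  assumes i: "i < 2 ^ k"
  defines "I \<equiv> cis ` {2 * pi * (i / 2 ^ k)..<2 * pi * (Suc i / 2 ^ k)}"
  shows "circle_arc I" "arc_length I = (1/2) ^ k"
    and "carleson_square I = {z \<in> unit_disk. 1 - (1/2) ^ k \<le> norm z \<and> arc_index k z = i}"
proof -
  define J where "J = {2 * pi * (i / 2 ^ k)..<2 * pi * (Suc i / 2 ^ k)}"
  have "real (Suc i) \<le> 2 ^ k" using i by (metis Suc_leI of_nat_le_iff of_nat_numeral of_nat_power)
  then have "real (Suc i) / 2 ^ k \<le> 1" by simp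
  then have "2 * pi * (real (Suc i) / 2 ^ k) \<le> 2 * pi * 1" by (intro mult_left_mono) auto
  then have J: "J \<subseteq> {0..<2 * pi}" by (auto simp: J_def intro: order_trans[rotated])
  have inj: "t = u" if "t \<in> {0..<2 * pi}" "u \<in> {0..<2 * pi}" "cis t = cis u" for t u
    using that Arg2pi_unique[of 1 t "cis t"] Arg2pi_unique[of 1 u "cis u"] by (auto simp: cis_conv_exp)
  have "{t \<in> {0..<2 * pi}. cis t \<in> I} = J"
    using J inj unfolding I_def J_def[symmetric] by blast
  then have "arc_length I = measure lborel J / (2 * pi)" by (simp add: arc_length_def)
  also have "measure lborel J = 2 * pi * (1/2) ^ k"
    unfolding J_def by (subst measure_lborel_Ico) (auto simp: field_simps power_one_over)
  finally show len: "arc_length I = (1/2) ^ k" by simp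
  show "circle_arc I"
    unfolding circle_arc_def
  proof
    show "\<exists>a J. is_interval J \<and> J \<subseteq> {a..a + 2 * pi} \<and> I = cis ` J"
    proof (rule exI[of _ 0], rule exI[of _ J], intro conjI)
      show "is_interval J" unfolding J_def is_interval_1 by auto
      show "J \<subseteq> {0..0 + 2 * pi}" using J by auto
      show "I = cis ` J" by (simp add: I_def J_def)
    qed
  qed (simp add: len)
  have r0: "0 \<le> 1 - (1/2 :: real) ^ k" by (simp add: power_le_one)
  show "carleson_square I = {z \<in> unit_disk. 1 - (1/2) ^ k \<le> norm z \<and> arc_index k z = i}"
  proof (intro equalityI subsetI)
    fix z assume "z \<in> carleson_square I"
    then obtain r w where rw: "z = of_real r * w" "w \<in> I" "1 - (1/2) ^ k \<le> r" "r < 1"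
      unfolding carleson_square_def len by blast
    moreover obtain t where "t \<in> J" "w = cis t" using rw(2) unfolding I_def J_def by blast
    ultimately have z: "z = of_real r * cis t" "t \<in> J" "1 - (1/2) ^ k \<le> r" "r < 1" by simp_all
    have "0 \<le> r" using r0 z(3) by linarith
    have "arc_index k z = i"
    \<comment> \<open>At the origin the argument says nothing about t. This point belongs to the
      square only for k = 0, where 0 is the only index.\<close>
    proof (cases "r = 0")
      case True
      have "k = 0"
      proof (rule ccontr)
        assume "k \<noteq> 0"
        then have "(1/2 :: real) ^ k \<le> (1/2) ^ 1" by (intro power_decreasing) auto
        then show False using z(3) True by simp
      qed
      then show ?thesis using i arc_index_less[of k z] by simp
    next
      case False
      then have "Arg2pi z = t" using z J \<open>0 \<le> r\<close> by (intro Arg2pi_unique[of r]) (auto simp: cis_conv_exp)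
      then have "2 ^ k * (Arg2pi z / (2 * pi)) \<in> {real i..<real i + 1}" using z(2) by (auto simp: J_def field_simps)
      then have "\<lfloor>2 ^ k * (Arg2pi z / (2 * pi))\<rfloor> = int i" by (intro floor_unique) auto
      then show ?thesis by (simp add: arc_index_def)
    qed
    then show "z \<in> {z \<in> unit_disk. 1 - (1/2) ^ k \<le> norm z \<and> arc_index k z = i}"
      using z \<open>0 \<le> r\<close> by (simp add: norm_mult)
  next
    fix z assume z: "z \<in> {z \<in> unit_disk. 1 - (1/2) ^ k \<le> norm z \<and> arc_index k z = i}"
    have argJ: "Arg2pi z \<in> J" using z arc_index_bounds[where k = k and z = z] by (auto simp: J_def)
    have "\<exists>r w. z = of_real r * w \<and> w \<in> cis ` J \<and> 1 - (1/2) ^ k \<le> r \<and> r < 1"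
    proof (intro exI conjI)
      show "z = of_real (norm z) * cis (Arg2pi z)" using Arg2pi_eq[of z] by (simp add: cis_conv_exp)
    qed (use argJ z in auto)
    then show "z \<in> carleson_square I"
      unfolding carleson_square_def len mem_Collect_eq unfolding I_def J_def[symmetric] .
  qed
qed

lemma dyadic_carleson_square_in_sets:
  "{z \<in> unit_disk. c \<le> norm z \<and> arc_index k z = i} \<in> sets (restrict_space borel unit_disk)"
proof -
  have "{z. c \<le> norm z \<and> arc_index k z = i} \<in> sets borel" by measurable
  then show ?thesis
    unfolding sets_restrict_space by (rule image_eqI[rotated]) auto
qed

lemma emeasure_shadow_le_carleson_square:
  assumes "i < 2 ^ k" and "sets \<mu> = sets (restrict_space borel unit_disk)"
  shows "emeasure \<mu> {z \<in> unit_disk. k \<le> gen z \<and> arc_index k z = i}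
    \<le> emeasure \<mu> (carleson_square (cis ` {2 * pi * (i / 2 ^ k)..<2 * pi * (Suc i / 2 ^ k)}))"
  unfolding carleson_square_dyadic(3)[OF assms(1)]
proof (intro emeasure_mono)
  show "{z \<in> unit_disk. 1 - (1/2) ^ k \<le> norm z \<and> arc_index k z = i} \<in> sets \<mu>"
    unfolding assms(2) by (rule dyadic_carleson_square_in_sets)
  show "{z \<in> unit_disk. k \<le> gen z \<and> arc_index k z = i} \<subseteq> {z \<in> unit_disk. 1 - (1/2) ^ k \<le> norm z \<and> arc_index k z = i}"
  proof safe
    fix z assume "z \<in> unit_disk" "k \<le> gen z"
    then have "(1/2 :: real) ^ gen z \<le> (1/2) ^ k" "1 - (1/2) ^ gen z \<le> norm z"
      using gen_bounds[of z] by (auto intro: power_decreasing)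
    then show "1 - (1/2) ^ k \<le> norm z" by linarith
  qed
qed

text \<open>\<open>arc_length\<close> counts angles in [0, 2 pi), whereas an arc may be parametrized
  anywhere on the line. After a shift the parameter interval starts in [0, 2 pi); a part beyond 2 pi
  is moved back to 0, and \<open>v \<le> u + 2 * pi\<close> keeps the two pieces disjoint.\<close>

lemma measure_angles_ge:
  fixes u v :: real
  assumes uv: "u \<le> v" "v \<le> u + 2 * pi" and A: "A \<in> sets lborel" "A \<subseteq> {0..<2 * pi}"
    and sub: "\<And>t s. t \<in> {0..<2 * pi} \<Longrightarrow> s \<in> {u..<v} \<Longrightarrow> cis t = cis s \<Longrightarrow> t \<in> A"
  shows "v - u \<le> measure lborel A"
proof -
  define m where "m = \<lfloor>u / (2 * pi)\<rfloor>"
  define u' where "u' = u - 2 * pi * m"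
  define v' where "v' = v - 2 * pi * m"
  have "real_of_int m \<le> u / (2 * pi)" "u / (2 * pi) < real_of_int m + 1" unfolding m_def by linarith+
  then have u': "0 \<le> u'" "u' < 2 * pi" by (auto simp: u'_def field_simps)
  have v': "u' \<le> v'" "v' \<le> u' + 2 * pi" using uv by (auto simp: u'_def v'_def)
  have cis_int: "cis (t + 2 * pi * of_int n) = cis t" for t n
  proof -
    have "cis (2 * pi * of_int n) = 1" by (simp add: complex_eq_iff)
    then show ?thesis by (simp flip: cis_mult)
  qed
  have fin: "A \<in> fmeasurable lborel"
    by (rule fmeasurableI2[of "{0..<2 * pi}"]) (use A in \<open>auto simp: fmeasurable_def\<close>)
  have in_A: "t \<in> A" if "t \<in> {0..<2 * pi}" "t + 2 * pi * of_int n \<in> {u'..<v'}" for t n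
  proof (rule sub[OF that(1), of "t + 2 * pi * of_int (n + m)"])
    show "t + 2 * pi * of_int (n + m) \<in> {u..<v}" using that(2) by (auto simp: u'_def v'_def algebra_simps)
  qed (rule cis_int[symmetric])
  show ?thesis
  proof (cases "v' \<le> 2 * pi")
    case True
    have "{u'..<v'} \<subseteq> A"
    proof
      fix t assume "t \<in> {u'..<v'}"
      then show "t \<in> A" using in_A[of t 0] u' True by auto
    qed
    then have "measure lborel {u'..<v'} \<le> measure lborel A" using fin by (intro measure_mono_fmeasurable) auto
    then show ?thesis using v' by (simp add: u'_def v'_def)
  next
    case False
    have "{u'..<2 * pi} \<union> {0..<v' - 2 * pi} \<subseteq> A"
    proof
      fix t assume "t \<in> {u'..<2 * pi} \<union> {0..<v' - 2 * pi}"
      then show "t \<in> A" using in_A[of t 0] in_A[of t 1] u' v' False by auto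
    qed
    then have "measure lborel ({u'..<2 * pi} \<union> {0..<v' - 2 * pi}) \<le> measure lborel A"
      using fin by (intro measure_mono_fmeasurable) auto
    moreover have "measure lborel ({u'..<2 * pi} \<union> {0..<v' - 2 * pi}) = measure lborel {u'..<2 * pi} + measure lborel {0..<v' - 2 * pi}"
      using u' v' False by (intro measure_Union) auto
    ultimately show ?thesis using u' v' False by (simp add: u'_def v'_def)
  qed
qed

lemma circle_arcE:
  assumes "circle_arc I"
  obtains J where "I = cis ` J" "J \<noteq> {}" "\<And>u v. u \<in> J \<Longrightarrow> v \<in> J \<Longrightarrow> \<bar>u - v\<bar> \<le> 2 * pi * arc_length I"
proof -
  obtain a J where J: "is_interval J" "J \<subseteq> {a..a + 2 * pi}" "I = cis ` J" and len: "0 < arc_length I"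
    using assms unfolding circle_arc_def by blast
  define A where "A = {t \<in> {0..<2 * pi}. cis t \<in> I}"
  have "0 < measure lborel A" using len by (simp add: arc_length_def A_def zero_less_divide_iff)
  \<comment> \<open>\<open>measure\<close> is 0 outside the sigma-algebra, so positive length
    already implies measurability.\<close>
  then have A: "A \<in> sets lborel" using measure_notin_sets[of A lborel] by auto
  have ord: "v - u \<le> 2 * pi * arc_length I" if uv: "u \<in> J" "v \<in> J" "u \<le> v" for u v
  proof -
    have "v - u \<le> measure lborel A"
    proof (rule measure_angles_ge[OF uv(3) _ A])
      have "u \<in> {a..a + 2 * pi}" "v \<in> {a..a + 2 * pi}" using uv J(2) by blast+
      then show "v \<le> u + 2 * pi" by auto
      fix t s assume ts: "t \<in> {0..<2 * pi}" "s \<in> {u..<v}" "cis t = cis s"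
      have "s \<in> J" using J(1) uv(1,2) ts(2) unfolding is_interval_1 atLeastLessThan_iff by (meson less_imp_le)
      then have "cis t \<in> I" unfolding J(3) ts(3) by (rule imageI)
      with ts(1) show "t \<in> A" unfolding A_def by blast
    qed (auto simp: A_def)
    then show ?thesis by (simp add: arc_length_def A_def)
  qed
  have "\<bar>u - v\<bar> \<le> 2 * pi * arc_length I" if "u \<in> J" "v \<in> J" for u v
    using ord[of u v] ord[of v u] that by (cases "u \<le> v") auto
  moreover have "J \<noteq> {}"
  proof
    assume "J = {}"
    then have "A = {}" using J(3) by (simp add: A_def)
    then show False using \<open>0 < measure lborel A\<close> by simp
  qed
  ultimately show ?thesis using that J(3) by blast
qed

lemma arc_length_bounds:
  assumes "circle_arc I"
  shows "0 < arc_length I" "arc_length I \<le> 1"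
proof -
  show "0 < arc_length I" using assms by (simp add: circle_arc_def)
  define A where "A = {t \<in> {0..<2 * pi}. cis t \<in> I}"
  have "0 < measure lborel A" using \<open>0 < arc_length I\<close> by (simp add: arc_length_def A_def zero_less_divide_iff)
  then have "A \<in> sets lborel" using measure_notin_sets[of A lborel] by auto
  then have "measure lborel A \<le> measure lborel {0..<2 * pi}"
    by (intro measure_mono_fmeasurable) (auto simp: A_def fmeasurable_def)
  then show "arc_length I \<le> 1" by (simp add: arc_length_def A_def)
qed

lemma norm_one_minus_cis_le: "norm (1 - cis t) \<le> \<bar>t\<bar>"
proof -
  have "norm (1 - cis t) = 2 * \<bar>sin (t / 2)\<bar>"
    using dist_exp_i_1[of t] by (simp add: cis_conv_exp norm_minus_commute)
  also have "\<dots> \<le> \<bar>t\<bar>" using abs_sin_x_le_abs_x[of "t / 2"] by simp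
  finally show ?thesis .
qed

text \<open>The point a has the argument of an arbitrary point of the arc. With s = |a| |z|, 1 - s
  is at most 3/2 |I| and the angular difference at most 2 pi |I|; together they stay below 10
  |I|.\<close>

lemma carleson_square_center:
  assumes I: "circle_arc I"
  shows "\<exists>a. norm a = 1 - arc_length I / 2 \<and> (\<forall>z\<in>carleson_square I. norm z < 1 \<and> norm (1 - cnj a * z) \<le> 10 * arc_length I)"
proof -
  define d where "d = arc_length I"
  have d: "0 < d" "d \<le> 1" using arc_length_bounds[OF I] by (auto simp: d_def)
  obtain J where J: "I = cis ` J" "J \<noteq> {}" "\<And>u v. u \<in> J \<Longrightarrow> v \<in> J \<Longrightarrow> \<bar>u - v\<bar> \<le> 2 * pi * d"
    using circle_arcE[OF I] unfolding d_def by metis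
  obtain c where c: "c \<in> J" using J(2) by blast
  define a where "a = of_real (1 - d / 2) * cis c"
  show ?thesis
  proof (intro exI[of _ a] conjI ballI)
    show "norm a = 1 - arc_length I / 2" unfolding a_def d_def[symmetric] norm_mult norm_of_real norm_cis using d by simp
    fix z assume "z \<in> carleson_square I"
    then obtain r w where rw: "z = of_real r * w" "w \<in> I" "1 - d \<le> r" "r < 1"
      unfolding carleson_square_def d_def by blast
    moreover obtain t where "t \<in> J" "w = cis t" using rw(2) unfolding J(1) by blast
    ultimately have z: "z = of_real r * cis t" "t \<in> J" "1 - d \<le> r" "r < 1" by simp_all
    have r: "0 \<le> r" using z d by linarith
    show "norm z < 1" using z r by (simp add: norm_mult)
    define s where "s = (1 - d / 2) * r"
    have s: "0 \<le> s" "s \<le> 1" "1 - s \<le> 3 / 2 * d"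
    proof -
      show "0 \<le> s" "s \<le> 1" unfolding s_def using d r z by (auto intro: mult_le_one)
      have "(1 - d / 2) * (1 - d) \<le> s" unfolding s_def using d z by (intro mult_left_mono) auto
      moreover have "(1 - d / 2) * (1 - d) = 1 - 3 / 2 * d + d * d / 2" by (simp add: field_simps)
      moreover have "0 \<le> d * d" by simp
      ultimately show "1 - s \<le> 3 / 2 * d" by linarith
    qed
    have "cnj a * z = of_real s * cis (t - c)"
      by (simp add: a_def z(1) s_def cis_cnj cis_divide[symmetric] cis_inverse[symmetric] field_simps)
    then have "1 - cnj a * z = of_real (1 - s) + of_real s * (1 - cis (t - c))" by (simp add: algebra_simps)
    then have "norm (1 - cnj a * z) \<le> norm (of_real (1 - s) :: complex) + norm (of_real s * (1 - cis (t - c)))"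
      by (simp only: norm_triangle_ineq)
    also have "\<dots> = (1 - s) + s * norm (1 - cis (t - c))" using s by (simp add: norm_mult del: of_real_diff)
    also have "\<dots> \<le> 3 / 2 * d + 1 * (2 * pi * d)"
      using s norm_one_minus_cis_le[of "t - c"] J(3)[OF z(2) c] by (intro add_mono mult_mono) auto
    also have "\<dots> \<le> 10 * d"
    proof -
      have "2 * pi * d \<le> 8 * d" using d pi_less_4 by (intro mult_right_mono) auto
      then show ?thesis using d by linarith
    qed
    finally show "norm (1 - cnj a * z) \<le> 10 * arc_length I" by (simp add: d_def)
  qed
qed

section \<open>Necessary and sufficient conditions\<close>

text \<open>Chebyshev's inequality. A set outside the sigma-algebra has \<open>emeasure\<close> 0,
  which allows any Carleson square to be inserted as it stands.\<close>

lemma powr_emeasure_le_nn_integral: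
  assumes f: "f \<in> borel_measurable \<mu>" and c: "0 < c" and q: "0 \<le> q" and S: "\<And>z. z \<in> S \<Longrightarrow> c \<le> norm (f z)"
  shows "ennreal (c powr q) * emeasure \<mu> S \<le> (\<integral>\<^sup>+z. ennreal (norm (f z) powr q) \<partial>\<mu>)"
proof (cases "S \<in> sets \<mu>")
  case True
  have "ennreal (c powr q) * emeasure \<mu> S = (\<integral>\<^sup>+z. ennreal (c powr q) * indicator S z \<partial>\<mu>)"
    using True by (simp add: nn_integral_cmult_indicator)
  also have "\<dots> \<le> (\<integral>\<^sup>+z. ennreal (norm (f z) powr q) \<partial>\<mu>)"
    using S c q by (intro nn_integral_mono) (auto intro!: ennreal_leI powr_mono2 split: split_indicator)
  finally show ?thesis .
qed (simp add: emeasure_notin_sets)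

lemma emeasure_le_of_powr_mult_le:
  fixes c q K :: real
  assumes c: "0 < c" and le: "ennreal (c powr q) * m \<le> ennreal K"
  shows "m \<le> ennreal (c powr (- q) * K)"
proof -
  have "m = ennreal (c powr (- q)) * (ennreal (c powr q) * m)"
    using c by (simp flip: mult.assoc ennreal_mult powr_add)
  also have "\<dots> \<le> ennreal (c powr (- q)) * ennreal K" by (intro mult_left_mono le) auto
  finally show ?thesis by (simp add: ennreal_mult')
qed

lemma one_minus_cnj_mult_nonzero:
  assumes "norm a < 1" "z \<in> unit_disk"
  shows "1 - cnj a * z \<noteq> 0" "0 < Re (1 - cnj a * z)"
proof -
  have "norm (cnj a * z) < 1"
    using assms mult_left_mono[of "norm z" 1 "norm a"] by (simp add: norm_mult)
  then show "0 < Re (1 - cnj a * z)" using complex_Re_le_cmod[of "cnj a * z"] by simp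
  then show "1 - cnj a * z \<noteq> 0" by (metis less_irrefl zero_complex.sel(1))
qed

lemma dirichlet_integral_le_kernel:
  assumes f: "f holomorphic_on unit_disk" and K: "0 \<le> K" and p: "0 < p"
    and d: "\<And>z. z \<in> unit_disk \<Longrightarrow> norm (deriv f z) powr p \<le> K * norm (1 - cnj a * z) powr (- b)"
  shows "dirichlet_integral p \<alpha> f \<le> ennreal (K / pi) *
    kernel_integral \<alpha> b a"
proof -
  have "dirichlet_integral p \<alpha> f = ennreal (1 / pi) * (\<integral>\<^sup>+z. ennreal (norm (deriv f z) powr p * (1 - (norm z)\<^sup>2) powr \<alpha>) * indicator unit_disk z \<partial>lborel)"
    unfolding dirichlet_integral_def by (intro nn_integral_disk_area dirichlet_integrand_measurable f)
  also have "\<dots> \<le> ennreal (1 / pi) * (\<integral>\<^sup>+z. ennreal K * (ennreal ((1 - (norm z)\<^sup>2) powr \<alpha> * norm (1 - cnj a * z) powr (- b)) * indicator unit_disk z) \<partial>lborel)"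
  proof (intro mult_left_mono nn_integral_mono)
    fix z
    show "ennreal (norm (deriv f z) powr p * (1 - (norm z)\<^sup>2) powr \<alpha>) * indicator unit_disk z
      \<le> ennreal K * (ennreal ((1 - (norm z)\<^sup>2) powr \<alpha> * norm (1 - cnj a * z) powr (- b)) * indicator unit_disk z)"
    proof (cases "z \<in> unit_disk")
      case True
      have "norm (deriv f z) powr p * (1 - (norm z)\<^sup>2) powr \<alpha> \<le> (K * norm (1 - cnj a * z) powr (- b)) * (1 - (norm z)\<^sup>2) powr \<alpha>"
        by (intro mult_right_mono d True) auto
      then show ?thesis using True K by (simp add: mult_ac ennreal_leI flip: ennreal_mult)
    qed simp
  qed simp
  also have "\<dots> = ennreal (1 / pi) * (ennreal K * kernel_integral \<alpha> b a)"
    by (subst nn_integral_cmult) auto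
  finally show ?thesis using K by (simp flip: mult.assoc ennreal_mult)
qed

lemma dirichlet_norm_powr_le:
  assumes p: "0 < p" and q: "0 < q" and f: "f holomorphic_on unit_disk"
    and I: "dirichlet_integral p \<alpha> f \<le> ennreal K" and K: "0 \<le> K" and M: "norm (f 0) powr p + K \<le> M"
  shows "f \<in> dirichlet_space p \<alpha>" "dirichlet_norm p \<alpha> f powr q \<le> M powr (q / p)"
proof -
  show "f \<in> dirichlet_space p \<alpha>" using f I by (auto simp: dirichlet_space_def intro: le_less_trans)
  have "enn2real (dirichlet_integral p \<alpha> f) \<le> K" using I K by (intro enn2real_leI) auto
  then have "norm (f 0) powr p + enn2real (dirichlet_integral p \<alpha> f) \<le> M" using M by linarith
  then have "(norm (f 0) powr p + enn2real (dirichlet_integral p \<alpha> f)) powr (q / p) \<le> M powr (q / p)"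
    using p q by (intro powr_mono2) auto
  then show "dirichlet_norm p \<alpha> f powr q \<le> M powr (q / p)"
    using p by (simp add: dirichlet_norm_def powr_powr)
qed

lemma emeasure_le_of_test_function:
  fixes p q C :: real
  assumes p: "0 < p" and q: "0 < q" and C: "0 \<le> C"
    and sets: "sets \<mu> = sets (restrict_space borel unit_disk)"
    and embedding: "dirichlet_embedding p \<alpha> q \<mu> C"
    and f: "f holomorphic_on unit_disk" and I: "dirichlet_integral p \<alpha> f \<le> ennreal K" and K: "0 \<le> K"
    and M: "norm (f 0) powr p + K \<le> M"
    and c: "0 < c" and S: "\<And>z. z \<in> S \<Longrightarrow> c \<le> norm (f z)"
  shows "emeasure \<mu> S \<le> ennreal (c powr (- q) * (C * M powr (q / p)))"
proof (rule emeasure_le_of_powr_mult_le[OF c])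
  note N = dirichlet_norm_powr_le[OF p q f I K M]
  have "f \<in> borel_measurable \<mu>"
    using borel_measurable_continuous_on_restrict[OF holomorphic_on_imp_continuous_on[OF f]]
    by (simp cong: measurable_cong_sets add: sets)
  then have "ennreal (c powr q) * emeasure \<mu> S \<le> (\<integral>\<^sup>+z. ennreal (norm (f z) powr q) \<partial>\<mu>)"
    using c q S by (intro powr_emeasure_le_nn_integral) auto
  also have "\<dots> \<le> ennreal (C * dirichlet_norm p \<alpha> f powr q)" using embedding N(1) by blast
  also have "\<dots> \<le> ennreal (C * M powr (q / p))" using N(2) C by (intro ennreal_leI mult_left_mono) auto
  finally show "ennreal (c powr q) * emeasure \<mu> S \<le> ennreal (C * M powr (q / p))" .
qed

text \<open>On the square |f| \<ge> (10 |I|)^(-n), while the p-th power of the norm of f is at most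
  a multiple of |I|^(\<alpha>+2-(n+1)p). In the quotient n cancels and the exponent q
  (\<alpha>+2-p)/p remains. A large n puts b = (n+1) p above \<alpha> + 2, where the kernel integral
  is a pure power.\<close>

lemma carleson_measure_necessary:
  fixes p q \<alpha> C :: real
  assumes \<alpha>: "-1 < \<alpha>" and p: "0 < p" and q: "0 < q" and C: "0 \<le> C"
    and sets: "sets \<mu> = sets (restrict_space borel unit_disk)"
    and embedding: "dirichlet_embedding p \<alpha> q \<mu> C"
  shows "carleson_measure (q * (\<alpha> + 2 - p) / p) \<mu>"
proof -
  obtain n :: nat where n: "(\<alpha> + 2) / p < real n" using reals_Archimedean2 by blast
  define b where "b = real (Suc n) * p"
  have b: "\<alpha> + 2 < b" using n p by (auto simp: b_def field_simps)
  obtain C1 where C1: "0 < C1" "\<And>a. norm a < 1 \<Longrightarrow>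
    kernel_integral \<alpha> b a
      \<le> ennreal (C1 * (1 - norm a) powr (\<alpha> + 2 - b))"
    using nn_integral_disk_kernel_le_powr[OF \<alpha> b] by blast
  \<comment> \<open>The power of 1/2 arises because the pole parameter satisfies 1 - |a| =
    |I|/2.\<close>
  define K1 where "K1 = real n powr p / pi * C1 * (1/2) powr (\<alpha> + 2 - b)"
  have K1: "0 \<le> K1" using C1 by (simp add: K1_def)
  define K where "K = 10 powr (real n * q) * (C * (1 + K1) powr (q / p))"
  have K: "0 \<le> K" using C by (simp add: K_def)
  show ?thesis
    unfolding carleson_measure_def
  proof (intro exI[of _ "K + 1"] conjI allI impI)
    show "0 < K + 1" using K by simp
    fix I assume I: "circle_arc I"
    define \<delta> where "\<delta> = arc_length I"
    have \<delta>: "0 < \<delta>" "\<delta> \<le> 1" using arc_length_bounds[OF I] by (auto simp: \<delta>_def)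
    obtain a where a: "norm a = 1 - \<delta> / 2" "\<And>z. z \<in> carleson_square I \<Longrightarrow> norm z < 1 \<and> norm (1 - cnj a * z) \<le> 10 * \<delta>"
      using carleson_square_center[OF I] unfolding \<delta>_def by blast
    have a1: "norm a < 1" using a \<delta> by simp
    note nz = one_minus_cnj_mult_nonzero(1)[OF a1]
    define f where "f z = inverse ((1 - cnj a * z) ^ n)" for z
    have hol: "f holomorphic_on unit_disk" unfolding f_def using nz by (intro holomorphic_intros) auto
    have deriv: "deriv f z = of_nat n * cnj a / (1 - cnj a * z) ^ Suc n" if "z \<in> unit_disk" for z
    proof (rule DERIV_imp_deriv)
      have "(f has_field_derivative - (of_nat n * (1 - cnj a * z) ^ (n - 1) * (- cnj a)) / ((1 - cnj a * z) ^ n * (1 - cnj a * z) ^ n)) (at z)"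
        unfolding f_def using nz[OF that] by (auto intro!: derivative_eq_intros simp: divide_inverse)
      also have "- (of_nat n * (1 - cnj a * z) ^ (n - 1) * (- cnj a)) / ((1 - cnj a * z) ^ n * (1 - cnj a * z) ^ n) = of_nat n * cnj a / (1 - cnj a * z) ^ Suc n"
      proof -
        have "- (of_nat n * w ^ (n - 1) * (- c)) / (w ^ n * w ^ n) = of_nat n * c / w ^ Suc n" if "w \<noteq> 0" for w c :: complex
          using that by (cases n) (simp_all add: field_simps)
        then show ?thesis using nz[OF that] .
      qed
      finally show "(f has_field_derivative of_nat n * cnj a / (1 - cnj a * z) ^ Suc n) (at z)" .
    qed
    have d: "norm (deriv f z) powr p \<le> real n powr p * norm (1 - cnj a * z) powr (- b)" if z: "z \<in> unit_disk" for z
    proof -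
      have "norm (deriv f z) = real n * norm a / norm (1 - cnj a * z) ^ Suc n"
        unfolding deriv[OF z] by (simp add: norm_mult norm_divide norm_power)
      also have "\<dots> \<le> real n * 1 / norm (1 - cnj a * z) ^ Suc n"
        using a1 by (intro divide_right_mono mult_left_mono) auto
      finally have "norm (deriv f z) powr p \<le> (real n / norm (1 - cnj a * z) ^ Suc n) powr p"
        using p by (intro powr_mono2) auto
      also have "\<dots> = real n powr p / (norm (1 - cnj a * z) powr real (Suc n)) powr p"
        using nz[OF z] by (subst powr_divide) (auto simp: powr_realpow simp del: power_Suc of_nat_Suc)
      also have "\<dots> = real n powr p * norm (1 - cnj a * z) powr (- b)"
        by (simp add: powr_powr b_def powr_minus divide_inverse)
      finally show ?thesis .
    qed
    have "dirichlet_integral p \<alpha> f \<le> ennreal (real n powr p / pi) * ennreal (C1 * (1 - norm a) powr (\<alpha> + 2 - b))"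
      by (rule order_trans[OF dirichlet_integral_le_kernel[OF hol _ p d] mult_left_mono[OF C1(2)[OF a1]]]) auto
    also have "\<dots> = ennreal (K1 * \<delta> powr (\<alpha> + 2 - b))"
    proof -
      have "(1 - norm a) powr (\<alpha> + 2 - b) = (1/2) powr (\<alpha> + 2 - b) * \<delta> powr (\<alpha> + 2 - b)"
        using a(1) \<delta> by (simp flip: powr_mult)
      then show ?thesis using C1(1) by (simp add: K1_def flip: ennreal_mult)
    qed
    finally have I_le: "dirichlet_integral p \<alpha> f \<le> ennreal (K1 * \<delta> powr (\<alpha> + 2 - b))" .
    have "1 \<le> \<delta> powr (\<alpha> + 2 - b)" using \<delta> b powr_mono2'[of "\<alpha> + 2 - b" \<delta> 1] by simp
    then have M: "norm (f 0) powr p + K1 * \<delta> powr (\<alpha> + 2 - b) \<le> (1 + K1) * \<delta> powr (\<alpha> + 2 - b)"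
      by (simp add: f_def algebra_simps)
    have "emeasure \<mu> (carleson_square I) \<le> ennreal ((1 / (10 * \<delta>) ^ n) powr (- q) * (C * ((1 + K1) * \<delta> powr (\<alpha> + 2 - b)) powr (q / p)))"
    proof (rule emeasure_le_of_test_function[OF p q C sets embedding hol I_le _ M])
      fix z assume z: "z \<in> carleson_square I"
      then have "z \<in> unit_disk" using a(2) by simp
      then have "0 < norm (1 - cnj a * z)" using nz by simp
      moreover have "0 < 10 * \<delta>" using \<delta> by simp
      ultimately have "1 / (10 * \<delta>) ^ n \<le> 1 / norm (1 - cnj a * z) ^ n"
        using a(2)[OF z] by (intro divide_left_mono power_mono mult_pos_pos zero_less_power) auto
      then show "1 / (10 * \<delta>) ^ n \<le> norm (f z)" by (simp add: f_def norm_inverse norm_power divide_inverse)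
    qed (use \<delta> K1 in auto)
    also have "(1 / (10 * \<delta>) ^ n) powr (- q) * (C * ((1 + K1) * \<delta> powr (\<alpha> + 2 - b)) powr (q / p)) = K * \<delta> powr (q * (\<alpha> + 2 - p) / p)"
    proof -
      have "(1 / (10 * \<delta>) ^ n) powr (- q) = ((10 * \<delta>) powr real n) powr q"
        using \<delta> by (simp add: powr_divide powr_minus_divide powr_realpow)
      also have "\<dots> = 10 powr (real n * q) * \<delta> powr (real n * q)" using \<delta> by (simp add: powr_powr powr_mult)
      finally have 1: "(1 / (10 * \<delta>) ^ n) powr (- q) = 10 powr (real n * q) * \<delta> powr (real n * q)" .
      have 2: "((1 + K1) * \<delta> powr (\<alpha> + 2 - b)) powr (q / p) = (1 + K1) powr (q / p) * \<delta> powr ((\<alpha> + 2 - b) * (q / p))"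
        using K1 by (simp add: powr_mult powr_powr)
      have "real n * q + (\<alpha> + 2 - b) * (q / p) = q * (\<alpha> + 2 - p) / p" using p by (simp add: b_def field_simps)
      then have 3: "\<delta> powr (real n * q) * \<delta> powr ((\<alpha> + 2 - b) * (q / p)) = \<delta> powr (q * (\<alpha> + 2 - p) / p)"
        by (simp only: powr_add[symmetric])
      show ?thesis unfolding 1 2 K_def 3[symmetric] by (simp only: mult_ac)
    qed
    also have "ennreal (K * \<delta> powr (q * (\<alpha> + 2 - p) / p)) \<le> ennreal ((K + 1) * \<delta> powr (q * (\<alpha> + 2 - p) / p))"
      by (intro ennreal_leI mult_right_mono) auto
    finally show "emeasure \<mu> (carleson_square I) \<le> ennreal ((K + 1) * arc_length I powr (q * (\<alpha> + 2 - p) / p))"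
      by (simp add: \<delta>_def)
  qed
qed

lemma one_in_dirichlet_space: "(\<lambda>_. 1) \<in> dirichlet_space p \<alpha>" "dirichlet_norm p \<alpha> (\<lambda>_. 1) = 1"
proof -
  have "dirichlet_integral p \<alpha> (\<lambda>_. 1) = 0" by (simp add: dirichlet_integral_def)
  then show "(\<lambda>_. 1) \<in> dirichlet_space p \<alpha>" "dirichlet_norm p \<alpha> (\<lambda>_. 1) = 1"
    by (simp_all add: dirichlet_space_def dirichlet_norm_def)
qed

lemma emeasure_le_of_embedding:
  assumes "dirichlet_embedding p \<alpha> q \<mu> C"
  shows "emeasure \<mu> A \<le> ennreal C"
proof -
  have "emeasure \<mu> A \<le> emeasure \<mu> (space \<mu>)" by (rule emeasure_space)
  also have "\<dots> = (\<integral>\<^sup>+z. ennreal (norm (1 :: complex) powr q) \<partial>\<mu>)" by simp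
  also have "\<dots> \<le> ennreal C"
    using bspec[OF assms one_in_dirichlet_space(1)] by (simp add: one_in_dirichlet_space(2))
  finally show ?thesis .
qed

text \<open>The test function log(1 - cnj a z) vanishes at 0 and leads to the kernel integral at its
  critical exponent p = \<alpha> + 2, so its norm is at most a multiple of L^(1/p) with L =
  log(1/|I|), while on the square its modulus is at least L/2. For long arcs the constant function 1
  suffices.\<close>

lemma log_carleson_necessary:
  fixes p q C :: real
  assumes p: "1 < p" and q: "0 < q" and C: "0 \<le> C"
    and sets: "sets \<mu> = sets (restrict_space borel unit_disk)"
    and embedding: "dirichlet_embedding p (p - 2) q \<mu> C"
  shows "\<exists>C>0. \<forall>I. circle_arc I \<and> arc_length I < 1 \<longrightarrow>
    emeasure \<mu> (carleson_square I) \<le> ennreal (C * ln (1 / arc_length I) powr ((1 / p - 1) * q))"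
proof -
  have p0: "0 < p" using p by simp
  have \<alpha>: "-1 < p - 2" using p by simp
  obtain C1 where C1: "0 < C1" "\<And>a. norm a < 1 \<Longrightarrow>
    kernel_integral (p - 2) p a
      \<le> ennreal (C1 * (1 + ln (1 / (1 - norm a))))"
    using nn_integral_disk_kernel_le_ln[OF \<alpha>] by auto
  define s where "s = (1 / p - 1) * q"
  have s: "s < 0" using p q by (auto simp: s_def mult_less_0_iff)
  define K1 where "K1 = 2 powr q * (C * (3 * C1 / pi) powr (q / p))"
  define K2 where "K2 = C * ln 100 powr (- s)"
  have K: "0 \<le> K1" "0 \<le> K2" using C by (auto simp: K1_def K2_def)
  show ?thesis
  proof (intro exI[of _ "K1 + K2 + 1"] conjI allI impI)
    show "0 < K1 + K2 + 1" using K by simp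
    fix I assume "circle_arc I \<and> arc_length I < 1"
    then have I: "circle_arc I" and I1: "arc_length I < 1" by auto
    define \<delta> where "\<delta> = arc_length I"
    have \<delta>: "0 < \<delta>" "\<delta> < 1" using arc_length_bounds[OF I] I1 by (auto simp: \<delta>_def)
    define L where "L = ln (1 / \<delta>)"
    have L: "0 < L" using \<delta> by (simp add: L_def ln_div)
    have "emeasure \<mu> (carleson_square I) \<le> ennreal ((K1 + K2) * L powr s)"
    \<comment> \<open>The threshold makes L at least log 100 = 2 log 10, so that L - log 10 \<ge>
      L/2. Above it L is at most log 100, and the negative power of L is bounded below.\<close>
    proof (cases "\<delta> \<le> 1 / 100")
      case False
      have "L \<le> ln 100" unfolding L_def using \<delta> False by (intro ln_mono) (auto simp: field_simps)
      then have "ln 100 powr s \<le> L powr s" using L s by (intro powr_mono2') auto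
      then have "K2 * ln 100 powr s \<le> K2 * L powr s" using K by (intro mult_left_mono)
      moreover have "K2 * ln 100 powr s = C" by (simp add: K2_def flip: powr_add)
      ultimately have "C \<le> (K1 + K2) * L powr s" using K by (simp add: distrib_right add_increasing)
      then show ?thesis using emeasure_le_of_embedding[OF embedding, where A = "carleson_square I"] by (auto intro: order_trans ennreal_leI)
    next
      case True
      obtain a where a: "norm a = 1 - \<delta> / 2" "\<And>z. z \<in> carleson_square I \<Longrightarrow> norm z < 1 \<and> norm (1 - cnj a * z) \<le> 10 * \<delta>"
        using carleson_square_center[OF I] unfolding \<delta>_def by blast
      have a1: "norm a < 1" using a \<delta> by simp
      note nz = one_minus_cnj_mult_nonzero[OF a1]
      have nonpos: "1 - cnj a * z \<notin> \<real>\<^sub>\<le>\<^sub>0" if "z \<in> unit_disk" for z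
        using nz(2)[OF that] complex_nonpos_Reals_iff[of "1 - cnj a * z"] by auto
      define f where "f z = Ln (1 - cnj a * z)" for z
      have hol: "f holomorphic_on unit_disk" unfolding f_def using nonpos by (intro holomorphic_intros) auto
      have deriv: "deriv f z = - cnj a / (1 - cnj a * z)" if "z \<in> unit_disk" for z
        unfolding f_def using nonpos[OF that]
        by (intro DERIV_imp_deriv) (auto intro!: derivative_eq_intros simp: divide_inverse)
      have d: "norm (deriv f z) powr p \<le> 1 * norm (1 - cnj a * z) powr (- p)" if z: "z \<in> unit_disk" for z
      proof -
        have "norm (deriv f z) = norm a / norm (1 - cnj a * z)" unfolding deriv[OF z] by (simp add: norm_divide)
        also have "\<dots> \<le> 1 / norm (1 - cnj a * z)" using a1 by (intro divide_right_mono) auto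
        finally have "norm (deriv f z) powr p \<le> (1 / norm (1 - cnj a * z)) powr p" using p by (intro powr_mono2) auto
        then show ?thesis by (simp add: powr_divide powr_minus_divide)
      qed
      have L100: "ln 100 \<le> L" unfolding L_def using \<delta> True by (intro ln_mono) (auto simp: field_simps)
      have "exp 1 \<le> (100 :: real)" using exp_le by linarith
      then have ln100: "1 \<le> ln (100 :: real)" by (subst ln_ge_iff) auto
      have "dirichlet_integral p (p - 2) f \<le> ennreal (1 / pi) * ennreal (C1 * (1 + ln (1 / (1 - norm a))))"
        by (rule order_trans[OF dirichlet_integral_le_kernel[OF hol _ p0 d] mult_left_mono[OF C1(2)[OF a1]]]) auto
      also have "\<dots> \<le> ennreal (3 * C1 / pi * L)"
      proof -
        \<comment> \<open>Here 1 - |a| = |I|/2. Both 1 and log 2 are at most L, which gives the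
          factor 3.\<close>
        have "ln (1 / (1 - norm a)) = ln 2 + L" using a(1) \<delta> by (simp add: L_def ln_div ln_mult)
        moreover have "ln 2 \<le> (1 :: real)" using ln_2_less_1 by simp
        ultimately have "1 + ln (1 / (1 - norm a)) \<le> 3 * L" using L100 ln100 by linarith
        then have "1 / pi * (C1 * (1 + ln (1 / (1 - norm a)))) \<le> 1 / pi * (C1 * (3 * L))"
          using C1(1) by (intro mult_left_mono) auto
        then show ?thesis using C1(1) by (simp add: ennreal_leI mult_ac flip: ennreal_mult')
      qed
      finally have I_le: "dirichlet_integral p (p - 2) f \<le> ennreal (3 * C1 / pi * L)" .
      have M: "norm (f 0) powr p + 3 * C1 / pi * L \<le> 3 * C1 / pi * L" using p by (simp add: f_def)
      have CL: "0 \<le> 3 * C1 / pi * L" using C1(1) L by simp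
      have "emeasure \<mu> (carleson_square I) \<le> ennreal ((L / 2) powr (- q) * (C * (3 * C1 / pi * L) powr (q / p)))"
      proof (rule emeasure_le_of_test_function[OF p0 q C sets embedding hol I_le CL M])
        fix z assume z: "z \<in> carleson_square I"
        then have zd: "z \<in> unit_disk" using a(2) by simp
        then have n0: "0 < norm (1 - cnj a * z)" using nz by simp
        have "ln (norm (1 - cnj a * z)) \<le> ln (10 * \<delta>)" using a(2)[OF z] n0 \<delta> by (intro ln_mono) auto
        also have "\<dots> = ln 10 - L" using \<delta> by (simp add: L_def ln_mult ln_div)
        finally have "L - ln 10 \<le> - ln (norm (1 - cnj a * z))" by simp
        also have "\<dots> \<le> \<bar>Re (f z)\<bar>" using nz(1)[OF zd] by (simp add: f_def)
        also have "\<dots> \<le> norm (f z)" by (rule abs_Re_le_cmod)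
        finally have "L - ln 10 \<le> norm (f z)" .
        moreover have "ln 100 = 2 * ln (10 :: real)" using ln_mult[of 10 "10 :: real"] by simp
        ultimately show "L / 2 \<le> norm (f z)" using L100 by linarith
      qed (use L in auto)
      also have "(L / 2) powr (- q) * (C * (3 * C1 / pi * L) powr (q / p)) = K1 * L powr s"
      proof -
        have 1: "(L / 2) powr (- q) = 2 powr q * L powr (- q)"
          using L by (simp add: powr_divide powr_minus_divide)
        have 2: "(3 * C1 / pi * L) powr (q / p) = (3 * C1 / pi) powr (q / p) * L powr (q / p)"
          by (rule powr_mult)
        have "- q + q / p = s" using p by (simp add: s_def field_simps)
        then have 3: "L powr (- q) * L powr (q / p) = L powr s" by (simp only: powr_add[symmetric])
        show ?thesis unfolding 1 2 K1_def 3[symmetric] by (simp only: mult_ac)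
      qed
      also have "ennreal (K1 * L powr s) \<le> ennreal ((K1 + K2) * L powr s)"
        using K by (intro ennreal_leI mult_right_mono) auto
      finally show ?thesis .
    qed
    also have "\<dots> \<le> ennreal ((K1 + K2 + 1) * L powr s)" by (intro ennreal_leI mult_right_mono) auto
    finally show "emeasure \<mu> (carleson_square I) \<le> ennreal ((K1 + K2 + 1) * ln (1 / arc_length I) powr ((1 / p - 1) * q))"
      by (simp add: L_def \<delta>_def s_def)
  qed
qed

section \<open>Sufficiency\<close>

text \<open>In the logarithmic case only arcs shorter than the full circle are tested, and their
  squares miss a neighbourhood of 0. The density is bounded on a compact disk, whatever the sign of
  \<beta>, because 1 - |z|^2 stays away from 0.\<close>

lemma emeasure_volterra_half_disk_finite:
  assumes g: "g holomorphic_on unit_disk" and q: "0 < q"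
  shows "emeasure (volterra_measure g q \<beta>) {z \<in> unit_disk. norm z \<le> 1 / 2} < \<infinity>"
proof -
  have S_eq: "{z \<in> unit_disk. norm z \<le> 1 / 2} = cball 0 (1 / 2)" by auto
  have S: "cball 0 (1 / 2) \<in> sets disk_area"
    unfolding sets_disk_area sets_restrict_space by (rule image_eqI[of _ _ "cball 0 (1 / 2)"]) auto
  have sq: "(norm z)\<^sup>2 \<noteq> 1" if "norm z \<le> 1 / 2" for z :: complex
    using that power_mono[of "norm z" "1 / 2" 2] by (auto simp: power2_eq_square)
  have "continuous_on (cball 0 (1 / 2)) (deriv g)"
    using g by (intro holomorphic_on_imp_continuous_on holomorphic_on_subset[OF holomorphic_deriv[OF g open_ball]]) auto
  then have "continuous_on (cball 0 (1 / 2)) (\<lambda>z. (1 - (norm z)\<^sup>2) powr \<beta> * norm (deriv g z) powr q)"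
    using q sq by (intro continuous_intros continuous_on_powr') auto
  then have "bounded ((\<lambda>z. (1 - (norm z)\<^sup>2) powr \<beta> * norm (deriv g z) powr q) ` cball 0 (1 / 2))"
    by (intro compact_imp_bounded compact_continuous_image) auto
  then obtain M where M: "\<And>z. z \<in> cball 0 (1 / 2) \<Longrightarrow> \<bar>(1 - (norm z)\<^sup>2) powr \<beta> * norm (deriv g z) powr q\<bar> \<le> M"
    unfolding bounded_iff ball_simps real_norm_def by blast
  have "emeasure (volterra_measure g q \<beta>) (cball 0 (1 / 2)) = (\<integral>\<^sup>+z. ennreal ((1 - (norm z)\<^sup>2) powr \<beta> * norm (deriv g z) powr q) * indicator (cball 0 (1 / 2)) z \<partial>disk_area)"
    unfolding volterra_measure_def by (intro emeasure_density volterra_density_measurable g S)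
  also have "\<dots> \<le> (\<integral>\<^sup>+z. ennreal M * indicator (cball 0 (1 / 2)) z \<partial>disk_area)"
    using M by (intro nn_integral_mono) (auto intro!: ennreal_leI split: split_indicator simp: abs_le_iff)
  also have "\<dots> = ennreal M * emeasure disk_area (cball 0 (1 / 2))" using S by (rule nn_integral_cmult_indicator)
  also have "emeasure disk_area (cball 0 (1 / 2)) = ennreal (1 / pi) * emeasure lborel (cball 0 (1 / 2) :: complex set)"
    unfolding disk_area_def by (subst emeasure_scale_measure, subst emeasure_restrict_space) auto
  also have "ennreal M * (ennreal (1 / pi) * emeasure lborel (cball 0 (1 / 2) :: complex set)) < \<infinity>"
    by (simp add: emeasure_cball ennreal_mult_less_top)
  finally show ?thesis unfolding S_eq .
qed

lemma measure_shadow_le: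
  assumes i: "i < 2 ^ k" and sets: "sets \<mu> = sets (restrict_space borel unit_disk)" and b: "0 \<le> b"
    and le: "\<And>I. circle_arc I \<Longrightarrow> arc_length I = (1/2) ^ k \<Longrightarrow> emeasure \<mu> (carleson_square I) \<le> ennreal b"
  shows "measure \<mu> {z \<in> unit_disk. k \<le> gen z \<and> arc_index k z = i} \<le> b"
proof -
  have "emeasure \<mu> {z \<in> unit_disk. k \<le> gen z \<and> arc_index k z = i} \<le> ennreal b"
    using emeasure_shadow_le_carleson_square[OF i sets] le carleson_square_dyadic(1,2)[OF i] by (meson order_trans)
  then show ?thesis unfolding measure_def using b by (rule enn2real_leI[rotated])
qed

lemma carleson_measure_sufficient:
  fixes p q \<alpha> :: real
  assumes p: "0 < p" "p < q" and \<alpha>: "p < \<alpha> + 2"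
    and sets: "sets \<mu> = sets (restrict_space borel unit_disk)"
    and carleson: "carleson_measure (q * (\<alpha> + 2 - p) / p) \<mu>"
  shows "\<exists>C\<ge>0. dirichlet_embedding p \<alpha> q \<mu> C"
proof -
  define \<tau> where "\<tau> = (\<alpha> + 2 - p) / p"
  have \<tau>: "0 < \<tau>" using p \<alpha> by (simp add: \<tau>_def)
  have exponent: "q * (\<alpha> + 2 - p) / p = \<tau> * q" by (simp add: \<tau>_def)
  obtain B where B: "0 < B" "\<And>I. circle_arc I \<Longrightarrow> emeasure \<mu> (carleson_square I) \<le> ennreal (B * arc_length I powr (\<tau> * q))"
    using carleson unfolding carleson_measure_def exponent by blast
  define bnd where "bnd k = B * 2 powr (- (real k * (\<tau> * q)))" for k
  have half: "((1/2) ^ k) powr (\<tau> * q) = 2 powr (- (real k * (\<tau> * q)))" for k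
    by (simp add: power_one_over powr_divide powr_powr powr_minus_divide flip: powr_realpow)
  obtain C0 where C0: "0 \<le> C0" and tree: "\<And>(T :: (nat \<times> nat) set) lev anc m h. finite_tree T lev anc \<Longrightarrow> (\<forall>z. 0 \<le> m z) \<Longrightarrow> (\<forall>z. 0 \<le> h z) \<Longrightarrow>
    (\<forall>Q\<in>T. finite_tree.shadow T lev anc m Q \<le> B * 2 powr (- (real (lev Q) * (\<tau> * q)))) \<Longrightarrow>
    (\<Sum>z\<in>T. m z * finite_tree.path_sum lev anc (\<lambda>j. 2 powr (real j * \<tau>)) h z powr q)
      \<le> C0 * (\<Sum>z\<in>T. h z powr p) powr (q / p)"
    using tree_embedding_geometric[OF p \<tau>, of B, where 'a = "nat \<times> nat"] B(1) by (auto simp: less_imp_le)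
  show ?thesis
  proof (rule embedding_from_tree[OF p(1) _ _ sets C0])
    show "0 < q" using p by simp
    \<comment> \<open>The square of the full circle is the whole disk, so the condition for |I| = 1
      contains the finiteness of \<mu>.\<close>
    have "carleson_square (cis ` {2 * pi * (real 0 / 2 ^ 0)..<2 * pi * (real (Suc 0) / 2 ^ 0)}) = space \<mu>"
      unfolding sets_eq_imp_space_eq[OF sets] by (subst carleson_square_dyadic(3)) (use arc_index_less[of 0] in auto)
    then have "emeasure \<mu> (space \<mu>) < \<infinity>"
      using B(2)[OF carleson_square_dyadic(1)[of 0 0]] by (auto intro: le_less_trans)
    then show "finite_measure \<mu>" by (intro finite_measureI) auto
    fix k i :: nat assume i: "i < 2 ^ k"
    show "measure \<mu> {z \<in> unit_disk. k \<le> gen z \<and> arc_index k z = i} \<le> bnd k"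
    proof (rule measure_shadow_le[OF i sets])
      fix I assume "circle_arc I" "arc_length I = (1/2) ^ k"
      then show "emeasure \<mu> (carleson_square I) \<le> ennreal (bnd k)" using B(2)[of I] by (simp add: bnd_def half)
    qed (use B in \<open>simp add: bnd_def\<close>)
  next
    fix N and m h :: "nat \<times> nat \<Rightarrow> real"
    assume "\<And>Q. 0 \<le> m Q" "\<And>Q. 0 \<le> h Q" "\<And>Q. Q \<in> nodes N \<Longrightarrow> finite_tree.shadow (nodes N) fst ancestor m Q \<le> bnd (fst Q)"
    then show "(\<Sum>Q\<in>nodes N. m Q * finite_tree.path_sum fst ancestor (\<lambda>j. 2 powr (real j * ((\<alpha> + 2 - p) / p))) h Q powr q)
        \<le> C0 * (\<Sum>Q\<in>nodes N. h Q powr p) powr (q / p)"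
      unfolding \<tau>_def[symmetric] bnd_def by (intro tree finite_tree_nodes) auto
  qed
qed

text \<open>Here \<tau> = 0, all weights are 1 and V_k = k + 1. For a dyadic arc of generation k the
  logarithm is k log 2, so the hypothesis has the form required by the tree inequality, with e = q
  (1 - 1/p).\<close>

lemma log_carleson_sufficient:
  fixes p q C :: real
  assumes p: "1 < p" "p < q" and C: "0 < C"
    and sets: "sets \<mu> = sets (restrict_space borel unit_disk)"
    and half_disk: "emeasure \<mu> {z \<in> unit_disk. norm z \<le> 1 / 2} < \<infinity>"
    and carleson: "\<And>I. circle_arc I \<Longrightarrow> arc_length I < 1 \<Longrightarrow>
      emeasure \<mu> (carleson_square I) \<le> ennreal (C * ln (1 / arc_length I) powr ((1 / p - 1) * q))"
  shows "\<exists>C\<ge>0. dirichlet_embedding p (p - 2) q \<mu> C"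
proof -
  define e where "e = q * (1 - 1 / p)"
  have e: "0 < e" using p by (simp add: e_def)
  have e_eq: "(1 / p - 1) * q = - e" by (simp add: e_def algebra_simps)
  have space: "space \<mu> = unit_disk" using sets_eq_imp_space_eq[OF sets] by simp
  let ?S = "\<lambda>i. {z \<in> unit_disk. 1 - (1/2) ^ 1 \<le> norm z \<and> arc_index 1 z = i}"
  have S_fin: "emeasure \<mu> (?S i) < \<infinity>" if "i < 2 ^ 1" for i
  proof -
    have "emeasure \<mu> (?S i) \<le> ennreal (C * ln (1 / (1/2) ^ 1) powr ((1 / p - 1) * q))"
      using carleson[OF carleson_square_dyadic(1)[OF that]] unfolding carleson_square_dyadic(2,3)[OF that] by simp
    then show ?thesis by (rule le_less_trans) simp
  qed
  have fin: "finite_measure \<mu>"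
  proof (rule finite_measureI)
    have half_sets: "{z \<in> unit_disk. norm z \<le> 1 / 2} \<in> sets \<mu>"
      unfolding sets sets_restrict_space by (rule image_eqI[of _ _ "cball 0 (1 / 2)"]) auto
    have S_sets: "?S i \<in> sets \<mu>" for i unfolding sets by (rule dyadic_carleson_square_in_sets)
    \<comment> \<open>The two squares of generation 1 cover the annulus |z| \<ge> 1/2; the disk |z|
      \<le> 1/2 has finite mass by hypothesis.\<close>
    have "space \<mu> \<subseteq> {z \<in> unit_disk. norm z \<le> 1 / 2} \<union> (?S 0 \<union> ?S 1)"
    proof
      fix z assume "z \<in> space \<mu>"
      then show "z \<in> {z \<in> unit_disk. norm z \<le> 1 / 2} \<union> (?S 0 \<union> ?S 1)"
        using arc_index_less[of 1 z] unfolding space by (auto simp: less_2_cases_iff)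
    qed
    then have "emeasure \<mu> (space \<mu>) \<le> emeasure \<mu> ({z \<in> unit_disk. norm z \<le> 1 / 2} \<union> (?S 0 \<union> ?S 1))"
      using half_sets S_sets by (intro emeasure_mono sets.Un)
    also have "\<dots> \<le> emeasure \<mu> {z \<in> unit_disk. norm z \<le> 1 / 2} + (emeasure \<mu> (?S 0) + emeasure \<mu> (?S 1))"
      using half_sets S_sets by (intro order_trans[OF emeasure_subadditive] add_left_mono emeasure_subadditive sets.Un)
    also have "\<dots> < \<infinity>" using half_disk S_fin[of 0] S_fin[of 1] by simp
    finally show "emeasure \<mu> (space \<mu>) \<noteq> \<infinity>" by simp
  qed
  interpret \<mu>: finite_measure \<mu> by (rule fin)
  \<comment> \<open>At the root the hypothesis says nothing and the total mass is used. For k \<ge>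
    1 one has k \<ge> (k+1)/2, which costs the factor 2^e.\<close>
  define B where "B = max (measure \<mu> (space \<mu>)) (C * ln 2 powr (- e) * 2 powr e)"
  have B: "0 \<le> B" by (simp add: B_def le_max_iff_disj)
  define bnd where "bnd k = B * (real (Suc k)) powr (- e)" for k
  define C0 where "C0 = 2 * q / p * (2 * q * (B powr (1 / (p - 1)) * (p / (p - 1) + p / (q - p))) + 1) powr (p - 1)"
  have C0: "0 \<le> C0" using p by (simp add: C0_def)
  have p0: "0 < p" and q0: "0 < q" using p by auto
  show ?thesis
  proof (rule embedding_from_tree[OF p0 q0 fin sets C0])
    fix k i :: nat assume i: "i < 2 ^ k"
    show "measure \<mu> {z \<in> unit_disk. k \<le> gen z \<and> arc_index k z = i} \<le> bnd k"
    proof (cases "k = 0")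
      case True
      have "measure \<mu> {z \<in> unit_disk. k \<le> gen z \<and> arc_index k z = i} \<le> measure \<mu> (space \<mu>)" by (rule \<mu>.bounded_measure)
      also have "\<dots> \<le> bnd k" using True by (simp add: bnd_def B_def)
      finally show ?thesis .
    next
      case False
      show ?thesis
      proof (rule measure_shadow_le[OF i sets])
        show "0 \<le> bnd k" using B by (simp add: bnd_def)
        fix I assume I: "circle_arc I" "arc_length I = (1/2) ^ k"
        have "arc_length I < 1" unfolding I(2) using False by (simp add: power_less_one_iff)
        then have "emeasure \<mu> (carleson_square I) \<le> ennreal (C * ln (1 / arc_length I) powr (- e))"
          using carleson[OF I(1)] by (simp add: e_eq)
        also have "ln (1 / arc_length I) = real k * ln 2" unfolding I(2) by (simp add: ln_realpow power_one_over)
        also have "C * (real k * ln 2) powr (- e) \<le> bnd k"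
        proof -
          have "real k powr (- e) \<le> (real (Suc k) / 2) powr (- e)" using False e by (intro powr_mono2') auto
          also have "\<dots> = 2 powr e * real (Suc k) powr (- e)" by (simp add: powr_divide powr_minus_divide)
          finally have "C * ln 2 powr (- e) * real k powr (- e) \<le> C * ln 2 powr (- e) * (2 powr e * real (Suc k) powr (- e))"
            using C by (intro mult_left_mono) auto
          also have "\<dots> = C * ln 2 powr (- e) * 2 powr e * real (Suc k) powr (- e)" by (simp only: mult.assoc)
          also have "\<dots> \<le> bnd k" unfolding bnd_def by (intro mult_right_mono) (auto simp: B_def)
          finally show ?thesis by (simp add: powr_mult mult_ac)
        qed
        finally show "emeasure \<mu> (carleson_square I) \<le> ennreal (bnd k)" by (simp add: ennreal_leI)
      qed
    qed
  next
    fix N and m h :: "nat \<times> nat \<Rightarrow> real"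
    assume m: "\<And>Q. 0 \<le> m Q" and h: "\<And>Q. 0 \<le> h Q"
      and sh: "\<And>Q. Q \<in> nodes N \<Longrightarrow> finite_tree.shadow (nodes N) fst ancestor m Q \<le> bnd (fst Q)"
    show "(\<Sum>Q\<in>nodes N. m Q * finite_tree.path_sum fst ancestor (\<lambda>j. 2 powr (real j * ((p - 2 + 2 - p) / p))) h Q powr q)
        \<le> C0 * (\<Sum>Q\<in>nodes N. h Q powr p) powr (q / p)"
      unfolding C0_def
    proof (intro finite_tree.sum_path_sum_powr_le[OF finite_tree_nodes p B] m h)
      fix Q assume "Q \<in> nodes N"
      then show "finite_tree.shadow (nodes N) fst ancestor m Q
        \<le> B * (\<Sum>j\<le>fst Q. (2 powr (real j * ((p - 2 + 2 - p) / p))) powr (p / (p - 1))) powr (- (q * (1 - 1 / p)))"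
        using sh by (simp add: bnd_def e_def add.commute)
    qed simp
  qed
qed

text \<open>For \<tau> < 0 every single coefficient is bounded by a multiple of the norm of f, and
  the path sum is a convergent geometric series. Thus f is bounded, and integration costs the total
  mass.\<close>

lemma finite_measure_sufficient:
  fixes p q \<alpha> :: real
  assumes p: "0 < p" and q: "0 < q" and \<alpha>: "\<alpha> + 2 < p" and fin: "finite_measure \<mu>"
    and sets: "sets \<mu> = sets (restrict_space borel unit_disk)"
  shows "\<exists>C\<ge>0. dirichlet_embedding p \<alpha> q \<mu> C"
proof -
  interpret \<mu>: finite_measure \<mu> by (rule fin)
  have space: "space \<mu> = unit_disk" using sets_eq_imp_space_eq[OF sets] by simp
  define \<tau> where "\<tau> = (\<alpha> + 2 - p) / p"
  have \<tau>: "\<tau> < 0" using p \<alpha> by (simp add: \<tau>_def divide_neg_pos)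
  obtain C1 where C1: "0 < C1" "\<And>f. f \<in> dirichlet_space p \<alpha> \<Longrightarrow> \<exists>h :: nat \<times> nat \<Rightarrow> real. (\<forall>Q. 0 \<le> h Q) \<and>
    (\<forall>N. (\<Sum>Q\<in>nodes N. h Q powr p) \<le> C1 * dirichlet_norm p \<alpha> f powr p) \<and>
    (\<forall>z\<in>unit_disk. norm (f z) \<le> (\<Sum>j\<le>gen z. 2 powr (real j * \<tau>) * h (j, arc_index j z)))"
    using whitney_coefficients[OF p, of \<alpha>] unfolding \<tau>_def by blast
  define G where "G = 1 / (1 - 2 powr \<tau>)"
  have G: "0 < G" using powr_less_mono[of \<tau> 0 "2::real"] \<tau> by (simp add: G_def)
  have geom: "(\<Sum>j\<le>n. 2 powr (real j * \<tau>)) \<le> G" for n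
  proof -
    have "2 powr (real j * \<tau>) = (2 powr \<tau>) ^ j" for j by (simp add: powr_powr mult.commute flip: powr_realpow)
    then have "(\<Sum>j\<le>n. 2 powr (real j * \<tau>)) = (\<Sum>j<Suc n. (2 powr \<tau>) ^ j)" by (simp add: lessThan_Suc_atMost)
    also have "\<dots> \<le> (\<Sum>j. (2 powr \<tau>) ^ j)"
      using powr_less_mono[of \<tau> 0 "2::real"] \<tau> by (intro sum_le_suminf summable_geometric) auto
    also have "\<dots> = G" using powr_less_mono[of \<tau> 0 "2::real"] \<tau> by (simp add: G_def suminf_geometric)
    finally show ?thesis .
  qed
  define K where "K = G * C1 powr (1 / p)"
  have K: "0 < K" using G C1 by (simp add: K_def)
  show ?thesis
  proof (intro exI[of _ "K powr q * measure \<mu> (space \<mu>)"] conjI ballI)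
    fix f assume f: "f \<in> dirichlet_space p \<alpha>"
    obtain h :: "nat \<times> nat \<Rightarrow> real" where h: "\<And>Q. 0 \<le> h Q"
      "\<And>N. (\<Sum>Q\<in>nodes N. h Q powr p) \<le> C1 * dirichlet_norm p \<alpha> f powr p"
      "\<And>z. z \<in> unit_disk \<Longrightarrow> norm (f z) \<le> (\<Sum>j\<le>gen z. 2 powr (real j * \<tau>) * h (j, arc_index j z))"
      using C1(2)[OF f] by blast
    have N0: "0 \<le> dirichlet_norm p \<alpha> f" by (simp add: dirichlet_norm_def)
    have h_le: "h (j, i) \<le> C1 powr (1 / p) * dirichlet_norm p \<alpha> f" if "i < 2 ^ j" for i j
    proof -
      have "h (j, i) powr p \<le> (\<Sum>Q\<in>nodes j. h Q powr p)"
        using that by (intro member_le_sum) (auto simp: nodes_def)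
      also have "\<dots> \<le> C1 * dirichlet_norm p \<alpha> f powr p" by (rule h(2))
      finally have "(h (j, i) powr p) powr (1 / p) \<le> (C1 * dirichlet_norm p \<alpha> f powr p) powr (1 / p)"
        using p by (intro powr_mono2) auto
      then show ?thesis using p h(1) C1(1) N0 by (simp add: powr_powr powr_mult)
    qed
    have f_le: "norm (f z) \<le> K * dirichlet_norm p \<alpha> f" if z: "z \<in> unit_disk" for z
    proof -
      have "norm (f z) \<le> (\<Sum>j\<le>gen z. 2 powr (real j * \<tau>) * h (j, arc_index j z))" by (rule h(3)[OF z])
      also have "\<dots> \<le> (\<Sum>j\<le>gen z. 2 powr (real j * \<tau>) * (C1 powr (1 / p) * dirichlet_norm p \<alpha> f))"
        by (intro sum_mono mult_left_mono h_le arc_index_less) auto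
      also have "\<dots> = (\<Sum>j\<le>gen z. 2 powr (real j * \<tau>)) * (C1 powr (1 / p) * dirichlet_norm p \<alpha> f)"
        by (simp add: sum_distrib_right)
      also have "\<dots> \<le> G * (C1 powr (1 / p) * dirichlet_norm p \<alpha> f)"
        using N0 by (intro mult_right_mono geom) auto
      finally show ?thesis by (simp add: K_def mult.assoc)
    qed
    have "(\<integral>\<^sup>+z. ennreal (norm (f z) powr q) \<partial>\<mu>) \<le> (\<integral>\<^sup>+z. ennreal ((K * dirichlet_norm p \<alpha> f) powr q) \<partial>\<mu>)"
      using f_le q by (intro nn_integral_mono ennreal_leI powr_mono2) (auto simp: space)
    also have "\<dots> = ennreal ((K * dirichlet_norm p \<alpha> f) powr q * measure \<mu> (space \<mu>))"
      by (simp add: \<mu>.emeasure_eq_measure ennreal_mult)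
    also have "(K * dirichlet_norm p \<alpha> f) powr q * measure \<mu> (space \<mu>) = K powr q * measure \<mu> (space \<mu>) * dirichlet_norm p \<alpha> f powr q"
      using K N0 by (simp add: powr_mult)
    finally show "(\<integral>\<^sup>+z. ennreal (norm (f z) powr q) \<partial>\<mu>) \<le> ennreal (K powr q * measure \<mu> (space \<mu>) * dirichlet_norm p \<alpha> f powr q)" .
  qed simp
qed

text \<open>The total mass of the measure is the Dirichlet integral of g.\<close>

lemma finite_volterra_measure_iff:
  assumes g: "g holomorphic_on unit_disk"
  shows "finite_measure (volterra_measure g q \<beta>) \<longleftrightarrow> g \<in> dirichlet_space q \<beta>"
proof -
  have "emeasure (volterra_measure g q \<beta>) (space disk_area)
    = (\<integral>\<^sup>+z. ennreal ((1 - (norm z)\<^sup>2) powr \<beta> * norm (deriv g z) powr q) * indicator (space disk_area) z \<partial>disk_area)"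
    unfolding volterra_measure_def by (intro emeasure_density volterra_density_measurable g) auto
  also have "\<dots> = dirichlet_integral q \<beta> g"
    unfolding dirichlet_integral_def by (intro nn_integral_cong) (simp add: mult.commute)
  finally have "emeasure (volterra_measure g q \<beta>) (space (volterra_measure g q \<beta>)) = dirichlet_integral q \<beta> g"
    by (simp add: space_volterra_measure space_disk_area)
  then show ?thesis
    using g finite_measure.emeasure_finite[of "volterra_measure g q \<beta>" "space (volterra_measure g q \<beta>)"]
    by (auto simp: dirichlet_space_def less_top intro: finite_measureI)
qed

theorem theorem2:
  fixes \<alpha> \<beta> p q :: real and g :: "complex \<Rightarrow> complex"
  assumes "\<alpha> > -1" and "\<beta> > -1"
    and "g holomorphic_on unit_disk"
    and "0 < p" and "p < q"
  shows
    "(p < \<alpha> + 2 \<longrightarrow>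
        (bounded_dirichlet_operator p \<alpha> q \<beta> (volterra g) \<longleftrightarrow>
         carleson_measure (q * (\<alpha> + 2 - p) / p) (volterra_measure g q \<beta>))) \<and>
     (p = \<alpha> + 2 \<longrightarrow>
        (bounded_dirichlet_operator p \<alpha> q \<beta> (volterra g) \<longleftrightarrow>
         (\<exists>C>0. \<forall>I. circle_arc I \<and> arc_length I < 1 \<longrightarrow>
            emeasure (volterra_measure g q \<beta>) (carleson_square I)
              \<le> ennreal (C * ln (1 / arc_length I) powr ((1 / p - 1) * q))))) \<and>
     (p > \<alpha> + 2 \<longrightarrow>
        (bounded_dirichlet_operator p \<alpha> q \<beta> (volterra g) \<longleftrightarrow>
         finite_measure (volterra_measure g q \<beta>)) \<and>
        (bounded_dirichlet_operator p \<alpha> q \<beta> (volterra g) \<longleftrightarrow>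
         g \<in> dirichlet_space q \<beta>))"
proof -
  note g = assms(3)
  have q: "0 < q" using assms by simp
  note iff = bounded_volterra_iff[OF assms(4) q g]
  note sets = sets_volterra_measure[of g q \<beta>]
  have one: "bounded_dirichlet_operator p \<alpha> q \<beta> (volterra g) \<longleftrightarrow>
      carleson_measure (q * (\<alpha> + 2 - p) / p) (volterra_measure g q \<beta>)" if "p < \<alpha> + 2"
    unfolding iff
    using carleson_measure_necessary[OF assms(1,4) q _ sets] carleson_measure_sufficient[OF assms(4,5) that sets]
    by meson
  have two: "bounded_dirichlet_operator p \<alpha> q \<beta> (volterra g) \<longleftrightarrow>
      (\<exists>C>0. \<forall>I. circle_arc I \<and> arc_length I < 1 \<longrightarrow>
        emeasure (volterra_measure g q \<beta>) (carleson_square I) \<le> ennreal (C * ln (1 / arc_length I) powr ((1 / p - 1) * q)))"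
    if "p = \<alpha> + 2"
  proof -
    \<comment> \<open>On the critical line \<alpha> > -1 forces p > 1, so the conjugate exponent
      exists.\<close>
    have p: "1 < p" and \<alpha>: "\<alpha> = p - 2" using that assms(1) by auto
    show ?thesis
      unfolding iff \<alpha>
      using log_carleson_necessary[OF p q _ sets]
        log_carleson_sufficient[OF p assms(5) _ sets emeasure_volterra_half_disk_finite[OF g q]]
      by meson
  qed
  have three: "bounded_dirichlet_operator p \<alpha> q \<beta> (volterra g) \<longleftrightarrow> finite_measure (volterra_measure g q \<beta>)"
    if "p > \<alpha> + 2"
  proof
    assume "bounded_dirichlet_operator p \<alpha> q \<beta> (volterra g)"
    then obtain C where "dirichlet_embedding p \<alpha> q (volterra_measure g q \<beta>) C"
      unfolding iff by blast
    then have "emeasure (volterra_measure g q \<beta>) (space (volterra_measure g q \<beta>)) \<le> ennreal C"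
      by (rule emeasure_le_of_embedding)
    then show "finite_measure (volterra_measure g q \<beta>)"
      by (intro finite_measureI) (auto simp: top_unique)
  next
    assume "finite_measure (volterra_measure g q \<beta>)"
    then show "bounded_dirichlet_operator p \<alpha> q \<beta> (volterra g)"
      unfolding iff by (intro finite_measure_sufficient[OF assms(4) q that _ sets])
  qed
  show ?thesis
    using one two three finite_volterra_measure_iff[OF g, of q \<beta>] by blast
qed

end
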